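(* Let $C\subset(\mathbb C^* )^n$ be a closed analytic curve with finitely many irreducible components. If the logarithmic limit set $\mathcal L^\infty(C)\subset S^{n-1}$ is finite, then $C$ is algebraic, i.e. $C$ is a closed algebraic subvariety of the algebraic torus $(\mathbb C^* )^n$.
   Context: With $\mathrm{Log}(z)=(\log|z_1|,\dots,\log|z_n|)$ for $z\in(\mathbb C^* )^n$, the logarithmic limit set of a subset $C\subset(\mathbb C^* )^n$ is the set $\mathcal L^\infty(C)$ of all $\xi\in S^{n-1}$ for which there is a sequence $z_m\in C$ with $\|\mathrm{Log}\,z_m\|\to+\infty$ and $\mathrm{Log}\,z_m/\|\mathrm{Log}\,z_m\|\to\xi$. A closed analytic curve is a closed (reduced) complex analytic subset of pure dimension one. *)

theory Defs
  imports "HOL-Analysis.Analysis"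
begin

definition complex_torus :: "(complex ^ 'n) set" where
  "complex_torus = {z. \<forall>i. z $ i \<noteq> 0}"


subsection \<open>Holomorphic functions and maps of several variables\<close>

text \<open>
  The library's \<open>holomorphic_on\<close> is about one variable only. Here a function is holomorphic on
  an open set if it is complex differentiable at each of its points: the real Frechet derivative
  exists and is complex linear (additivity being part of \<open>has_derivative\<close>).
\<close>

definition holo_fun_on :: "(complex ^ 'n \<Rightarrow> complex) \<Rightarrow> (complex ^ 'n) set \<Rightarrow> bool" where
  "holo_fun_on f U \<longleftrightarrow>
     (\<forall>z\<in>U. \<exists>f'. (f has_derivative f') (at z) \<and> (\<forall>c v. f' (c *s v) = c * f' v))"

definition holo_map_on :: "(complex ^ 'n \<Rightarrow> complex ^ 'm) \<Rightarrow> (complex ^ 'n) set \<Rightarrow> bool" where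
  "holo_map_on f U \<longleftrightarrow> (\<forall>i. holo_fun_on (\<lambda>z. f z $ i) U)"


subsection \<open>Analytic subsets\<close>

text \<open>
  The local equations are required around every point of the open set \<open>U\<close>, not only around
  the points of \<open>A\<close>; this makes \<open>A\<close> closed in \<open>U\<close>.
\<close>

definition closed_analytic_subset :: "(complex ^ 'n) set \<Rightarrow> (complex ^ 'n) set \<Rightarrow> bool" where
  "closed_analytic_subset U A \<longleftrightarrow> A \<subseteq> U \<and>
     (\<forall>p\<in>U. \<exists>V F. open V \<and> p \<in> V \<and> V \<subseteq> U \<and> finite F \<and> (\<forall>f\<in>F. holo_fun_on f V) \<and>
        A \<inter> V = {z\<in>V. \<forall>f\<in>F. f z = 0})"

text \<open>
  \<open>A\<close> is, near \<open>q\<close>, a complex submanifold of complex dimension \<open>d\<close>: after a biholomorphic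
  change of coordinates it is a coordinate subspace with \<open>d\<close> free coordinates.
\<close>

definition regular_point_of_dim :: "(complex ^ 'n) set \<Rightarrow> nat \<Rightarrow> complex ^ 'n \<Rightarrow> bool" where
  "regular_point_of_dim A d q \<longleftrightarrow> q \<in> A \<and>
     (\<exists>V W (\<phi> :: complex ^ 'n \<Rightarrow> complex ^ 'n) \<psi> I. open V \<and> q \<in> V \<and> open W \<and>
        holo_map_on \<phi> V \<and> holo_map_on \<psi> W \<and> homeomorphism V W \<phi> \<psi> \<and>
        card (- I) = d \<and> \<phi> ` (A \<inter> V) = {w\<in>W. \<forall>i\<in>I. w $ i = 0})"

text \<open>
  The dimension of \<open>A\<close> at \<open>p\<close> is the limes superior of the dimensions at regular points tending
  to \<open>p\<close>, that is, the greatest dimension occurring in every neighbourhood of \<open>p\<close>.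
\<close>

definition has_dim_at :: "(complex ^ 'n) set \<Rightarrow> complex ^ 'n \<Rightarrow> nat \<Rightarrow> bool" where
  "has_dim_at A p d \<longleftrightarrow>
     (let D = {k. \<forall>V. open V \<and> p \<in> V \<longrightarrow> (\<exists>q\<in>V. regular_point_of_dim A k q)}
      in d \<in> D \<and> (\<forall>k\<in>D. k \<le> d))"

definition pure_dimensional :: "(complex ^ 'n) set \<Rightarrow> nat \<Rightarrow> bool" where
  "pure_dimensional A d \<longleftrightarrow> (\<forall>p\<in>A. has_dim_at A p d)"

definition closed_analytic_curve :: "(complex ^ 'n) set \<Rightarrow> (complex ^ 'n) set \<Rightarrow> bool" where
  "closed_analytic_curve U C \<longleftrightarrow> closed_analytic_subset U C \<and> pure_dimensional C 1"

definition irreducible_analytic :: "(complex ^ 'n) set \<Rightarrow> (complex ^ 'n) set \<Rightarrow> bool" where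
  "irreducible_analytic U A \<longleftrightarrow> closed_analytic_subset U A \<and> A \<noteq> {} \<and>
     (\<forall>B1 B2. closed_analytic_subset U B1 \<and> closed_analytic_subset U B2 \<and> A = B1 \<union> B2 \<longrightarrow>
        A = B1 \<or> A = B2)"

definition irreducible_components :: "(complex ^ 'n) set \<Rightarrow> (complex ^ 'n) set \<Rightarrow> (complex ^ 'n) set set"
  where
  "irreducible_components U A =
     {Z. irreducible_analytic U Z \<and> Z \<subseteq> A \<and>
         (\<forall>Z'. irreducible_analytic U Z' \<and> Z \<subseteq> Z' \<and> Z' \<subseteq> A \<longrightarrow> Z' = Z)}"


subsection \<open>The logarithmic limit set\<close>

definition Log_map :: "complex ^ 'n \<Rightarrow> real ^ 'n" where
  "Log_map z = (\<chi> i. ln (cmod (z $ i)))"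

definition log_limit_set :: "(complex ^ 'n) set \<Rightarrow> (real ^ 'n) set" where
  "log_limit_set C = {\<xi> \<in> sphere 0 1. \<exists>z :: nat \<Rightarrow> complex ^ 'n.
     (\<forall>m. z m \<in> C) \<and>
     filterlim (\<lambda>m. norm (Log_map (z m))) at_top sequentially \<and>
     (\<lambda>m. Log_map (z m) /\<^sub>R norm (Log_map (z m))) \<longlonglongrightarrow> \<xi>}"


subsection \<open>Algebraic subsets of the torus\<close>

text \<open>
  Regular functions on the torus are Laurent polynomials; exponent vectors are functions from
  the index type to \<open>int\<close>.
\<close>

definition laurent_polynomial :: "(complex ^ 'n \<Rightarrow> complex) \<Rightarrow> bool" where
  "laurent_polynomial f \<longleftrightarrow>
     (\<exists>(S :: ('n \<Rightarrow> int) set) c. finite S \<and>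
        f = (\<lambda>z. \<Sum>\<alpha>\<in>S. c \<alpha> * (\<Prod>i\<in>UNIV. (z $ i) powi \<alpha> i)))"

definition algebraic_in_torus :: "(complex ^ 'n) set \<Rightarrow> bool" where
  "algebraic_in_torus C \<longleftrightarrow>
     (\<exists>F. (\<forall>f\<in>F. laurent_polynomial f) \<and> C = {z\<in>complex_torus. \<forall>f\<in>F. f z = 0})"

end

theory Submission
  imports Defs "HOL-Complex_Analysis.Complex_Analysis"
begin

text \<open>
  Since the logarithmic limit set is finite, some integer vector \<open>a\<close> is orthogonal to none of its
  points. On \<open>C\<close> the norm of \<open>Log z\<close> is then bounded linearly by \<open>\<bar>a \<bullet> Log z\<bar>\<close>, so the monomial
  \<open>w = z\<^sup>a\<close> is a proper map from \<open>C\<close> to the punctured plane and all coordinates grow at most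
  polynomially in \<open>\<bar>w\<bar> + 1/\<bar>w\<bar>\<close>. Given a polynomial \<open>l\<close>, the image of \<open>C\<close> under \<open>(z\<^sup>a, l)\<close> is an
  analytic set \<open>\<Gamma>\<close> of pairs \<open>(w, u)\<close>, finite over each \<open>w\<close>; this is proved by eliminating the
  coordinates of \<open>z\<close> one at a time, with products over the roots of a local equation playing the
  role of resultants. Outside a discrete set of \<open>w\<close>, \<open>\<Gamma>\<close> is locally a union of holomorphic graphs,
  because no point of \<open>C\<close> is isolated. Hence the coefficients of \<open>\<Prod>\<^sub>u (X - u)\<close>, with \<open>u\<close> running over the
  fibre of \<open>\<Gamma>\<close>, extend to holomorphic functions of \<open>w \<noteq> 0\<close> of polynomial growth, that is, to Laurent
  polynomials. Substituting \<open>w = z\<^sup>a\<close>, \<open>X = l z\<close> gives a Laurent polynomial that vanishes on \<open>C\<close> and,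
  if \<open>l\<close> separates \<open>q \<notin> C\<close> from the finitely many points of \<open>C\<close> over \<open>q\<^sup>a\<close>, not at \<open>q\<close>.
\<close>

section \<open>Separately holomorphic functions\<close>

text \<open>The elimination amounts to Remmert's finite mapping theorem. It stays elementary because
  a set only has to be cut out locally by holomorphic functions: for each point off the projection
  it is enough to find one function that vanishes on the projection and not at that point. Two
  mismatches shape the rest. A local equation counts its roots with multiplicity, which is what
  makes their power sums holomorphic (argument principle), whereas a fibre of \<Gamma> counts each
  point once; and the equation may have roots off \<Gamma>. The first is met by working where the
  number of distinct roots is constant, so that every root is a holomorphic function of w. The
  second is met by the identity theorem: such a branch lies locally entirely inside or entirely
  outside \<Gamma>, provided that points of \<Gamma> are limits of points of \<Gamma> with other
  values of w.\<close>

definition upd :: "complex ^ 'k \<Rightarrow> 'k \<Rightarrow> complex \<Rightarrow> complex ^ 'k" where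
  "upd x i t = (\<chi> j. if j = i then t else x $ j)"

lemma upd_nth [simp]: "upd x i t $ j = (if j = i then t else x $ j)"
  by (simp add: upd_def)

lemma upd_upd [simp]: "upd (upd x i s) i t = upd x i t"
  by (simp add: vec_eq_iff)

lemma upd_self [simp]: "upd x i (x $ i) = x"
  by (simp add: vec_eq_iff)

lemma upd_commute: "i \<noteq> j \<Longrightarrow> upd (upd x i s) j t = upd (upd x j t) i s"
  by (simp add: vec_eq_iff)

lemma continuous_on_upd [continuous_intros]:
  assumes "continuous_on S f" "continuous_on S g"
  shows "continuous_on S (\<lambda>x. upd (f x) i (g x))"
  unfolding upd_def
proof (rule continuous_on_vec_lambda)
  fix j
  show "continuous_on S (\<lambda>x. if j = i then g x else f x $ j)"
    using assms by (cases "j = i") (auto intro!: continuous_intros)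
qed

text \<open>Joint continuity is built in, so neither Hartogs' theorem nor Osgood's lemma is needed.\<close>

definition sephol :: "(complex ^ 'k \<Rightarrow> complex) \<Rightarrow> (complex ^ 'k) set \<Rightarrow> bool" where
  "sephol f U \<longleftrightarrow> continuous_on U f \<and>
     (\<forall>x\<in>U. \<forall>i. (\<lambda>t. f (upd x i t)) field_differentiable (at (x $ i)))"

lemma sephol_imp_continuous_on: "sephol f U \<Longrightarrow> continuous_on U f"
  by (simp add: sephol_def)

lemma sephol_subset: "sephol f U \<Longrightarrow> V \<subseteq> U \<Longrightarrow> sephol f V"
  unfolding sephol_def by (meson continuous_on_subset subsetD)

lemma sephol_const [simp, intro]: "sephol (\<lambda>x. c) U"
  by (simp add: sephol_def)

lemma sephol_add: "sephol f U \<Longrightarrow> sephol g U \<Longrightarrow> sephol (\<lambda>x. f x + g x) U"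
  unfolding sephol_def by (auto intro!: continuous_intros derivative_intros field_differentiable_add)

lemma sephol_minus: "sephol f U \<Longrightarrow> sephol (\<lambda>x. - f x) U"
  unfolding sephol_def by (auto intro!: continuous_intros field_differentiable_minus)

lemma sephol_diff: "sephol f U \<Longrightarrow> sephol g U \<Longrightarrow> sephol (\<lambda>x. f x - g x) U"
  unfolding sephol_def by (auto intro!: continuous_intros field_differentiable_diff)

lemma sephol_mult: "sephol f U \<Longrightarrow> sephol g U \<Longrightarrow> sephol (\<lambda>x. f x * g x) U"
  unfolding sephol_def by (auto intro!: continuous_intros field_differentiable_mult)

lemma sephol_divide:
  "sephol f U \<Longrightarrow> sephol g U \<Longrightarrow> (\<And>x. x \<in> U \<Longrightarrow> g x \<noteq> 0) \<Longrightarrow> sephol (\<lambda>x. f x / g x) U"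
  unfolding sephol_def by (auto intro!: continuous_intros field_differentiable_divide)

lemma sephol_power: "sephol f U \<Longrightarrow> sephol (\<lambda>x. f x ^ n) U"
  by (induction n) (auto intro: sephol_mult)

lemma sephol_sum: "(\<And>a. a \<in> I \<Longrightarrow> sephol (f a) U) \<Longrightarrow> sephol (\<lambda>x. \<Sum>a\<in>I. f a x) U"
  by (induction I rule: infinite_finite_induct) (auto intro: sephol_add)

lemma sephol_prod: "(\<And>a. a \<in> I \<Longrightarrow> sephol (f a) U) \<Longrightarrow> sephol (\<lambda>x. \<Prod>a\<in>I. f a x) U"
  by (induction I rule: infinite_finite_induct) (auto intro: sephol_mult)

lemma sephol_nth: "sephol (\<lambda>x. x $ j) U"
  unfolding sephol_def
proof (intro conjI ballI allI)
  fix x :: "complex ^ 'a" and i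
  show "(\<lambda>t. upd x i t $ j) field_differentiable at (x $ i)"
    by (cases "j = i") auto
qed (auto intro!: continuous_intros)

lemma open_upd_slice: "open U \<Longrightarrow> open {t. upd x i t \<in> U}"
  using continuous_on_open_vimage[of UNIV "\<lambda>t. upd x i t"] 
  by (auto simp: vimage_def intro!: continuous_intros)

lemma sephol_slice:
  assumes "sephol f U"
  shows "(\<lambda>t. f (upd x i t)) holomorphic_on {t. upd x i t \<in> U}"
  unfolding holomorphic_on_def
proof safe
  fix t assume "upd x i t \<in> U"
  with assms have "(\<lambda>s. f (upd (upd x i t) i s)) field_differentiable (at (upd x i t $ i))"
    unfolding sephol_def by blast
  then show "(\<lambda>t. f (upd x i t)) field_differentiable at t within {t. upd x i t \<in> U}"
    by (simp add: field_differentiable_at_within)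
qed

lemma sephol_upd:
  assumes "sephol f W" "open B" and B: "\<And>x. x \<in> B \<Longrightarrow> upd x i t \<in> W"
  shows "sephol (\<lambda>x. f (upd x i t)) B"
  unfolding sephol_def
proof (intro conjI ballI allI)
  show "continuous_on B (\<lambda>x. f (upd x i t))"
    using assms(1) B unfolding sephol_def
    by (auto intro!: continuous_on_compose2[of W f] continuous_intros)
next
  fix x j assume x: "x \<in> B"
  show "(\<lambda>s. f (upd (upd x j s) i t)) field_differentiable at (x $ j)"
  proof (cases "i = j")
    case False
    then have "(\<lambda>s. f (upd (upd x j s) i t)) = (\<lambda>s. f (upd (upd x i t) j s))"
      by (simp add: upd_commute)
    moreover have "(\<lambda>s. f (upd (upd x i t) j s)) field_differentiable at (upd x i t $ j)"
      using assms(1) B[OF x] unfolding sephol_def by blast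
    ultimately show ?thesis using False by auto
  qed auto
qed

lemma sephol_local:
  assumes "\<And>x. x \<in> U \<Longrightarrow> \<exists>B. open B \<and> x \<in> B \<and> sephol f B"
  shows "sephol f U"
proof -
  have "continuous (at x) f" if "x \<in> U" for x
    using assms[OF that] unfolding sephol_def by (auto simp: continuous_on_eq_continuous_at)
  then have "continuous_on U f"
    by (simp add: continuous_at_imp_continuous_on)
  then show ?thesis
    using assms unfolding sephol_def by blast
qed

lemma sephol_cong: 
  assumes "sephol f U" "open U" "\<And>x. x \<in> U \<Longrightarrow> f x = g x"
  shows "sephol g U"
  unfolding sephol_def
proof (intro conjI ballI allI)
  show "continuous_on U g"
    using assms by (metis continuous_on_cong sephol_def)
  fix x i assume x: "x \<in> U"
  have "(\<lambda>t. f (upd x i t)) field_differentiable (at (x $ i))"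
    using assms(1) x unfolding sephol_def by blast
  moreover have "eventually (\<lambda>t. f (upd x i t) = g (upd x i t)) (nhds (x $ i))"
    unfolding eventually_nhds
    by (rule exI[of _ "{t. upd x i t \<in> U}"]) (use assms x in \<open>auto intro: open_upd_slice\<close>)
  ultimately show "(\<lambda>t. g (upd x i t)) field_differentiable (at (x $ i))"
    unfolding field_differentiable_def by (auto simp: DERIV_cong_ev)
qed

section \<open>Contour integrals depending on parameters\<close>

lemma continuous_on_contour_integral_circlepath:
  fixes G :: "'a::topological_space \<Rightarrow> complex \<Rightarrow> complex"
  assumes "continuous_on (B \<times> sphere z r) (\<lambda>(x, \<eta>). G x \<eta>)" "r \<ge> 0"
  shows "continuous_on B (\<lambda>x. contour_integral (circlepath z r) (G x))"
proof -
  have "continuous_on (B \<times> cbox 0 1)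
      (\<lambda>(x, t). G x (circlepath z r t) * vector_derivative (circlepath z r) (at t))"
    unfolding vector_derivative_circlepath split_def
  proof (intro continuous_intros)
    show "continuous_on (B \<times> cbox 0 1) (\<lambda>p. G (fst p) (circlepath z r (snd p)))"
    proof -
      have 1: "continuous_on (B \<times> cbox 0 1) (\<lambda>p. (fst p, circlepath z r (snd p)))"
        unfolding circlepath_def part_circlepath_def linepath_def by (intro continuous_intros)
      have 2: "(\<lambda>p. (fst p, circlepath z r (snd p))) ` (B \<times> cbox 0 1) \<subseteq> B \<times> sphere z r"
        using assms(2) path_image_circlepath[of z r] unfolding path_image_def by fastforce
      from continuous_on_compose2[OF assms(1) 1 2] show ?thesis by simp
    qed
  qed
  from integral_continuous_on_param[OF this] show ?thesis
    by (simp add: contour_integral_integral)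
qed

text \<open>By Fubini and Cauchy's formula for each fixed \<eta>, the integral reproduces its own
  values from a small circle in \<open>V\<close>; a continuous function that does so is
  differentiable.\<close>

lemma holomorphic_on_contour_integral_circlepath:
  fixes g :: "complex \<Rightarrow> complex \<Rightarrow> complex"
  assumes V: "open V" and r: "r \<ge> 0"
    and cont: "continuous_on (V \<times> sphere z r) (\<lambda>(\<tau>, \<eta>). g \<tau> \<eta>)"
    and hol: "\<And>\<eta>. \<eta> \<in> sphere z r \<Longrightarrow> (\<lambda>\<tau>. g \<tau> \<eta>) holomorphic_on V"
  shows "(\<lambda>\<tau>. contour_integral (circlepath z r) (g \<tau>)) holomorphic_on V"
proof -
  define I where "I \<tau> = contour_integral (circlepath z r) (g \<tau>)" for \<tau>
  have I_cont: "continuous_on V I"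
    unfolding I_def by (rule continuous_on_contour_integral_circlepath[OF cont r])
  have "I field_differentiable (at a)" if a: "a \<in> V" for a
  proof -
    obtain \<rho> where \<rho>: "\<rho> > 0" "cball a \<rho> \<subseteq> V"
      using V a open_contains_cball by blast
    have sph: "sphere a \<rho> \<subseteq> V" using \<rho> by auto
    have contS: "continuous_on (sphere a \<rho>) I" using I_cont sph continuous_on_subset by blast
    have eq: "((\<lambda>u. I u / (u - w)) has_contour_integral (2 * of_real pi * \<i> * I w)) (circlepath a \<rho>)"
      if w: "w \<in> ball a \<rho>" for w
    proof -
      have wn: "w \<notin> sphere a \<rho>" using w by auto
      have cint: "(\<lambda>u. I u / (u - w)) contour_integrable_on (circlepath a \<rho>)"
        using \<rho> wn by (intro contour_integrable_continuous_circlepath continuous_intros) 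
          (auto intro: contS)
      have "contour_integral (circlepath a \<rho>) (\<lambda>u. I u / (u - w)) =
          contour_integral (circlepath a \<rho>) (\<lambda>u. contour_integral (circlepath z r) (\<lambda>\<eta>. g u \<eta> / (u - w)))"
        unfolding I_def
        apply (rule contour_integral_cong[OF refl])
        apply (subst contour_integral_div)
        using \<rho> r sph apply (auto intro!: contour_integrable_continuous_circlepath
            continuous_on_compose2[OF cont, of _ "\<lambda>\<eta>. (_, \<eta>)", simplified] continuous_intros)
        done
      also have "\<dots> = contour_integral (circlepath z r) (\<lambda>\<eta>. contour_integral (circlepath a \<rho>) (\<lambda>u. g u \<eta> / (u - w)))"
      proof (rule contour_integral_swap)
        show "continuous_on (path_image (circlepath a \<rho>) \<times> path_image (circlepath z r)) (\<lambda>(u, \<eta>). g u \<eta> / (u - w))"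
          unfolding split_def using \<rho> r wn sph
          by (auto intro!: continuous_intros continuous_on_compose2[OF cont, of _ "\<lambda>p. p", simplified split_def])
      qed (auto simp: vector_derivative_circlepath intro!: continuous_intros)
      also have "\<dots> = contour_integral (circlepath z r) (\<lambda>\<eta>. 2 * of_real pi * \<i> * g w \<eta>)"
      proof (rule contour_integral_cong[OF refl])
        fix \<eta> assume "\<eta> \<in> path_image (circlepath z r)"
        then have \<eta>: "\<eta> \<in> sphere z r" using r by simp
        show "contour_integral (circlepath a \<rho>) (\<lambda>u. g u \<eta> / (u - w)) = 2 * of_real pi * \<i> * g w \<eta>"
          apply (rule contour_integral_unique, rule Cauchy_integral_circlepath_simple)
          using hol[OF \<eta>] \<rho> w by (auto simp: dist_norm norm_minus_commute intro: holomorphic_on_subset)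
      qed
      also have "\<dots> = 2 * of_real pi * \<i> * I w"
      proof -
        have "w \<in> V" using w \<rho> by auto
        then show ?thesis unfolding I_def
          by (intro contour_integral_lmul contour_integrable_continuous_circlepath)
            (use r in \<open>auto intro!: continuous_on_compose2[OF cont, of _ "\<lambda>\<eta>. (w, \<eta>)", simplified] continuous_intros\<close>)
      qed
      finally show ?thesis using cint
        by (metis has_contour_integral_integral)
    qed
    \<comment> \<open>By \<open>eq\<close> the function is the Cauchy integral of its continuous
      boundary values, which may be differentiated under the integral sign.\<close>
    have "((\<lambda>w. 2 * of_real pi * \<i> * I w) has_field_derivative
        (1 * contour_integral (circlepath a \<rho>) (\<lambda>u. I u / (u - a) ^ 2))) (at a)"
      using Cauchy_next_derivative_circlepath(2)[of a \<rho> I 1 "\<lambda>w. 2 * of_real pi * \<i> * I w" a] contS eq \<rho>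
      by (simp add: power2_eq_square)
    from DERIV_cdivide[OF this, of "2 * of_real pi * \<i>"] show ?thesis
      by (auto simp: field_differentiable_def)
  qed
  then show ?thesis
    unfolding I_def[symmetric] holomorphic_on_def using field_differentiable_at_within by blast
qed

lemma sephol_contour_integral:
  fixes G :: "complex ^ 'k \<Rightarrow> complex \<Rightarrow> complex"
  assumes B: "open B" and r: "r \<ge> 0"
    and cont: "continuous_on (B \<times> sphere z r) (\<lambda>(x, \<eta>). G x \<eta>)"
    and hol: "\<And>\<eta>. \<eta> \<in> sphere z r \<Longrightarrow> sephol (\<lambda>x. G x \<eta>) B"
  shows "sephol (\<lambda>x. contour_integral (circlepath z r) (G x)) B"
  unfolding sephol_def
proof (intro conjI ballI allI)
  show "continuous_on B (\<lambda>x. contour_integral (circlepath z r) (G x))"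
    by (rule continuous_on_contour_integral_circlepath[OF cont r])
next
  fix x i assume x: "x \<in> B"
  let ?V = "{t. upd x i t \<in> B}"
  have "(\<lambda>\<tau>. contour_integral (circlepath z r) ((\<lambda>\<tau>. G (upd x i \<tau>)) \<tau>)) holomorphic_on ?V"
  proof (rule holomorphic_on_contour_integral_circlepath)
    show "open ?V" using B by (rule open_upd_slice)
    show "continuous_on (?V \<times> sphere z r) (\<lambda>(\<tau>, \<eta>). G (upd x i \<tau>) \<eta>)"
      unfolding split_def
      by (rule continuous_on_compose2[OF cont, of _ "\<lambda>p. (upd x i (fst p), snd p)", simplified])
        (auto intro!: continuous_intros)
  qed (use r sephol_slice[OF hol] in auto)
  then show "(\<lambda>t. contour_integral (circlepath z r) (G (upd x i t))) field_differentiable at (x $ i)"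
    using x open_upd_slice[OF B, of x i] by (intro holomorphic_on_imp_differentiable_at[of _ ?V]) auto
qed

lemma norm_axis: "norm (axis i c) = norm c"
  by (simp add: norm_vec_def L2_set_def axis_def if_distrib[of norm] if_distrib[of "\<lambda>x. x\<^sup>2"] cong: if_cong)

lemma dist_upd: "dist (upd x i s) (upd x i t) = dist s t"
proof -
  have "upd x i s - upd x i t = axis i (s - t)" by (simp add: vec_eq_iff axis_def)
  then show ?thesis by (simp add: dist_norm norm_axis)
qed

text \<open>Cauchy's formula on a circle of fixed radius turns the partial derivative into a
  parameter integral. There \<open>y $ i\<close> occurs only in the kernel, since
  \<open>upd y i \<eta>\<close> overwrites it.\<close>

lemma sephol_partial_deriv:
  assumes W: "open W" and f: "sephol f W"
  shows "sephol (\<lambda>y. deriv (\<lambda>t. f (upd y i t)) (y $ i)) W"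
proof (rule sephol_local)
  fix y0 assume y0: "y0 \<in> W"
  obtain e where e: "e > 0" "cball y0 e \<subseteq> W"
    using W y0 open_contains_cball by blast
  \<comment> \<open>Half of \<open>e\<close>, because \<open>upd y i t\<close> deviates from
    \<open>y0\<close> by at most \<rho> through \<open>y\<close> and again by at most \<rho> through
    \<open>t\<close>.\<close>
  define \<rho> where "\<rho> = e / 2"
  define B where "B = ball y0 \<rho>"
  let ?c = "y0 $ i"
  have upd_in: "upd y i t \<in> W" if "y \<in> B" "t \<in> cball ?c \<rho>" for y t
  proof -
    have "y0 - upd y i t = (\<chi> j. if j = i then 0 else (y0 - y) $ j) + axis i (?c - t)"
      by (auto simp: vec_eq_iff axis_def)
    then have "norm (y0 - upd y i t) \<le> norm (\<chi> j. if j = i then 0 else (y0 - y) $ j) + norm (axis i (?c - t) :: complex ^ 'a)"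
      by (metis norm_triangle_ineq)
    also have "norm (\<chi> j. if j = i then 0 else (y0 - y) $ j) \<le> norm (y0 - y)"
      by (rule norm_le_componentwise_cart) auto
    also have "norm (axis i (?c - t) :: complex ^ 'a) = cmod (?c - t)"
      by (rule norm_axis)
    also have "norm (y0 - y) + cmod (?c - t) \<le> \<rho> + \<rho>"
      using that by (intro add_mono) (auto simp: B_def dist_norm)
    finally show ?thesis using e by (auto simp: \<rho>_def dist_norm)
  qed
  have comp: "y $ i \<in> ball ?c \<rho>" if "y \<in> B" for y
    using that dist_vec_nth_le[of y0 i y] by (auto simp: B_def)
  have \<rho>: "\<rho> > 0" using e by (simp add: \<rho>_def)
  have ne: "\<eta> - y $ i \<noteq> 0" if "y \<in> B" "\<eta> \<in> sphere ?c \<rho>" for y \<eta>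
    using comp[OF that(1)] that(2) by auto
  have BW: "B \<subseteq> W" using e by (auto simp: B_def \<rho>_def)
  have "sephol (\<lambda>y. contour_integral (circlepath ?c \<rho>) (\<lambda>\<eta>. f (upd y i \<eta>) / (\<eta> - y $ i)^2)) B"
  proof (rule sephol_contour_integral)
    show "continuous_on (B \<times> sphere ?c \<rho>) (\<lambda>(x, \<eta>). f (upd x i \<eta>) / (\<eta> - x $ i)\<^sup>2)"
      unfolding split_def
    proof (intro continuous_intros)
      show "continuous_on (B \<times> sphere ?c \<rho>) (\<lambda>x. f (upd (fst x) i (snd x)))"
        by (rule continuous_on_compose2[OF sephol_imp_continuous_on[OF f]])
          (auto intro!: continuous_intros upd_in)
    qed (use ne in auto)
    fix \<eta> assume \<eta>: "\<eta> \<in> sphere ?c \<rho>"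
    show "sephol (\<lambda>x. f (upd x i \<eta>) / (\<eta> - x $ i)\<^sup>2) B"
      by (intro sephol_divide sephol_power sephol_diff sephol_const sephol_nth sephol_upd[OF f])
        (use \<eta> ne upd_in in \<open>auto simp: B_def\<close>)
  qed (use \<rho> in \<open>auto simp: B_def\<close>)
  then have "sephol (\<lambda>y. (1 / (2 * of_real pi * \<i>)) * contour_integral (circlepath ?c \<rho>) (\<lambda>\<eta>. f (upd y i \<eta>) / (\<eta> - y $ i)^2)) B"
    by (intro sephol_mult sephol_const)
  then have "sephol (\<lambda>y. deriv (\<lambda>t. f (upd y i t)) (y $ i)) B"
  proof (rule sephol_cong)
    show "open B" by (simp add: B_def)
    fix y assume y: "y \<in> B"
    have sub: "cball ?c \<rho> \<subseteq> {t. upd y i t \<in> W}" using upd_in[OF y] by auto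
    have h: "(\<lambda>t. f (upd y i t)) holomorphic_on cball ?c \<rho>"
      using sephol_slice[OF f] sub holomorphic_on_subset by blast
    have "((\<lambda>t. f (upd y i t)) has_field_derivative (1 / (2 * of_real pi * \<i>) *
        contour_integral (circlepath ?c \<rho>) (\<lambda>u. f (upd y i u) / (u - y $ i)^2))) (at (y $ i))"
      by (rule Cauchy_derivative_integral_circlepath(2))
        (use h comp[OF y] in \<open>auto intro: holomorphic_on_imp_continuous_on holomorphic_on_subset\<close>)
    then show "1 / (2 * of_real pi * \<i>) * contour_integral (circlepath ?c \<rho>) (\<lambda>u. f (upd y i u) / (u - y $ i)^2) =
        deriv (\<lambda>t. f (upd y i t)) (y $ i)"
      by (simp add: DERIV_imp_deriv)
  qed
  then show "\<exists>B. open B \<and> y0 \<in> B \<and> sephol (\<lambda>y. deriv (\<lambda>t. f (upd y i t)) (y $ i)) B"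
    using \<rho> by (intro exI[of _ B]) (auto simp: B_def)
qed

section \<open>Sums and products over roots\<close>

text \<open>Multiplicities are kept because only with them are the power sums of the roots
  holomorphic in parameters and their number locally constant.\<close>

definition root_mset :: "(complex \<Rightarrow> complex) \<Rightarrow> complex \<Rightarrow> real \<Rightarrow> complex multiset" where
  "root_mset \<phi> z r = (\<Sum>\<zeta>\<in>{\<zeta>\<in>ball z r. \<phi> \<zeta> = 0}. replicate_mset (nat (zorder \<phi> \<zeta>)) \<zeta>)"

lemma cball_subset_open_enlarge:
  fixes z :: "'a::heine_borel"
  assumes "open S" "cball z r \<subseteq> S"
  obtains R where "R > r" "ball z R \<subseteq> S"
proof (cases "S = UNIV")
  case True
  then show ?thesis using that[of "r + 1"] by auto
next
  case False
  then obtain x where x: "x \<in> - S" "\<And>y. y \<in> - S \<Longrightarrow> dist z x \<le> dist z y"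
    using distance_attains_inf[of "- S" z] assms(1) by auto
  have "dist z x > r" using x(1) assms(2) by (meson ComplD linorder_not_less mem_cball subsetD)
  moreover have "ball z (dist z x) \<subseteq> S" using x(2) by fastforce
  ultimately show ?thesis using that by blast
qed

lemma sum_mset_sum_replicate:
  fixes h :: "'a \<Rightarrow> 'b::semiring_1"
  assumes "finite Z"
  shows "(\<Sum>\<zeta>\<in>#(\<Sum>\<zeta>\<in>Z. replicate_mset (n \<zeta>) \<zeta>). h \<zeta>) = (\<Sum>\<zeta>\<in>Z. of_nat (n \<zeta>) * h \<zeta>)"
  using assms by (induction rule: finite_induct) simp_all

lemma set_mset_sum_replicate:
  assumes "finite Z"
  shows "set_mset (\<Sum>\<zeta>\<in>Z. replicate_mset (n \<zeta>) \<zeta>) = {\<zeta>\<in>Z. n \<zeta> > 0}"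
  by (use assms in \<open>auto simp: set_mset_sum set_mset_replicate_mset_subset split: if_splits\<close>)

lemma finite_zeros_cball:
  fixes \<phi> :: "complex \<Rightarrow> complex"
  assumes "\<phi> holomorphic_on ball z R" "r < R" "w \<in> ball z R" "\<phi> w \<noteq> 0"
  shows "finite {\<zeta>\<in>cball z r. \<phi> \<zeta> = 0}"
proof (cases "\<exists>\<zeta>\<in>cball z r. \<phi> \<zeta> = 0")
  case True
  then obtain \<zeta> where \<zeta>: "\<zeta> \<in> cball z r" "\<phi> \<zeta> = 0" by blast
  then have "\<zeta> \<in> ball z R" using assms(2) by auto
  with \<zeta> have "\<zeta> \<in> ball z R" "\<phi> \<zeta> = 0" by auto
  then have "\<not> \<phi> constant_on ball z R"
    using assms(3,4) unfolding constant_on_def by force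
  then show ?thesis
    by (intro holomorphic_compact_finite_zeros[OF assms(1)]) (use assms in auto)
next
  case False
  then have "{\<zeta>\<in>cball z r. \<phi> \<zeta> = 0} = {}" by auto
  then show ?thesis by (simp only: finite.emptyI)
qed

locale zero_free_circle =
  fixes \<phi> :: "complex \<Rightarrow> complex" and S z r
  assumes S: "open S" "cball z r \<subseteq> S" and r: "r > 0" and hol: "\<phi> holomorphic_on S"
    and nz: "\<And>t. t \<in> sphere z r \<Longrightarrow> \<phi> t \<noteq> 0"
begin

lemma nz_point: "z + of_real r \<in> sphere z r" "\<phi> (z + of_real r) \<noteq> 0"
proof -
  show 1: "z + of_real r \<in> sphere z r" using r by (simp add: dist_norm)
  show "\<phi> (z + of_real r) \<noteq> 0" by (rule nz[OF 1])
qed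

lemma finite_zeros: "finite {\<zeta>\<in>ball z r. \<phi> \<zeta> = 0}"
proof -
  obtain R where R: "R > r" "ball z R \<subseteq> S" using cball_subset_open_enlarge[OF S] .
  have "finite {\<zeta>\<in>cball z r. \<phi> \<zeta> = 0}"
    by (rule finite_zeros_cball[of _ _ R _ "z + of_real r"])
      (use R hol nz_point holomorphic_on_subset in auto)
  then show ?thesis by (rule finite_subset[rotated]) auto
qed

lemma zorder_pos: "\<zeta> \<in> ball z r \<Longrightarrow> \<phi> \<zeta> = 0 \<Longrightarrow> zorder \<phi> \<zeta> > 0"
proof -
  assume \<zeta>: "\<zeta> \<in> ball z r" "\<phi> \<zeta> = 0"
  obtain R where R: "R > r" "ball z R \<subseteq> S" using cball_subset_open_enlarge[OF S] .
  have "z + of_real r \<in> ball z R" using nz_point(1) R by auto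
  then have "\<exists>w\<in>ball z R. \<phi> w \<noteq> 0" using nz_point(2) by blast
  moreover have "\<zeta> \<in> ball z R" using \<zeta> R by auto
  ultimately show ?thesis
    using zorder_exist_zero[of \<phi> "ball z R" \<zeta>] \<zeta>(2) holomorphic_on_subset[OF hol R(2)]
    by (simp add: split: if_splits)
qed

lemma set_root_mset: "set_mset (root_mset \<phi> z r) = {\<zeta>\<in>ball z r. \<phi> \<zeta> = 0}"
  unfolding root_mset_def set_mset_sum_replicate[OF finite_zeros] using zorder_pos by auto

lemma contour_integral_root_sum:
  assumes h: "h holomorphic_on S"
  shows "contour_integral (circlepath z r) (\<lambda>\<eta>. deriv \<phi> \<eta> * h \<eta> / \<phi> \<eta>) =
      2 * pi * \<i> * (\<Sum>\<zeta>\<in>#root_mset \<phi> z r. h \<zeta>)"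
proof -
  obtain R where R: "R > r" "ball z R \<subseteq> S" using cball_subset_open_enlarge[OF S] .
  \<comment> \<open>The argument principle needs a domain that contains the circle, hence a slightly
    larger disc. Its zeros beyond the circle have winding number 0 and drop out of the sum.\<close>
  define \<rho> where "\<rho> = (r + R) / 2"
  have \<rho>: "r < \<rho>" "\<rho> < R" using R by (auto simp: \<rho>_def)
  have sub: "ball z \<rho> \<subseteq> S" using \<rho> R(2) subset_ball[of \<rho> R z] by auto
  let ?Z = "{w\<in>ball z \<rho>. \<phi> w = 0 \<or> w \<in> {}}"
  have fin: "finite ?Z"
  proof -
    have "finite {\<zeta>\<in>cball z \<rho>. \<phi> \<zeta> = 0}"
      by (rule finite_zeros_cball[of _ _ R _ "z + of_real r"])
        (use \<rho> R hol nz_point holomorphic_on_subset in auto)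
    then show ?thesis by (rule finite_subset[rotated]) auto
  qed
  have w1: "winding_number (circlepath z r) p = 1" if "p \<in> ball z r" for p
    using that by (intro winding_number_circlepath) (auto simp: dist_norm norm_minus_commute)
  have w0: "winding_number (circlepath z r) p = 0" if "p \<notin> cball z r" for p
    by (rule winding_number_zero_outside[of _ "cball z r"]) (use r that in auto)
  have "contour_integral (circlepath z r) (\<lambda>\<eta>. deriv \<phi> \<eta> * h \<eta> / \<phi> \<eta>) =
      2 * pi * \<i> * (\<Sum>p\<in>?Z. winding_number (circlepath z r) p * h p * zorder \<phi> p)"
  proof (rule argument_principle)
    show "\<forall>p. p \<notin> ball z \<rho> \<longrightarrow> winding_number (circlepath z r) p = 0"
      using w0 \<rho> by auto
  qed (use sub hol h r nz \<rho> fin holomorphic_on_subset in auto)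
  also have "(\<Sum>p\<in>?Z. winding_number (circlepath z r) p * h p * zorder \<phi> p) =
      (\<Sum>p\<in>{\<zeta>\<in>ball z r. \<phi> \<zeta> = 0}. of_nat (nat (zorder \<phi> p)) * h p)"
  proof (rule sum.mono_neutral_cong_right[OF fin])
    show "{\<zeta>\<in>ball z r. \<phi> \<zeta> = 0} \<subseteq> ?Z" using \<rho> by auto
    show "\<forall>p\<in>?Z - {\<zeta>\<in>ball z r. \<phi> \<zeta> = 0}. winding_number (circlepath z r) p * h p * zorder \<phi> p = 0"
    proof
      fix p assume p: "p \<in> ?Z - {\<zeta>\<in>ball z r. \<phi> \<zeta> = 0}"
      then have "p \<notin> ball z r" "p \<notin> sphere z r" using nz by auto
      then have "p \<notin> cball z r" by auto
      then show "winding_number (circlepath z r) p * h p * zorder \<phi> p = 0" using w0 by simp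
    qed
    fix p assume "p \<in> {\<zeta>\<in>ball z r. \<phi> \<zeta> = 0}"
    then show "winding_number (circlepath z r) p * h p * zorder \<phi> p = of_nat (nat (zorder \<phi> p)) * h p"
      using w1[of p] zorder_pos[of p] by simp
  qed
  also have "\<dots> = (\<Sum>\<zeta>\<in>#root_mset \<phi> z r. h \<zeta>)"
    unfolding root_mset_def sum_mset_sum_replicate[OF finite_zeros] ..
  finally show ?thesis .
qed

end

text \<open>The logarithmic derivative of the product is the sum of the series - a / (1 - a X), and
  their geometric expansions add up to the power sums. The coefficients of \<open>P M\<close> are
  the elementary symmetric functions up to sign.\<close>

lemma Newton_fps:
  fixes M :: "'a::field_char_0 multiset"
  defines "P \<equiv> (\<lambda>M. \<Prod>a\<in>#M. 1 - fps_const a * fps_X)"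
  shows "fps_deriv (P M) = - P M * Abs_fps (\<lambda>m. \<Sum>a\<in>#M. a ^ Suc m)"
proof (induction M)
  case (add a M)
  have g: "(1 - fps_const a * fps_X) * Abs_fps (\<lambda>m. a ^ Suc m) = fps_const a"
  proof (rule fps_ext)
    fix n
    show "((1 - fps_const a * fps_X) * Abs_fps (\<lambda>m. a ^ Suc m)) $ n = fps_const a $ n"
      by (cases n) (simp_all add: algebra_simps mult.assoc)
  qed
  have S: "Abs_fps (\<lambda>m. \<Sum>b\<in>#add_mset a M. b ^ Suc m) = Abs_fps (\<lambda>m. a ^ Suc m) + Abs_fps (\<lambda>m. \<Sum>b\<in>#M. b ^ Suc m)"
    by (simp add: fps_eq_iff)
  have P: "P (add_mset a M) = (1 - fps_const a * fps_X) * P M"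
    by (simp add: P_def)
  have "fps_deriv (P (add_mset a M)) = - fps_const a * P M + (1 - fps_const a * fps_X) * fps_deriv (P M)"
    unfolding P by (simp add: algebra_simps fps_const_neg[symmetric] del: fps_const_neg)
  also have "\<dots> = - ((1 - fps_const a * fps_X) * Abs_fps (\<lambda>m. a ^ Suc m)) * P M
      + (1 - fps_const a * fps_X) * (- P M * Abs_fps (\<lambda>m. \<Sum>a\<in>#M. a ^ Suc m))"
    unfolding g add.IH ..
  also have "\<dots> = - P (add_mset a M) * Abs_fps (\<lambda>m. \<Sum>b\<in>#add_mset a M. b ^ Suc m)"
    unfolding P S by (simp add: algebra_simps)
  finally show ?case .
qed (simp add: P_def fps_eq_iff)

text \<open>Newton's identities as a recursion, by comparing coefficients; characteristic 0 allows
  the division.\<close>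

lemma Newton_fps_nth:
  fixes M :: "'a::field_char_0 multiset"
  defines "P \<equiv> (\<lambda>M. \<Prod>a\<in>#M. 1 - fps_const a * fps_X)"
  shows "P M $ Suc k = - (\<Sum>j\<le>k. P M $ j * (\<Sum>a\<in>#M. a ^ Suc (k - j))) / of_nat (Suc k)"
proof -
  have "of_nat (Suc k) * P M $ Suc k = fps_deriv (P M) $ k" by simp
  also have "\<dots> = - (\<Sum>j\<le>k. P M $ j * (\<Sum>a\<in>#M. a ^ Suc (k - j)))"
    unfolding P_def Newton_fps by (simp add: fps_mult_nth sum_negf atLeast0AtMost)
  finally show ?thesis by (simp add: field_simps del: of_nat_Suc)
qed

text \<open>The vanishing of the higher coefficients belongs to the claim because the new top
  coefficient is the old one times \<open>- a\<close> plus a coefficient beyond the old top.\<close>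

lemma fps_nth_prod_mset_size:
  fixes M :: "'a::field_char_0 multiset"
  defines "P \<equiv> (\<lambda>M. \<Prod>a\<in>#M. 1 - fps_const a * fps_X)"
  shows "P M $ size M = (- 1) ^ size M * \<Prod>\<^sub># M \<and> (\<forall>k>size M. P M $ k = 0)"
proof (induction M)
  case (add a M)
  have P: "P (add_mset a M) = (1 - fps_const a * fps_X) * P M"
    by (simp add: P_def)
  have "P (add_mset a M) $ Suc k = P M $ Suc k - a * P M $ k" for k
    unfolding P by (simp add: algebra_simps mult.assoc)
  then show ?case using add.IH by (auto simp: Suc_less_eq2 less_SucI)
qed (auto simp: P_def)

text \<open>By Newton's recursion every coefficient is a polynomial in the power sums, and the
  product is, up to sign, the coefficient of index \<open>d\<close>. A constant size is what fixes
  this index.\<close>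

lemma sephol_prod_mset:
  fixes M :: "complex ^ 'k \<Rightarrow> complex multiset"
  assumes "\<And>m. sephol (\<lambda>x. \<Sum>a\<in>#M x. a ^ Suc m) B" and B: "open B" and "\<And>x. x \<in> B \<Longrightarrow> size (M x) = d"
  shows "sephol (\<lambda>x. \<Prod>\<^sub># (M x)) B"
proof -
  define P where "P = (\<lambda>M :: complex multiset. \<Prod>a\<in>#M. 1 - fps_const a * fps_X)"
  have N: "P M $ Suc k = - (\<Sum>j\<le>k. P M $ j * (\<Sum>a\<in>#M. a ^ Suc (k - j))) / of_nat (Suc k)" for M k
    unfolding P_def by (rule Newton_fps_nth)
  have *: "sephol (\<lambda>x. P (M x) $ k) B" for k
  proof (induction k rule: less_induct)
    case (less k)
    show ?case
    proof (cases k)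
      case 0
      have "P M $ 0 = 1" for M unfolding P_def by (induction M) auto
      then show ?thesis using 0 by simp
    next
      case (Suc n)
      show ?thesis
        unfolding Suc N
        by (intro sephol_divide sephol_minus sephol_sum sephol_mult sephol_const assms(1))
          (auto simp del: of_nat_Suc intro: less simp: Suc)
    qed
  qed
  have "sephol (\<lambda>x. (- 1) ^ d * P (M x) $ d) B"
    by (intro sephol_mult * sephol_const)
  moreover have "P (M x) $ d = (- 1) ^ d * \<Prod>\<^sub># (M x)" if "x \<in> B" for x
    using fps_nth_prod_mset_size[of "M x"] assms(3)[OF that] by (simp add: P_def)
  ultimately show ?thesis
    by (elim sephol_cong[OF _ B]) (simp add: mult.assoc[symmetric] power_mult_distrib[symmetric])
qed

text \<open>The local situation for elimination: one fixed circle in direction \<open>i\<close> is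
  free of zeros for all parameters in \<open>B\<close>, so no root can cross it. A parameter still
  has an entry at \<open>i\<close>, but \<open>upd\<close> overwrites it.\<close>

locale root_disc =
  fixes f :: "complex ^ 'k \<Rightarrow> complex" and W B :: "(complex ^ 'k) set" and i :: 'k and z r
  assumes openW: "open W" and openB: "open B" and rpos: "r > 0" and sephol_f: "sephol f W"
    and inW: "\<And>x t. x \<in> B \<Longrightarrow> t \<in> cball z r \<Longrightarrow> upd x i t \<in> W"
    and nzf: "\<And>x t. x \<in> B \<Longrightarrow> t \<in> sphere z r \<Longrightarrow> f (upd x i t) \<noteq> 0"
begin

abbreviation roots :: "complex ^ 'k \<Rightarrow> complex multiset" where
  "roots x \<equiv> root_mset (\<lambda>t. f (upd x i t)) z r"

lemma circle: "x \<in> B \<Longrightarrow> zero_free_circle (\<lambda>t. f (upd x i t)) {t. upd x i t \<in> W} z r"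
  by unfold_locales
    (use open_upd_slice[OF openW] inW rpos sephol_slice[OF sephol_f] nzf in auto)

lemma set_roots: "x \<in> B \<Longrightarrow> set_mset (roots x) = {\<zeta>\<in>ball z r. f (upd x i \<zeta>) = 0}"
  by (rule zero_free_circle.set_root_mset[OF circle])

text \<open>The argument principle writes the sum as an integral over the fixed circle, with an
  integrand that is separately holomorphic in the parameter.\<close>

lemma sephol_root_sum:
  assumes h: "sephol h W"
  shows "sephol (\<lambda>x. \<Sum>\<zeta>\<in>#roots x. h (upd x i \<zeta>)) B"
proof -
  \<comment> \<open>The partial derivative as a function on \<open>W\<close>; at
    \<open>upd x i \<eta>\<close> it gives the derivative of the slice at \<eta> that the argument
    principle calls for.\<close>
  define g where "g y = deriv (\<lambda>t. f (upd y i t)) (y $ i)" for y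
  have g: "sephol g W" unfolding g_def by (rule sephol_partial_deriv[OF openW sephol_f])
  have cc: "continuous_on (B \<times> sphere z r) (\<lambda>p. k (upd (fst p) i (snd p)))" if "sephol k W" for k
    by (rule continuous_on_compose2[OF sephol_imp_continuous_on[OF that]])
      (use inW in \<open>auto intro!: continuous_intros\<close>)
  have "sephol (\<lambda>x. contour_integral (circlepath z r) (\<lambda>\<eta>. g (upd x i \<eta>) * h (upd x i \<eta>) / f (upd x i \<eta>))) B"
  proof (rule sephol_contour_integral[OF openB])
    show "continuous_on (B \<times> sphere z r) (\<lambda>(x, \<eta>). g (upd x i \<eta>) * h (upd x i \<eta>) / f (upd x i \<eta>))"
      unfolding split_def using nzf by (intro continuous_intros cc g h sephol_f) auto
    fix \<eta> assume \<eta>: "\<eta> \<in> sphere z r"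
    show "sephol (\<lambda>x. g (upd x i \<eta>) * h (upd x i \<eta>) / f (upd x i \<eta>)) B"
      by (intro sephol_divide sephol_mult sephol_upd[OF g] sephol_upd[OF h] sephol_upd[OF sephol_f] openB)
        (use \<eta> inW nzf in auto)
  qed (use rpos in auto)
  then have "sephol (\<lambda>x. contour_integral (circlepath z r) (\<lambda>\<eta>. g (upd x i \<eta>) * h (upd x i \<eta>) / f (upd x i \<eta>)) / (2 * pi * \<i>)) B"
    by (intro sephol_divide) auto
  then show ?thesis
  proof (rule sephol_cong[OF _ openB])
    fix x assume x: "x \<in> B"
    show "contour_integral (circlepath z r) (\<lambda>\<eta>. g (upd x i \<eta>) * h (upd x i \<eta>) / f (upd x i \<eta>)) / (2 * pi * \<i>) =
        (\<Sum>\<zeta>\<in>#roots x. h (upd x i \<zeta>))"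
      using zero_free_circle.contour_integral_root_sum[OF circle[OF x] sephol_slice[OF h]]
      by (simp add: g_def)
  qed
qed

text \<open>The size is the root sum of the constant 1, hence continuous, and it takes integer
  values.\<close>

lemma size_roots_eq:
  assumes "connected B" "x \<in> B" "y \<in> B"
  shows "size (roots x) = size (roots y)"
proof -
  have "sephol (\<lambda>x. \<Sum>\<zeta>\<in>#roots x. 1) B" by (rule sephol_root_sum) auto
  then have "continuous_on B (\<lambda>x. of_nat (size (roots x)) :: complex)"
    unfolding sephol_def by simp
  then have "(\<lambda>x. of_nat (size (roots x)) :: complex) constant_on B"
  proof (rule continuous_discrete_range_constant[OF assms(1)])
    fix x
    have "1 \<le> norm (of_nat a - of_nat b :: complex)" if "a \<noteq> b" for a b :: nat
    proof -
      have "norm (of_nat a - of_nat b :: complex) = \<bar>real a - real b\<bar>"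
        by (metis norm_of_real of_real_diff of_real_of_nat_eq)
      then show ?thesis using that by linarith
    qed
    then show "\<exists>e>0. \<forall>y. y \<in> B \<and> (of_nat (size (roots y)) :: complex) \<noteq> of_nat (size (roots x)) \<longrightarrow>
        e \<le> norm (of_nat (size (roots y)) - of_nat (size (roots x)) :: complex)"
      by (intro exI[of _ 1]) auto
  qed
  then show ?thesis using assms unfolding constant_on_def by (metis of_nat_eq_iff)
qed

text \<open>A local resultant of \<open>f\<close> and \<open>h\<close>: it vanishes at
  \<open>x\<close> exactly when the two have a common zero over \<open>x\<close> inside the disc.
  The power sums of the values of \<open>h\<close> are the root sums of the powers of
  \<open>h\<close>.\<close>

lemma sephol_root_prod:
  assumes h: "sephol h W" and B: "connected B"
  shows "sephol (\<lambda>x. \<Prod>\<zeta>\<in>#roots x. h (upd x i \<zeta>)) B"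
proof (cases "B = {}")
  case False
  then obtain x0 where x0: "x0 \<in> B" by auto
  have "sephol (\<lambda>x. \<Prod>\<^sub># (image_mset (\<lambda>\<zeta>. h (upd x i \<zeta>)) (roots x))) B"
  proof (rule sephol_prod_mset[OF _ openB])
    show "sephol (\<lambda>x. \<Sum>a\<in>#image_mset (\<lambda>\<zeta>. h (upd x i \<zeta>)) (roots x). a ^ Suc m) B" for m
      using sephol_root_sum[OF sephol_power[OF h, of "Suc m"]] by (simp add: image_mset.compositionality o_def)
    show "size (image_mset (\<lambda>\<zeta>. h (upd x i \<zeta>)) (roots x)) = size (roots x0)" if "x \<in> B" for x
      using size_roots_eq[OF B that x0] by simp
  qed
  then show ?thesis by simp
qed (simp add: sephol_def)

end

section \<open>Analytic sets and elimination of a coordinate\<close>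

definition vanishing :: "(complex ^ 'k) set \<Rightarrow> (complex ^ 'k) set \<Rightarrow> (complex ^ 'k \<Rightarrow> complex) \<Rightarrow> bool" where
  "vanishing A V h \<longleftrightarrow> sephol h V \<and> (\<forall>a\<in>A \<inter> V. h a = 0)"

text \<open>No finite generation is asked for, so that elimination need not keep track of it.\<close>

definition cut_out :: "(complex ^ 'k) set \<Rightarrow> (complex ^ 'k) set \<Rightarrow> bool" where
  "cut_out A V \<longleftrightarrow> (\<forall>y\<in>V - A. \<exists>h. vanishing A V h \<and> h y \<noteq> 0)"

definition analytic_in :: "(complex ^ 'k) set \<Rightarrow> (complex ^ 'k) set \<Rightarrow> bool" where
  "analytic_in U A \<longleftrightarrow> A \<subseteq> U \<and> (\<forall>p\<in>U. \<exists>V. open V \<and> p \<in> V \<and> V \<subseteq> U \<and> cut_out A V)"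

section \<open>Slices of analytic sets along coordinate lines\<close>

lemma open_nonzero_set: 
  assumes "open V" "sephol h V"
  shows "open {x\<in>V. h x \<noteq> 0}"
proof -
  have "open (V \<inter> h -` (- {0}))"
    by (rule continuous_open_preimage[OF sephol_imp_continuous_on[OF assms(2)] assms(1)]) auto
  moreover have "V \<inter> h -` (- {0}) = {x\<in>V. h x \<noteq> 0}" by auto
  ultimately show ?thesis by simp
qed

lemma open_diff_analytic:
  assumes "analytic_in U A"
  shows "open (U - A)"
proof (subst open_subopen, safe)
  fix y assume y: "y \<in> U" "y \<notin> A"
  then obtain V where V: "open V" "y \<in> V" "V \<subseteq> U" "cut_out A V"
    using assms unfolding analytic_in_def by blast
  then obtain h where h: "vanishing A V h" "h y \<noteq> 0" using y unfolding cut_out_def by blast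
  then have "open {x\<in>V. h x \<noteq> 0}" using V(1) by (intro open_nonzero_set) (auto simp: vanishing_def)
  then show "\<exists>T. open T \<and> y \<in> T \<and> T \<subseteq> U - A"
    using V h y unfolding vanishing_def by (intro exI[of _ "{x\<in>V. h x \<noteq> 0}"]) auto
qed

text \<open>The tube lemma: an open condition along a compact piece of a coordinate line persists on
  nearby parallel lines.\<close>

lemma eventually_upd_compact:
  assumes "compact K" "open S" "\<And>t. t \<in> K \<Longrightarrow> upd p i t \<in> S"
  shows "eventually (\<lambda>x. \<forall>t\<in>K. upd x i t \<in> S) (nhds p)"
proof -
  define S' where "S' = (\<lambda>q. upd (fst q) i (snd q)) -` S"
  have "open S'" unfolding S'_def
    by (rule open_vimage[OF assms(2)]) (auto intro!: continuous_intros)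
  moreover have "{p} \<times> K \<subseteq> S'" using assms(3) by (auto simp: S'_def)
  ultimately have "\<exists>X. p \<in> X \<and> open X \<and> X \<times> K \<subseteq> S'"
    using Elementary_Topology.tube_lemma[OF assms(1), of S' p] by simp
  then obtain X where X: "p \<in> X" "open X" "X \<times> K \<subseteq> S'"
    by (elim exE conjE)
  then have "\<forall>x\<in>X. \<forall>t\<in>K. upd x i t \<in> S" by (auto simp: S'_def)
  then show ?thesis unfolding eventually_nhds using X(1,2) by blast
qed

text \<open>The accumulation points of the slice form a closed set, which is also open by the
  identity theorem, so it is empty or the whole plane. Boundedness excludes the plane, and
  Bolzano-Weierstrass excludes the empty set if the slice is infinite.\<close>

lemma finite_fibre:
  assumes A: "analytic_in U A" and U: "\<And>t. upd p i t \<in> U"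
    and bd: "bounded {t. upd p i t \<in> A}"
  shows "finite {t. upd p i t \<in> A}"
proof (rule ccontr)
  define L where "L = {t. upd p i t \<in> A}"
  assume "infinite {t. upd p i t \<in> A}"
  then have inf: "infinite L" by (simp add: L_def)
  have "- L = {t. upd p i t \<in> U - A}" using U by (auto simp: L_def)
  then have "open (- L)" using open_upd_slice[OF open_diff_analytic[OF A]] by metis
  then have cl: "closed L" by (simp add: closed_def)
  then have "compact L" using bd by (simp add: L_def compact_eq_bounded_closed)
  then obtain t0 where t0: "t0 islimpt L"
    using inf compact_eq_Bolzano_Weierstrass by (metis subset_refl)
  define T where "T = {t. t islimpt L}"
  have TL: "T \<subseteq> L" using cl unfolding T_def closed_limpt by blast
  have "closed T" unfolding T_def by (rule closed_limpts)
  moreover have "open T"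
  proof (subst open_subopen, safe)
    fix t assume t: "t \<in> T"
    then have tA: "upd p i t \<in> A" using TL by (auto simp: L_def)
    then obtain V where V: "open V" "upd p i t \<in> V" "cut_out A V"
      using A unfolding analytic_in_def by blast
    obtain e where e: "e > 0" "ball t e \<subseteq> {s. upd p i s \<in> V}"
      using open_upd_slice[OF V(1)] V(2) open_contains_ball by (metis mem_Collect_eq)
    \<comment> \<open>A point \<open>s\<close> of the ball off \<open>L\<close> would have an
      equation that is nonzero at \<open>s\<close> although its zeros accumulate at
      \<open>t\<close>.\<close>
    have "ball t e \<subseteq> L"
    proof (rule ccontr)
      assume "\<not> ball t e \<subseteq> L"
      then obtain s where s: "s \<in> ball t e" "upd p i s \<notin> A" unfolding L_def by blast
      then obtain h where h: "vanishing A V h" "h (upd p i s) \<noteq> 0"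
        using V e unfolding cut_out_def by blast
      have hol: "(\<lambda>t. h (upd p i t)) holomorphic_on ball t e"
        using h(1) sephol_slice e holomorphic_on_subset unfolding vanishing_def by blast
      have "h (upd p i t) = 0" using h(1) tA V(2) by (auto simp: vanishing_def)
      with isolated_zeros[OF hol _ _ _ this s(1) h(2)] e
      obtain r where r: "r > 0" "ball t r \<subseteq> ball t e" "\<And>z. z \<in> ball t r - {t} \<Longrightarrow> h (upd p i z) \<noteq> 0"
        by (metis centre_in_ball connected_ball open_ball)
      obtain z where z: "z \<in> L" "z \<noteq> t" "dist z t < r"
        using t r(1) unfolding T_def islimpt_approachable by blast
      then have "z \<in> ball t r - {t}" by (auto simp: dist_commute)
      moreover have "upd p i z \<in> V" using r(2) e(2) \<open>z \<in> ball t r - {t}\<close> by blast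
      then have "h (upd p i z) = 0"
        using h(1) z(1) by (auto simp: vanishing_def L_def)
      ultimately show False using r(3) by blast
    qed
    then have "ball t e \<subseteq> T" unfolding T_def
      using interior_limit_point islimpt_subset interior_open[OF open_ball] by blast
    then show "\<exists>B. open B \<and> t \<in> B \<and> B \<subseteq> T" using e(1) by (intro exI[of _ "ball t e"]) auto
  qed
  ultimately have "T = UNIV" using t0 clopen[of T] unfolding T_def by blast
  then have "bounded (UNIV :: complex set)" using TL bd by (metis L_def bounded_subset)
  then show False by simp
qed

text \<open>A finite slice misses points arbitrarily close to \<zeta>. An equation of
  \<open>A\<close> that is nonzero at such a point does not vanish identically along the line, so
  \<zeta> is an isolated zero of it.\<close>

lemma isolating_equation:
  assumes A: "analytic_in U A" and \<zeta>: "upd p i \<zeta> \<in> A" and fin: "finite {t. upd p i t \<in> A}"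
  obtains V f \<rho> where "open V" "V \<subseteq> U" "cut_out A V" "vanishing A V f" "\<rho> > 0"
    "\<And>t. t \<in> ball \<zeta> \<rho> \<Longrightarrow> upd p i t \<in> V"
    "\<And>t. t \<in> ball \<zeta> \<rho> - {\<zeta>} \<Longrightarrow> f (upd p i t) \<noteq> 0"
proof -
  obtain V where V: "open V" "upd p i \<zeta> \<in> V" "V \<subseteq> U" "cut_out A V"
    using A \<zeta> unfolding analytic_in_def by blast
  obtain e where e: "e > 0" "ball \<zeta> e \<subseteq> {s. upd p i s \<in> V}"
    using open_upd_slice[OF V(1)] V(2) open_contains_ball by (metis mem_Collect_eq)
  have "uncountable (ball \<zeta> e)" using uncountable_ball e(1) by blast
  then have "\<not> ball \<zeta> e \<subseteq> {t. upd p i t \<in> A}" using fin by (metis countable_finite countable_subset)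
  then obtain t where t: "t \<in> ball \<zeta> e" "upd p i t \<notin> A" by blast
  then obtain f where f: "vanishing A V f" "f (upd p i t) \<noteq> 0"
    using V e unfolding cut_out_def by blast
  have hol: "(\<lambda>t. f (upd p i t)) holomorphic_on ball \<zeta> e"
    using f(1) sephol_slice e holomorphic_on_subset unfolding vanishing_def by blast
  have "f (upd p i \<zeta>) = 0" using f(1) \<zeta> V(2) by (auto simp: vanishing_def)
  with isolated_zeros[OF hol _ _ _ this t(1) f(2)] e
  obtain r where r: "r > 0" "ball \<zeta> r \<subseteq> ball \<zeta> e" "\<And>z. z \<in> ball \<zeta> r - {\<zeta>} \<Longrightarrow> f (upd p i z) \<noteq> 0"
    by (metis centre_in_ball connected_ball open_ball)
  show ?thesis by (rule that[OF V(1,3,4) f(1) r(1) _ r(3)]) (use r(2) e(2) in auto)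
qed

lemma finite_separated:
  fixes L :: "'a::metric_space set"
  assumes "finite L"
  obtains \<delta> where "\<delta> > 0" "\<And>a b. a \<in> L \<Longrightarrow> b \<in> L \<Longrightarrow> a \<noteq> b \<Longrightarrow> cball a \<delta> \<inter> cball b \<delta> = {}"
proof -
  \<comment> \<open>The entry 1 keeps \<open>Min D\<close> meaningful when \<open>L\<close> has
    fewer than two points.\<close>
  define D where "D = insert 1 ((\<lambda>(a, b). dist a b) ` {(a, b)\<in>L \<times> L. a \<noteq> b})"
  have fin: "finite D" unfolding D_def using assms
    by (auto intro: finite_subset[of _ "L \<times> L"])
  then have pos: "Min D > 0" by (subst Min_gr_iff) (auto simp: D_def)
  show ?thesis
  proof (rule that[of "Min D / 3"])
    fix a b assume "a \<in> L" "b \<in> L" "a \<noteq> b"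
    then have "Min D \<le> dist a b" by (intro Min_le fin) (auto simp: D_def)
    then have "\<not> (dist a c \<le> Min D / 3 \<and> dist b c \<le> Min D / 3)" for c
      using pos dist_triangle[of a b c] dist_commute[of b c] by linarith
    then show "cball a (Min D / 3) \<inter> cball b (Min D / 3) = {}" by auto
  qed (use pos in auto)
qed

text \<open>The fibre over \<open>p\<close> is finite, so disjoint discs with zero-free circles fit
  around its points. The bound \<open>R\<close> confines \<open>A\<close> to a compact part of each
  line, and therefore no point of \<open>A\<close> over a nearby \<open>x\<close> escapes from the
  discs.\<close>

lemma local_discs:
  assumes U: "open U" and A: "analytic_in U A" and p: "p \<in> U"
    and Ui: "\<And>x t. x \<in> U \<Longrightarrow> upd x i t \<in> U"
    and bd: "eventually (\<lambda>x. \<forall>t. upd x i t \<in> A \<longrightarrow> norm t \<le> R) (nhds p)"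
  obtains \<epsilon> V f r where "\<epsilon> > 0" "ball p \<epsilon> \<subseteq> U" "finite {t. upd p i t \<in> A}"
    "\<And>\<zeta>. upd p i \<zeta> \<in> A \<Longrightarrow> root_disc (f \<zeta>) (V \<zeta>) (ball p \<epsilon>) i \<zeta> (r \<zeta>)"
    "\<And>\<zeta>. upd p i \<zeta> \<in> A \<Longrightarrow> vanishing A (V \<zeta>) (f \<zeta>)"
    "\<And>\<zeta>. upd p i \<zeta> \<in> A \<Longrightarrow> cut_out A (V \<zeta>)"
    "\<And>\<zeta> \<zeta>'. upd p i \<zeta> \<in> A \<Longrightarrow> upd p i \<zeta>' \<in> A \<Longrightarrow> \<zeta> \<noteq> \<zeta>' \<Longrightarrow> cball \<zeta> (r \<zeta>) \<inter> cball \<zeta>' (r \<zeta>') = {}"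
    "\<And>x t. x \<in> ball p \<epsilon> \<Longrightarrow> upd x i t \<in> A \<Longrightarrow> \<exists>\<zeta>. upd p i \<zeta> \<in> A \<and> t \<in> ball \<zeta> (r \<zeta>)"
proof -
  define L where "L = {t. upd p i t \<in> A}"
  have "L \<subseteq> cball 0 R" using eventually_nhds_x_imp_x[OF bd] by (auto simp: L_def)
  then have "bounded L" using bounded_cball bounded_subset by blast
  then have fin: "finite L" unfolding L_def using finite_fibre[OF A] Ui[OF p] by blast
  obtain \<delta> where \<delta>: "\<delta> > 0" "\<And>a b. a \<in> L \<Longrightarrow> b \<in> L \<Longrightarrow> a \<noteq> b \<Longrightarrow> cball a \<delta> \<inter> cball b \<delta> = {}"
    using finite_separated[OF fin] by metis
  \<comment> \<open>Neighbourhood, equation and radius are packed into a triple, so that one choice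
    function yields all three.\<close>
  have "\<forall>\<zeta>\<in>L. \<exists>q. case q of (V, f, \<rho>) \<Rightarrow> open V \<and> V \<subseteq> U \<and> cut_out A V \<and> vanishing A V f \<and> \<rho> > 0 \<and>
      (\<forall>t\<in>ball \<zeta> \<rho>. upd p i t \<in> V) \<and> (\<forall>t\<in>ball \<zeta> \<rho> - {\<zeta>}. f (upd p i t) \<noteq> 0)"
  proof
    fix \<zeta> assume "\<zeta> \<in> L"
    then have "upd p i \<zeta> \<in> A" "finite {t. upd p i t \<in> A}" using fin by (auto simp: L_def)
    from isolating_equation[OF A this] obtain V f \<rho> where "open V" "V \<subseteq> U" "cut_out A V" "vanishing A V f" "\<rho> > 0"
    "\<And>t. t \<in> ball \<zeta> \<rho> \<Longrightarrow> upd p i t \<in> V"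
    "\<And>t. t \<in> ball \<zeta> \<rho> - {\<zeta>} \<Longrightarrow> f (upd p i t) \<noteq> 0" by metis
    then show "\<exists>q. case q of (V, f, \<rho>) \<Rightarrow> open V \<and> V \<subseteq> U \<and> cut_out A V \<and> vanishing A V f \<and> \<rho> > 0 \<and>
      (\<forall>t\<in>ball \<zeta> \<rho>. upd p i t \<in> V) \<and> (\<forall>t\<in>ball \<zeta> \<rho> - {\<zeta>}. f (upd p i t) \<noteq> 0)"
      by (intro exI[of _ "(V, f, \<rho>)"]) auto
  qed
  from bchoice[OF this] obtain q where q: "\<forall>\<zeta>\<in>L. case q \<zeta> of (V, f, \<rho>) \<Rightarrow> open V \<and> V \<subseteq> U \<and> cut_out A V \<and> vanishing A V f \<and> \<rho> > 0 \<and>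
      (\<forall>t\<in>ball \<zeta> \<rho>. upd p i t \<in> V) \<and> (\<forall>t\<in>ball \<zeta> \<rho> - {\<zeta>}. f (upd p i t) \<noteq> 0)" ..
  define V where "V \<zeta> = fst (q \<zeta>)" for \<zeta>
  define f where "f \<zeta> = fst (snd (q \<zeta>))" for \<zeta>
  \<comment> \<open>Halving puts the closed disc inside the open one where \<zeta> is the only zero;
    \<delta> keeps the discs apart.\<close>
  define r where "r \<zeta> = min (snd (snd (q \<zeta>)) / 2) \<delta>" for \<zeta>
  have V: "open (V \<zeta>)" "cut_out A (V \<zeta>)" "vanishing A (V \<zeta>) (f \<zeta>)" "r \<zeta> > 0"
    "\<And>t. t \<in> cball \<zeta> (r \<zeta>) \<Longrightarrow> upd p i t \<in> V \<zeta>"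
    "\<And>t. t \<in> sphere \<zeta> (r \<zeta>) \<Longrightarrow> f \<zeta> (upd p i t) \<noteq> 0" if "\<zeta> \<in> L" for \<zeta>
  proof -
    have *: "open (V \<zeta>)" "cut_out A (V \<zeta>)" "vanishing A (V \<zeta>) (f \<zeta>)" "snd (snd (q \<zeta>)) > 0"
      "\<And>t. t \<in> ball \<zeta> (snd (snd (q \<zeta>))) \<Longrightarrow> upd p i t \<in> V \<zeta>"
      "\<And>t. t \<in> ball \<zeta> (snd (snd (q \<zeta>))) - {\<zeta>} \<Longrightarrow> f \<zeta> (upd p i t) \<noteq> 0"
      using bspec[OF q that] by (auto simp: V_def f_def split_def)
    have r: "0 < r \<zeta>" "r \<zeta> < snd (snd (q \<zeta>))" using *(4) \<delta>(1) by (auto simp: r_def)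
    show "open (V \<zeta>)" "cut_out A (V \<zeta>)" "vanishing A (V \<zeta>) (f \<zeta>)" "r \<zeta> > 0" using * r by auto
    show "upd p i t \<in> V \<zeta>" if "t \<in> cball \<zeta> (r \<zeta>)" for t
      using that r by (intro *(5)) auto
    show "f \<zeta> (upd p i t) \<noteq> 0" if "t \<in> sphere \<zeta> (r \<zeta>)" for t
      using that r by (intro *(6)) auto
  qed
  have disj: "cball a (r a) \<inter> cball b (r b) = {}" if "a \<in> L" "b \<in> L" "a \<noteq> b" for a b
  proof -
    have "cball a (r a) \<subseteq> cball a \<delta>" "cball b (r b) \<subseteq> cball b \<delta>" by (auto simp: r_def)
    then show ?thesis using \<delta>(2)[OF that] by blast
  qed
  \<comment> \<open>What remains of the disc of radius \<open>R\<close>: compact and free of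
    \<open>A\<close> over \<open>p\<close>, hence also over nearby \<open>x\<close>.\<close>
  let ?K = "cball 0 R - (\<Union>\<zeta>\<in>L. ball \<zeta> (r \<zeta>))"
  have K: "compact ?K" by (intro compact_diff) auto
  have "eventually (\<lambda>x. \<forall>t\<in>?K. upd x i t \<in> U - A) (nhds p)"
  proof (rule eventually_upd_compact[OF K open_diff_analytic[OF A]])
    fix t assume "t \<in> ?K"
    then have "t \<notin> L" using V(4) by auto
    then show "upd p i t \<in> U - A" using Ui[OF p] by (simp add: L_def)
  qed
  moreover have "eventually (\<lambda>x. \<forall>\<zeta>\<in>L. (\<forall>t\<in>cball \<zeta> (r \<zeta>). upd x i t \<in> V \<zeta>) \<and>
      (\<forall>t\<in>sphere \<zeta> (r \<zeta>). upd x i t \<in> {y\<in>V \<zeta>. f \<zeta> y \<noteq> 0})) (nhds p)"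
  proof (intro eventually_ball_finite[OF fin] ballI eventually_conj)
    fix \<zeta> assume \<zeta>: "\<zeta> \<in> L"
    show "eventually (\<lambda>x. \<forall>t\<in>cball \<zeta> (r \<zeta>). upd x i t \<in> V \<zeta>) (nhds p)"
      by (rule eventually_upd_compact) (use V[OF \<zeta>] in auto)
    have "f \<zeta> (upd p i t) \<noteq> 0 \<and> upd p i t \<in> V \<zeta>" if "t \<in> sphere \<zeta> (r \<zeta>)" for t
      using V(5,6)[OF \<zeta>, of t] that by auto
    then show "eventually (\<lambda>x. \<forall>t\<in>sphere \<zeta> (r \<zeta>). upd x i t \<in> {y\<in>V \<zeta>. f \<zeta> y \<noteq> 0}) (nhds p)"
      using V(1,3)[OF \<zeta>] 
      by (intro eventually_upd_compact open_nonzero_set) (auto simp: vanishing_def)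
  qed
  moreover have "eventually (\<lambda>x. x \<in> U) (nhds p)" using U p by (rule eventually_nhds_in_open)
  ultimately have "eventually (\<lambda>x. x \<in> U \<and> (\<forall>t\<in>?K. upd x i t \<in> U - A) \<and> (\<forall>t. upd x i t \<in> A \<longrightarrow> norm t \<le> R) \<and>
      (\<forall>\<zeta>\<in>L. (\<forall>t\<in>cball \<zeta> (r \<zeta>). upd x i t \<in> V \<zeta>) \<and>
      (\<forall>t\<in>sphere \<zeta> (r \<zeta>). upd x i t \<in> {y\<in>V \<zeta>. f \<zeta> y \<noteq> 0}))) (nhds p)"
    using bd by eventually_elim blast
  then obtain \<epsilon> where \<epsilon>: "\<epsilon> > 0" and E: "\<And>x. x \<in> ball p \<epsilon> \<Longrightarrow> x \<in> U \<and> (\<forall>t\<in>?K. upd x i t \<in> U - A) \<and>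
      (\<forall>t. upd x i t \<in> A \<longrightarrow> norm t \<le> R) \<and>
      (\<forall>\<zeta>\<in>L. (\<forall>t\<in>cball \<zeta> (r \<zeta>). upd x i t \<in> V \<zeta>) \<and>
      (\<forall>t\<in>sphere \<zeta> (r \<zeta>). upd x i t \<in> {y\<in>V \<zeta>. f \<zeta> y \<noteq> 0}))"
    unfolding eventually_nhds_metric by (auto simp: dist_commute)
  show ?thesis
  proof (rule that[of \<epsilon> f V r])
    show "finite {t. upd p i t \<in> A}" using fin by (simp add: L_def)
    show "ball p \<epsilon> \<subseteq> U" using E by auto
    fix \<zeta> assume "upd p i \<zeta> \<in> A"
    then have \<zeta>: "\<zeta> \<in> L" by (simp add: L_def)
    show "root_disc (f \<zeta>) (V \<zeta>) (ball p \<epsilon>) i \<zeta> (r \<zeta>)"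
    proof
      show "upd x i t \<in> V \<zeta>" if "x \<in> ball p \<epsilon>" "t \<in> cball \<zeta> (r \<zeta>)" for x t
        using E[OF that(1)] \<zeta> that(2) by blast
      show "f \<zeta> (upd x i t) \<noteq> 0" if "x \<in> ball p \<epsilon>" "t \<in> sphere \<zeta> (r \<zeta>)" for x t
        using E[OF that(1)] \<zeta> that(2) by blast
    qed (use V[OF \<zeta>] in \<open>auto simp: vanishing_def\<close>)
    show "vanishing A (V \<zeta>) (f \<zeta>)" "cut_out A (V \<zeta>)" using V[OF \<zeta>] by auto
    show "cball \<zeta> (r \<zeta>) \<inter> cball \<zeta>' (r \<zeta>') = {}" if "upd p i \<zeta>' \<in> A" "\<zeta> \<noteq> \<zeta>'" for \<zeta>'
      using disj[OF \<zeta> _ that(2)] that(1) by (simp add: L_def)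
  next
    fix x t assume x: "x \<in> ball p \<epsilon>" "upd x i t \<in> A"
    have "t \<notin> ?K" "t \<in> cball 0 R" using E[OF x(1)] x(2) by auto
    then show "\<exists>\<zeta>. upd p i \<zeta> \<in> A \<and> t \<in> ball \<zeta> (r \<zeta>)" by (auto simp: L_def)
  qed (rule \<epsilon>)
qed

text \<open>A general combination h + c k works, because each point forbids at most one value of
  c.\<close>

lemma vanishing_nonzero_on_finite:
  assumes "finite T" "\<And>t. t \<in> T \<Longrightarrow> \<exists>h. vanishing A V h \<and> h (g t) \<noteq> 0"
  shows "\<exists>h. vanishing A V h \<and> (\<forall>t\<in>T. h (g t) \<noteq> 0)"
  using assms
proof (induction T rule: finite_induct)
  case empty
  have "vanishing A V (\<lambda>x. 0)" by (auto simp: vanishing_def)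
  then show ?case by auto
next
  case (insert t T)
  then obtain h where h: "vanishing A V h" "\<And>s. s \<in> T \<Longrightarrow> h (g s) \<noteq> 0" by auto
  obtain k where k: "vanishing A V k" "k (g t) \<noteq> 0" using insert.prems by auto
  define Bad where "Bad s = {c. h (g s) + c * k (g s) = 0}" for s
  have "finite (Bad s)" if "s \<in> insert t T" for s
  proof (cases "k (g s) = 0")
    case True
    then have "Bad s = {}" using that h(2) k(2) by (auto simp: Bad_def)
    then show ?thesis by simp
  next
    case False
    then have "Bad s \<subseteq> {- h (g s) / k (g s)}" by (auto simp: Bad_def field_simps eq_neg_iff_add_eq_0)
    then show ?thesis using finite_subset by blast
  qed
  then have "finite (\<Union>s\<in>insert t T. Bad s)" using insert.hyps(1) by blast
  then obtain c where c: "c \<notin> (\<Union>s\<in>insert t T. Bad s)"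
    using ex_new_if_finite infinite_UNIV_char_0 by blast
  have "vanishing A V (\<lambda>x. h x + c * k x)"
    using h(1) k(1) unfolding vanishing_def by (auto intro!: sephol_add sephol_mult)
  then show ?case using c by (intro exI[of _ "\<lambda>x. h x + c * k x"]) (auto simp: Bad_def)
qed

text \<open>Over a point \<open>y\<close> off the projection no root of the local equation
  \<open>f\<close> lies in \<open>A\<close>, so some \<open>h\<close> vanishes on \<open>A\<close>
  but at none of these roots. The product of \<open>h\<close> over the roots is then nonzero at
  \<open>y\<close>, and it is zero wherever \<open>A\<close> meets the disc, since a point of
  \<open>A\<close> is a common zero of \<open>f\<close> and \<open>h\<close>. Finally one multiplies
  over the finitely many discs.\<close>

theorem analytic_in_eliminate:
  assumes U: "open U" and A: "analytic_in U A"
    and Ui: "\<And>x t. x \<in> U \<Longrightarrow> upd x i t \<in> U"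
    and bd: "\<And>p. p \<in> U \<Longrightarrow> \<exists>R. eventually (\<lambda>x. \<forall>t. upd x i t \<in> A \<longrightarrow> norm t \<le> R) (nhds p)"
  shows "analytic_in U {x. \<exists>t. upd x i t \<in> A}"
  unfolding analytic_in_def
proof (intro conjI ballI)
  show "{x. \<exists>t. upd x i t \<in> A} \<subseteq> U"
  proof safe
    fix x t assume "upd x i t \<in> A"
    then have "upd x i t \<in> U" using A by (auto simp: analytic_in_def)
    from Ui[OF this, of "x $ i"] show "x \<in> U" by simp
  qed
  fix p assume p: "p \<in> U"
  obtain R where R: "eventually (\<lambda>x. \<forall>t. upd x i t \<in> A \<longrightarrow> norm t \<le> R) (nhds p)"
    using bd[OF p] by blast
  obtain \<epsilon> V f r where E: "\<epsilon> > 0" "ball p \<epsilon> \<subseteq> U" "finite {t. upd p i t \<in> A}"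
    "\<And>\<zeta>. upd p i \<zeta> \<in> A \<Longrightarrow> root_disc (f \<zeta>) (V \<zeta>) (ball p \<epsilon>) i \<zeta> (r \<zeta>)"
    "\<And>\<zeta>. upd p i \<zeta> \<in> A \<Longrightarrow> vanishing A (V \<zeta>) (f \<zeta>)"
    "\<And>\<zeta>. upd p i \<zeta> \<in> A \<Longrightarrow> cut_out A (V \<zeta>)"
    "\<And>x t. x \<in> ball p \<epsilon> \<Longrightarrow> upd x i t \<in> A \<Longrightarrow> \<exists>\<zeta>. upd p i \<zeta> \<in> A \<and> t \<in> ball \<zeta> (r \<zeta>)"
    using local_discs[OF U A p Ui R] by metis
  let ?L = "{t. upd p i t \<in> A}"
  let ?E = "{x. \<exists>t. upd x i t \<in> A}"
  have "cut_out ?E (ball p \<epsilon>)"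
    unfolding cut_out_def
  proof
    fix y assume y: "y \<in> ball p \<epsilon> - ?E"
    have "\<exists>H. sephol H (ball p \<epsilon>) \<and> H y \<noteq> 0 \<and>
        (\<forall>a\<in>ball p \<epsilon>. (\<exists>t\<in>ball \<zeta> (r \<zeta>). upd a i t \<in> A) \<longrightarrow> H a = 0)" if \<zeta>: "\<zeta> \<in> ?L" for \<zeta>
    proof -
      interpret root_disc "f \<zeta>" "V \<zeta>" "ball p \<epsilon>" i \<zeta> "r \<zeta>" using E(4) \<zeta> by simp
      have "\<exists>h. vanishing A (V \<zeta>) h \<and> (\<forall>t\<in>set_mset (roots y). h (upd y i t) \<noteq> 0)"
      proof (rule vanishing_nonzero_on_finite)
        fix t assume "t \<in># roots y"
        then have "t \<in> ball \<zeta> (r \<zeta>)" using set_roots y by auto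
        then have "upd y i t \<in> V \<zeta> - A" using inW y by auto
        then show "\<exists>h. vanishing A (V \<zeta>) h \<and> h (upd y i t) \<noteq> 0"
          using E(6) \<zeta> unfolding cut_out_def by blast
      qed simp
      then obtain h where h: "vanishing A (V \<zeta>) h" "\<And>t. t \<in># roots y \<Longrightarrow> h (upd y i t) \<noteq> 0" by blast
      define H where "H x = (\<Prod>t\<in>#roots x. h (upd x i t))" for x
      have "sephol H (ball p \<epsilon>)" unfolding H_def
        using h(1) by (intro sephol_root_prod) (auto simp: vanishing_def)
      moreover have "H y \<noteq> 0" using h(2) by (auto simp: H_def)
      moreover have "H a = 0" if a: "a \<in> ball p \<epsilon>" "t \<in> ball \<zeta> (r \<zeta>)" "upd a i t \<in> A" for a t
      proof -
        have "upd a i t \<in> V \<zeta>" using a inW by auto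
        then have "f \<zeta> (upd a i t) = 0" "h (upd a i t) = 0"
          using E(5) \<zeta> h(1) a(3) by (auto simp: vanishing_def)
        then have "t \<in># roots a" using set_roots a by auto
        then show ?thesis using \<open>h (upd a i t) = 0\<close> by (auto simp: H_def)
      qed
      ultimately show ?thesis by blast
    qed
    then obtain H where H: "\<And>\<zeta>. \<zeta> \<in> ?L \<Longrightarrow> sephol (H \<zeta>) (ball p \<epsilon>) \<and> H \<zeta> y \<noteq> 0 \<and>
        (\<forall>a\<in>ball p \<epsilon>. (\<exists>t\<in>ball \<zeta> (r \<zeta>). upd a i t \<in> A) \<longrightarrow> H \<zeta> a = 0)"
      by metis
    define G where "G x = (\<Prod>\<zeta>\<in>?L. H \<zeta> x)" for x
    have "sephol G (ball p \<epsilon>)" unfolding G_def using H by (intro sephol_prod) auto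
    moreover have "G y \<noteq> 0" using H E(3) by (auto simp: G_def)
    moreover have "G a = 0" if a: "a \<in> ball p \<epsilon>" "a \<in> ?E" for a
    proof -
      obtain t where t: "upd a i t \<in> A" using a(2) by auto
      then obtain \<zeta> where "\<zeta> \<in> ?L" "t \<in> ball \<zeta> (r \<zeta>)" using E(7)[OF a(1)] by auto
      then have "H \<zeta> a = 0" using H a(1) t by blast
      then show ?thesis unfolding G_def using E(3) \<open>\<zeta> \<in> ?L\<close> by auto
    qed
    ultimately show "\<exists>h. vanishing ?E (ball p \<epsilon>) h \<and> h y \<noteq> 0"
      unfolding vanishing_def by blast
  qed
  then show "\<exists>V. open V \<and> p \<in> V \<and> V \<subseteq> U \<and> cut_out ?E V"
    using E(1,2) by (intro exI[of _ "ball p \<epsilon>"]) auto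
qed

section \<open>The number of distinct roots\<close>

lemma prod_power_fun_upd:
  fixes v :: "nat \<Rightarrow> 'a::comm_semiring_1"
  assumes "a < m"
  shows "(\<Prod>c<m. v c ^ (\<alpha>(a := Suc (\<alpha> a))) c) = v a * (\<Prod>c<m. v c ^ \<alpha> c)"
proof -
  have "(\<Prod>c\<in>{..<m} - {a}. v c ^ (\<alpha>(a := Suc (\<alpha> a))) c) = (\<Prod>c\<in>{..<m} - {a}. v c ^ \<alpha> c)"
    by (rule prod.cong) auto
  then show ?thesis using assms by (simp add: prod.remove[of _ a] mult.assoc)
qed

text \<open>Multiplying out leaves sums of monomials over all \<tau>, and each such sum factors into
  power sums. Only symmetric expressions enter, so \<open>rs w\<close> may order the roots
  arbitrarily for each \<open>w\<close>, without any continuity.\<close>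

lemma holomorphic_power_sums_imp_discriminant:
  fixes rs :: "complex \<Rightarrow> complex list" and m :: nat
  assumes S: "\<And>k. (\<lambda>w. \<Sum>j<d. (rs w ! j) ^ k) holomorphic_on S"
  shows "(\<lambda>w. \<Sum>\<tau>\<in>PiE {..<m} (\<lambda>_. {..<d}). \<Prod>(a, b)\<in>{(a, b). a < m \<and> b < m \<and> a \<noteq> b}. (rs w ! \<tau> a - rs w ! \<tau> b))
    holomorphic_on S"
proof -
  let ?E = "PiE {..<m} (\<lambda>_. {..<d})"
  \<comment> \<open>Generalised to some of the factors times a monomial, since expanding one factor
    raises an exponent.\<close>
  have *: "(\<lambda>w. \<Sum>\<tau>\<in>?E. (\<Prod>(a, b)\<in>F. (rs w ! \<tau> a - rs w ! \<tau> b)) * (\<Prod>c<m. (rs w ! \<tau> c) ^ \<alpha> c)) holomorphic_on S"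
    if "finite F" "F \<subseteq> {(a, b). a < m \<and> b < m \<and> a \<noteq> b}" for F \<alpha>
    using that
  proof (induction F arbitrary: \<alpha> rule: finite_induct)
    case empty
    have "(\<Sum>\<tau>\<in>?E. (\<Prod>c<m. (rs w ! \<tau> c) ^ \<alpha> c)) = (\<Prod>c<m. \<Sum>j<d. (rs w ! j) ^ \<alpha> c)" for w
      by (rule prod_sum_PiE[symmetric]) auto
    then show ?case by (simp add: S holomorphic_on_prod)
  next
    case (insert ab F)
    obtain a b where ab: "ab = (a, b)" by (cases ab)
    have m: "a < m" "b < m" using insert.prems ab by auto
    let ?P = "\<lambda>w \<tau>. \<Prod>(a, b)\<in>F. (rs w ! \<tau> a - rs w ! \<tau> b)"
    have "(\<lambda>w. (\<Sum>\<tau>\<in>?E. ?P w \<tau> * (\<Prod>c<m. (rs w ! \<tau> c) ^ (\<alpha>(a := Suc (\<alpha> a))) c)) -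
        (\<Sum>\<tau>\<in>?E. ?P w \<tau> * (\<Prod>c<m. (rs w ! \<tau> c) ^ (\<alpha>(b := Suc (\<alpha> b))) c))) holomorphic_on S"
      by (intro holomorphic_on_diff insert.IH) (use insert.prems in auto)
    also have "(\<lambda>w. (\<Sum>\<tau>\<in>?E. ?P w \<tau> * (\<Prod>c<m. (rs w ! \<tau> c) ^ (\<alpha>(a := Suc (\<alpha> a))) c)) -
        (\<Sum>\<tau>\<in>?E. ?P w \<tau> * (\<Prod>c<m. (rs w ! \<tau> c) ^ (\<alpha>(b := Suc (\<alpha> b))) c))) =
        (\<lambda>w. \<Sum>\<tau>\<in>?E. (\<Prod>(a, b)\<in>insert ab F. (rs w ! \<tau> a - rs w ! \<tau> b)) * (\<Prod>c<m. (rs w ! \<tau> c) ^ \<alpha> c))"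
    proof -
      have v: "(\<Prod>c<m. (rs w ! \<tau> c) ^ (\<alpha>(e := Suc (\<alpha> e))) c) = rs w ! \<tau> e * (\<Prod>c<m. (rs w ! \<tau> c) ^ \<alpha> c)"
        if "e < m" for w \<tau> e
        using prod_power_fun_upd[OF that, of "\<lambda>c. rs w ! \<tau> c"] .
      show ?thesis
        unfolding v[OF m(1)] v[OF m(2)] sum_subtractf[symmetric] ab
        using insert.hyps ab by (simp add: algebra_simps)
    qed
    finally show ?case .
  qed
  have "finite {(a, b). a < m \<and> b < m \<and> a \<noteq> b}"
    by (rule finite_subset[of _ "{..<m} \<times> {..<m}"]) auto
  from *[OF this, of "\<lambda>_. 0"] show ?thesis by simp
qed

text \<open>Taking ordered pairs makes the product invariant under permutations, so that all nonzero terms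
  agree when there are exactly \<open>m\<close> distinct roots, and no cancellation can occur.\<close>

definition difference_product_sum :: "nat \<Rightarrow> complex list \<Rightarrow> complex" where
  "difference_product_sum m xs = (\<Sum>\<tau>\<in>PiE {..<m} (\<lambda>_. {..<length xs}).
     \<Prod>(a, b)\<in>{(a, b). a < m \<and> b < m \<and> a \<noteq> b}. (xs ! \<tau> a - xs ! \<tau> b))"

lemma prod_differences_not_inj:
  fixes v :: "nat \<Rightarrow> complex"
  assumes "\<not> inj_on v {..<m}"
  shows "(\<Prod>(a, b)\<in>{(a, b). a < m \<and> b < m \<and> a \<noteq> b}. (v a - v b)) = 0"
proof -
  obtain a b where "a < m" "b < m" "a \<noteq> b" "v a = v b" using assms by (auto simp: inj_on_def)
  moreover have "finite {(a, b). a < m \<and> b < m \<and> a \<noteq> b}"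
    by (rule finite_subset[of _ "{..<m} \<times> {..<m}"]) auto
  ultimately show ?thesis by (intro prod_zero) auto
qed

text \<open>Pigeonhole: every \<tau> picks some entry twice, so each term has a zero factor.\<close>

lemma difference_product_sum_eq_0:
  assumes "card (set xs) < m"
  shows "difference_product_sum m xs = 0"
  unfolding difference_product_sum_def
proof (rule sum.neutral, rule ballI, rule prod_differences_not_inj)
  fix \<tau> assume \<tau>: "\<tau> \<in> PiE {..<m} (\<lambda>_. {..<length xs})"
  then have "(\<lambda>a. xs ! \<tau> a) ` {..<m} \<subseteq> set xs" by (auto simp: PiE_def Pi_def)
  then have "card ((\<lambda>a. xs ! \<tau> a) ` {..<m}) \<le> card (set xs)" by (simp add: card_mono)
  then show "\<not> inj_on (\<lambda>a. xs ! \<tau> a) {..<m}" using assms card_image by fastforce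
qed

lemma difference_product_sum_neq_0:
  "difference_product_sum (card (set xs)) xs \<noteq> 0"
proof -
  define m where "m = card (set xs)"
  let ?E = "PiE {..<m} (\<lambda>_. {..<length xs})"
  let ?D = "{(a, b). a < m \<and> b < m \<and> a \<noteq> b}"
  let ?Z = "{(y, z). y \<in> set xs \<and> z \<in> set xs \<and> y \<noteq> z}"
  define K where "K = (\<Prod>(y, z)\<in>?Z. (y - z))"
  define I where "I = {\<tau>\<in>?E. inj_on (\<lambda>a. xs ! \<tau> a) {..<m}}"
  have "finite ?Z" by (rule finite_subset[of _ "set xs \<times> set xs"]) auto
  then have K: "K \<noteq> 0" by (auto simp: K_def)
  have "(\<Prod>(a, b)\<in>?D. (xs ! \<tau> a - xs ! \<tau> b)) = (if \<tau> \<in> I then K else 0)" if \<tau>: "\<tau> \<in> ?E" for \<tau>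
  proof (cases "\<tau> \<in> I")
    case True
    define v where "v a = xs ! \<tau> a" for a
    have inj: "inj_on v {..<m}" using True unfolding I_def v_def by blast
    have sub: "v ` {..<m} \<subseteq> set xs" using \<tau> by (auto simp: PiE_def Pi_def v_def)
    have img: "v ` {..<m} = set xs"
    proof (rule card_subset_eq)
      show "card (v ` {..<m}) = card (set xs)" using card_image[OF inj] by (simp add: m_def)
    qed (use sub in auto)
    have "bij_betw (\<lambda>(a, b). (v a, v b)) ?D ?Z"
      unfolding bij_betw_def
    proof
      show "inj_on (\<lambda>(a, b). (v a, v b)) ?D" using inj by (auto simp: inj_on_def)
      have "x \<in> (\<lambda>(a, b). (v a, v b)) ` ?D" if x: "x \<in> ?Z" for x
      proof -
        obtain y z where yz: "x = (y, z)" "y \<in> set xs" "z \<in> set xs" "y \<noteq> z"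
          using x by blast
        then have "y \<in> v ` {..<m}" "z \<in> v ` {..<m}" unfolding img by auto
        with yz show ?thesis by force
      qed
      moreover have "(\<lambda>(a, b). (v a, v b)) ` ?D \<subseteq> ?Z"
        using inj img by (auto simp: inj_on_def)
      ultimately show "(\<lambda>(a, b). (v a, v b)) ` ?D = ?Z" by blast
    qed
    from prod.reindex_bij_betw[OF this, of "\<lambda>(y, z). y - z"]
    show ?thesis using True by (simp add: K_def split_def v_def)
  next
    case False
    then have "\<not> inj_on (\<lambda>a. xs ! \<tau> a) {..<m}" using \<tau> by (auto simp: I_def)
    from prod_differences_not_inj[OF this] show ?thesis using False by simp
  qed
  then have "difference_product_sum m xs = (\<Sum>\<tau>\<in>?E. if \<tau> \<in> I then K else 0)"
    unfolding difference_product_sum_def by (intro sum.cong) auto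
  also have "\<dots> = of_nat (card I) * K"
  proof -
    have "finite ?E" by (intro finite_PiE) auto
    moreover have "I \<subseteq> ?E" by (auto simp: I_def)
    ultimately show ?thesis by (simp add: sum.If_cases Int_absorb1)
  qed
  finally have eq: "difference_product_sum m xs = of_nat (card I) * K" .
  \<comment> \<open>One list position for each distinct entry gives a member of \<open>I\<close>, so
    the multiple of \<open>K\<close> is not zero.\<close>
  obtain g where g: "bij_betw g {..<m} (set xs)"
    using ex_bij_betw_nat_finite[of "set xs"] by (auto simp: m_def atLeast0LessThan)
  have "\<forall>a\<in>{..<m}. \<exists>j. j < length xs \<and> xs ! j = g a"
    using g by (metis bij_betw_apply in_set_conv_nth)
  then obtain s where s: "\<forall>a\<in>{..<m}. s a < length xs \<and> xs ! s a = g a" using bchoice by meson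
  have "restrict s {..<m} \<in> ?E" using s by auto
  moreover have "inj_on (\<lambda>a. xs ! restrict s {..<m} a) {..<m}"
    using g s by (auto simp: bij_betw_def inj_on_def)
  ultimately have "restrict s {..<m} \<in> I" by (simp add: I_def)
  moreover have "finite I" unfolding I_def by (auto intro!: finite_subset[of _ ?E] finite_PiE)
  ultimately have "card I \<noteq> 0" by auto
  then show ?thesis using eq K by (simp add: m_def)
qed

lemma nonzero_punctured_ball:
  assumes "g holomorphic_on ball w0 \<epsilon>" "\<epsilon> > 0" "w1 \<in> ball w0 \<epsilon>" "g w1 \<noteq> 0"
  obtains \<delta> where "\<delta> > 0" "\<delta> \<le> \<epsilon>" "\<And>w. w \<in> ball w0 \<delta> - {w0} \<Longrightarrow> g w \<noteq> 0"
proof (cases "g w0 = 0")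
  case True
  obtain r where r: "0 < r" "ball w0 r \<subseteq> ball w0 \<epsilon>" "\<And>z. z \<in> ball w0 r - {w0} \<Longrightarrow> g z \<noteq> 0"
    using isolated_zeros[OF assms(1) _ _ _ True assms(3,4)] assms(2) by (metis centre_in_ball connected_ball open_ball)
  then show ?thesis using that[of "min r \<epsilon>"] assms(2) by auto
next
  case False
  have "open {w\<in>ball w0 \<epsilon>. g w \<noteq> 0}"
  proof -
    have "open (ball w0 \<epsilon> \<inter> g -` (- {0}))"
      by (intro continuous_open_preimage holomorphic_on_imp_continuous_on assms(1)) auto
    moreover have "ball w0 \<epsilon> \<inter> g -` (- {0}) = {w\<in>ball w0 \<epsilon>. g w \<noteq> 0}" by auto
    ultimately show ?thesis by simp
  qed
  then obtain r where r: "r > 0" "ball w0 r \<subseteq> {w\<in>ball w0 \<epsilon>. g w \<noteq> 0}"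
    using False assms(2) unfolding open_contains_ball by fastforce
  show ?thesis by (rule that[of "min r \<epsilon>"]) (use r assms(2) in auto)
qed

text \<open>Let n be the largest number of distinct roots that occurs. The difference-product sum
  for n is holomorphic and nonzero where n is attained, so it has no zero close to \<open>w0\<close>
  except possibly \<open>w0\<close>. Where it is nonzero there are at least n distinct roots, hence
  exactly n.\<close>

lemma card_distinct_roots_generic:
  fixes M :: "complex \<Rightarrow> complex multiset"
  assumes hol: "\<And>k. (\<lambda>w. \<Sum>\<zeta>\<in>#M w. \<zeta> ^ k) holomorphic_on ball w0 \<epsilon>" and \<epsilon>: "\<epsilon> > 0"
    and d: "\<And>w. w \<in> ball w0 \<epsilon> \<Longrightarrow> size (M w) = d"
  obtains \<delta> n where "\<delta> > 0" "\<delta> \<le> \<epsilon>" "\<And>w. w \<in> ball w0 \<delta> - {w0} \<Longrightarrow> card (set_mset (M w)) = n"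
proof -
  have "\<forall>w. \<exists>xs. mset xs = M w" by (metis ex_mset)
  then obtain rs where rs: "\<And>w. mset (rs w) = M w" by metis
  have len: "length (rs w) = d" if "w \<in> ball w0 \<epsilon>" for w using d[OF that] rs by (metis size_mset)
  have set: "set (rs w) = set_mset (M w)" for w using rs by (metis set_mset_mset)
  let ?C = "(\<lambda>w. card (set_mset (M w))) ` ball w0 \<epsilon>"
  have "?C \<subseteq> {..d}" using d by (auto simp: set[symmetric] len[symmetric] card_length)
  then have fin: "finite ?C" using finite_subset by blast
  define n where "n = Max ?C"
  have "n \<in> ?C" unfolding n_def by (rule Max_in[OF fin]) (use \<epsilon> in auto)
  then obtain w1 where w1: "w1 \<in> ball w0 \<epsilon>" "card (set_mset (M w1)) = n" by auto
  have le: "card (set_mset (M w)) \<le> n" if "w \<in> ball w0 \<epsilon>" for w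
    unfolding n_def using that fin by (intro Max_ge) auto
  have "(\<lambda>w. difference_product_sum n (rs w)) holomorphic_on ball w0 \<epsilon>"
  proof (rule holomorphic_transform)
    show "(\<lambda>w. \<Sum>\<tau>\<in>PiE {..<n} (\<lambda>_. {..<d}). \<Prod>(a, b)\<in>{(a, b). a < n \<and> b < n \<and> a \<noteq> b}. (rs w ! \<tau> a - rs w ! \<tau> b))
        holomorphic_on ball w0 \<epsilon>"
    proof (rule holomorphic_power_sums_imp_discriminant)
      fix k
      show "(\<lambda>w. \<Sum>j<d. (rs w ! j) ^ k) holomorphic_on ball w0 \<epsilon>"
      proof (rule holomorphic_transform[OF hol])
        fix w assume "w \<in> ball w0 \<epsilon>"
        have "(\<Sum>\<zeta>\<in>#M w. \<zeta> ^ k) = sum_list (map (\<lambda>\<zeta>. \<zeta> ^ k) (rs w))"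
          unfolding rs[symmetric] by (simp add: sum_mset_sum_list[symmetric])
        also have "\<dots> = (\<Sum>j<d. (rs w ! j) ^ k)"
          using len[OF \<open>w \<in> ball w0 \<epsilon>\<close>] by (simp add: sum_list_sum_nth atLeast0LessThan)
        finally show "(\<Sum>\<zeta>\<in>#M w. \<zeta> ^ k) = (\<Sum>j<d. (rs w ! j) ^ k)" .
      qed
    qed
  qed (simp add: difference_product_sum_def len)
  moreover have "difference_product_sum n (rs w1) \<noteq> 0"
    using difference_product_sum_neq_0[of "rs w1"] w1(2) by (simp add: set)
  ultimately obtain \<delta> where \<delta>: "\<delta> > 0" "\<delta> \<le> \<epsilon>" "\<And>w. w \<in> ball w0 \<delta> - {w0} \<Longrightarrow> difference_product_sum n (rs w) \<noteq> 0"
    using nonzero_punctured_ball[OF _ \<epsilon> w1(1)] by blast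
  show ?thesis
  proof (rule that[OF \<delta>(1,2)])
    fix w assume w: "w \<in> ball w0 \<delta> - {w0}"
    then have "w \<in> ball w0 \<epsilon>" using \<delta>(2) by auto
    moreover have "\<not> card (set_mset (M w)) < n"
      using difference_product_sum_eq_0[of "rs w" n] \<delta>(3)[OF w] by (auto simp: set)
    ultimately show "card (set_mset (M w)) = n" using le by (metis nat_less_le)
  qed
qed

section \<open>Analytic multifunctions of one variable\<close>

definition poly_holomorphic_on :: "(complex \<Rightarrow> complex poly) \<Rightarrow> complex set \<Rightarrow> bool" where
  "poly_holomorphic_on P S \<longleftrightarrow> (\<forall>k. (\<lambda>w. coeff (P w) k) holomorphic_on S)"

lemma poly_holomorphic_on_subset: "poly_holomorphic_on P S \<Longrightarrow> T \<subseteq> S \<Longrightarrow> poly_holomorphic_on P T"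
  unfolding poly_holomorphic_on_def using holomorphic_on_subset by blast

lemma poly_holomorphic_on_cong:
  "poly_holomorphic_on P S \<Longrightarrow> (\<And>w. w \<in> S \<Longrightarrow> P w = Q w) \<Longrightarrow> poly_holomorphic_on Q S"
  unfolding poly_holomorphic_on_def by (metis (mono_tags, lifting) holomorphic_cong)

lemma poly_holomorphic_on_prod:
  "(\<And>a. a \<in> I \<Longrightarrow> poly_holomorphic_on (P a) S) \<Longrightarrow> poly_holomorphic_on (\<lambda>w. \<Prod>a\<in>I. P a w) S"
proof (induction I rule: infinite_finite_induct)
  case (insert a I)
  then show ?case
    by (auto simp: poly_holomorphic_on_def coeff_mult intro!: holomorphic_intros)
qed (auto simp: poly_holomorphic_on_def)

lemma poly_holomorphic_on_linear:
  assumes "\<rho> holomorphic_on S"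
  shows "poly_holomorphic_on (\<lambda>w. [:- \<rho> w, 1:]) S"
  unfolding poly_holomorphic_on_def
proof
  fix k show "(\<lambda>w. coeff [:- \<rho> w, 1:] k) holomorphic_on S"
  proof (cases k)
    case (Suc j)
    then show ?thesis by (cases j) auto
  qed (use assms in \<open>auto intro!: holomorphic_intros\<close>)
qed

lemma poly_holomorphic_on_local:
  assumes "\<And>w. w \<in> S \<Longrightarrow> \<exists>\<delta>>0. poly_holomorphic_on P (ball w \<delta>)"
  shows "poly_holomorphic_on P S"
  unfolding poly_holomorphic_on_def
proof
  fix k
  show "(\<lambda>w. coeff (P w) k) holomorphic_on S"
    unfolding holomorphic_on_def
  proof
    fix w assume "w \<in> S"
    then obtain \<delta> where "\<delta> > 0" "poly_holomorphic_on P (ball w \<delta>)" using assms by blast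
    then have "(\<lambda>w. coeff (P w) k) field_differentiable at w"
      unfolding poly_holomorphic_on_def
      by (meson centre_in_ball holomorphic_on_imp_differentiable_at open_ball)
    then show "(\<lambda>w. coeff (P w) k) field_differentiable at w within S"
      by (rule field_differentiable_at_within)
  qed
qed

lemma finite_uniform_radius:
  assumes "finite L" "\<And>\<zeta>. \<zeta> \<in> L \<Longrightarrow> \<exists>\<delta>>0::real. Q \<zeta> \<delta>"
    "\<And>\<zeta> \<delta> \<delta>'. \<zeta> \<in> L \<Longrightarrow> Q \<zeta> \<delta> \<Longrightarrow> 0 < \<delta>' \<Longrightarrow> \<delta>' \<le> \<delta> \<Longrightarrow> Q \<zeta> \<delta>'"
  shows "\<exists>\<delta>>0. \<forall>\<zeta>\<in>L. Q \<zeta> \<delta>"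
  using assms
proof (induction L rule: finite_induct)
  case (insert a L)
  have "\<exists>\<delta>>0. \<forall>\<zeta>\<in>L. Q \<zeta> \<delta>" by (rule insert.IH) (use insert.prems in blast)+
  then obtain \<delta>1 where 1: "\<delta>1 > 0" "\<And>\<zeta>. \<zeta> \<in> L \<Longrightarrow> Q \<zeta> \<delta>1" by blast
  obtain \<delta>2 where 2: "\<delta>2 > 0" "Q a \<delta>2" using insert.prems(1) by auto
  have "Q \<zeta> (min \<delta>1 \<delta>2)" if "\<zeta> \<in> insert a L" for \<zeta>
    using that 1 2 insert.prems(2)[OF that, of \<delta>1 "min \<delta>1 \<delta>2"] insert.prems(2)[OF that, of \<delta>2 "min \<delta>1 \<delta>2"] by auto
  then show ?case using 1(1) 2(1) by (intro exI[of _ "min \<delta>1 \<delta>2"]) auto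
qed (auto intro: exI[of _ 1])

section \<open>Fibres of a multifunction and their local branches\<close>

lemma sephol_line:
  assumes "sephol g (ball (upd x i w) \<epsilon>)"
  shows "(\<lambda>v. g (upd x i v)) holomorphic_on ball w \<epsilon>"
  using sephol_slice[OF assms, of x i] by (simp add: dist_upd ball_def)

lemma eventually_growth_le:
  fixes p :: "complex ^ 'k"
  assumes "p $ i \<noteq> 0"
  shows "\<exists>R. eventually (\<lambda>x. K * (norm (x $ i) + inverse (norm (x $ i))) ^ \<kappa> \<le> R) (nhds p)"
proof -
  let ?g = "\<lambda>x :: complex ^ 'k. K * (norm (x $ i) + inverse (norm (x $ i))) ^ \<kappa>"
  have "isCont ?g p" using assms by (intro continuous_intros) auto
  then have "(?g \<longlongrightarrow> ?g p) (at p)" by (rule isContD)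
  then have "eventually (\<lambda>x. ?g x < ?g p + 1) (at p)"
    by (rule order_tendstoD) simp
  then have "eventually (\<lambda>x. ?g x < ?g p + 1) (nhds p)"
    by (simp add: eventually_nhds_conv_at)
  then have "eventually (\<lambda>x. ?g x \<le> ?g p + 1) (nhds p)" by eventually_elim simp
  then show ?thesis by blast
qed

text \<open>\<open>A\<close> is the cylinder over a set of pairs (w, u): by \<open>cyl\<close> the
  other coordinates are free and may be set to 0. \<open>nonisolated\<close> demands nearby points
  with another w; a stray pair would not be detected by the root polynomials of the neighbouring
  fibres.\<close>

locale analytic_multifunction =
  fixes A :: "(complex ^ 'k) set" and iw iu :: 'k
  assumes idx: "iw \<noteq> iu"
    and A: "analytic_in {x. x $ iw \<noteq> 0} A"
    and cyl: "\<And>x y. x $ iw = y $ iw \<Longrightarrow> x $ iu = y $ iu \<Longrightarrow> x \<in> A \<Longrightarrow> y \<in> A"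
    and growth: "\<exists>K \<kappa>. \<forall>x\<in>A. norm (x $ iu) \<le> K * (norm (x $ iw) + inverse (norm (x $ iw))) ^ \<kappa>"
    and nonisolated: "\<And>x e. x \<in> A \<Longrightarrow> e > 0 \<Longrightarrow>
      \<exists>y\<in>A. y $ iw \<noteq> x $ iw \<and> dist (y $ iw) (x $ iw) < e \<and> dist (y $ iu) (x $ iu) < e"
begin

abbreviation line :: "complex \<Rightarrow> complex ^ 'k" where "line w \<equiv> upd 0 iw w"

abbreviation pt :: "complex \<Rightarrow> complex \<Rightarrow> complex ^ 'k" where "pt w u \<equiv> upd (line w) iu u"

definition fib :: "complex \<Rightarrow> complex set" where "fib w = {u. pt w u \<in> A}"

lemma fib_iff: "u \<in> fib w \<longleftrightarrow> (\<exists>x\<in>A. x $ iw = w \<and> x $ iu = u)"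
proof
  assume "u \<in> fib w"
  then show "\<exists>x\<in>A. x $ iw = w \<and> x $ iu = u"
    using idx unfolding fib_def by (intro bexI[of _ "pt w u"]) auto
next
  assume "\<exists>x\<in>A. x $ iw = w \<and> x $ iu = u"
  then show "u \<in> fib w" unfolding fib_def using idx cyl[of _ "pt w u"] by auto
qed

lemma nonisolated_fib:
  assumes "u \<in> fib w" "e > 0"
  obtains w' u' where "u' \<in> fib w'" "w' \<noteq> w" "dist w' w < e" "dist u' u < e"
proof -
  obtain x where x: "x \<in> A" "x $ iw = w" "x $ iu = u" using assms(1) unfolding fib_iff by blast
  obtain y where "y \<in> A" "y $ iw \<noteq> x $ iw" "dist (y $ iw) (x $ iw) < e" "dist (y $ iu) (x $ iu) < e"
    using nonisolated[OF x(1) assms(2)] by blast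
  then show ?thesis using that[of "y $ iu" "y $ iw"] x fib_iff by auto
qed

lemma fib_nonzero: "u \<in> fib w \<Longrightarrow> w \<noteq> 0"
  using A unfolding fib_iff analytic_in_def by auto

lemma open_U: "open {x :: complex ^ 'k. x $ iw \<noteq> 0}"
  by (intro open_Collect_neq continuous_intros)

lemma fib_bound:
  obtains K \<kappa> where "K \<ge> 0" "\<And>w u. u \<in> fib w \<Longrightarrow> norm u \<le> K * (norm w + inverse (norm w)) ^ \<kappa>"
proof -
  obtain K \<kappa> where K: "\<And>x. x \<in> A \<Longrightarrow> norm (x $ iu) \<le> K * (norm (x $ iw) + inverse (norm (x $ iw))) ^ \<kappa>"
    using growth by blast
  have *: "norm u \<le> max K 0 * (norm w + inverse (norm w)) ^ \<kappa>" if u: "u \<in> fib w" for w u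
  proof -
    obtain x where "x \<in> A" "x $ iw = w" "x $ iu = u" using u unfolding fib_iff by blast
    then have "norm u \<le> K * (norm w + inverse (norm w)) ^ \<kappa>" using K by blast
    also have "\<dots> \<le> max K 0 * (norm w + inverse (norm w)) ^ \<kappa>"
      by (intro mult_right_mono) auto
    finally show ?thesis .
  qed
  show ?thesis by (rule that[of "max K 0" \<kappa>]) (use * in auto)
qed

lemma locally_bounded:
  assumes "w0 \<noteq> 0"
  shows "\<exists>R. eventually (\<lambda>x. \<forall>t. upd x iu t \<in> A \<longrightarrow> norm t \<le> R) (nhds (line w0))"
proof -
  obtain K \<kappa> where K: "K \<ge> 0" "\<And>w u. u \<in> fib w \<Longrightarrow> norm u \<le> K * (norm w + inverse (norm w)) ^ \<kappa>"
    using fib_bound by blast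
  have "line w0 $ iw \<noteq> 0" using assms by simp
  from eventually_growth_le[OF this] obtain R
    where R: "eventually (\<lambda>x. K * (norm (x $ iw) + inverse (norm (x $ iw))) ^ \<kappa> \<le> R) (nhds (line w0))"
    by blast
  have "eventually (\<lambda>x. \<forall>t. upd x iu t \<in> A \<longrightarrow> norm t \<le> R) (nhds (line w0))"
    using R
  proof eventually_elim
    case (elim x)
    show ?case
    proof (intro allI impI)
      fix t assume "upd x iu t \<in> A"
      then have "t \<in> fib (x $ iw)" unfolding fib_iff using idx by (intro bexI) auto
      then show "norm t \<le> R" using K(2) elim order_trans by blast
    qed
  qed
  then show ?thesis by blast
qed

text \<open>Where the number of distinct roots of \<open>f\<close> is constant, every root over
  \<open>w1\<close> continues as one holomorphic branch. A branch that starts in \<open>A\<close>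
  stays in it by the identity theorem; one that starts outside stays outside, because the complement
  is open. So near \<open>w1\<close> the fibre in the disc consists of the values of fixed
  branches.\<close>

lemma local_graphs:
  assumes rd: "root_disc f V (ball (line w0) \<epsilon>) iu z r" and van: "vanishing A V f" and cut: "cut_out A V"
    and w1: "w1 \<noteq> 0" "\<eta> > 0" "ball w1 \<eta> \<subseteq> ball w0 \<epsilon>"
    and card: "\<And>w. w \<in> ball w1 \<eta> \<Longrightarrow> card (set_mset (root_mset (\<lambda>t. f (pt w t)) z r)) = n"
  shows "\<exists>\<delta>>0. \<exists>m. poly_holomorphic_on (\<lambda>w. \<Prod>u\<in>fib w \<inter> ball z r. [:- u, 1:]) (ball w1 \<delta>) \<and>
    (\<forall>w\<in>ball w1 \<delta>. finite (fib w \<inter> ball z r) \<and> card (fib w \<inter> ball z r) = m)"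
proof -
  interpret root_disc f V "ball (line w0) \<epsilon>" iu z r by (rule rd)
  have inB: "line w \<in> ball (line w0) \<epsilon>" if "w \<in> ball w1 \<eta>" for w
    using that w1(3) by (auto simp: dist_upd)
  have w1B: "line w1 \<in> ball (line w0) \<epsilon>" using inB w1(2) by auto
  define Z where "Z = set_mset (roots (line w1))"
  have Z: "Z = {\<zeta>\<in>ball z r. f (pt w1 \<zeta>) = 0}" unfolding Z_def by (rule set_roots[OF w1B])
  have finZ: "finite Z" by (simp add: Z_def)
  obtain \<delta>0 where \<delta>0: "\<delta>0 > 0" "\<And>a b. a \<in> Z \<Longrightarrow> b \<in> Z \<Longrightarrow> a \<noteq> b \<Longrightarrow> cball a \<delta>0 \<inter> cball b \<delta>0 = {}"
    using finite_separated[OF finZ] by metis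
  have "\<exists>s>0. \<forall>\<zeta>\<in>Z. cball \<zeta> s \<subseteq> ball z r"
  proof (rule finite_uniform_radius[OF finZ])
    fix \<zeta> assume "\<zeta> \<in> Z"
    then have "\<zeta> \<in> ball z r" by (simp add: Z)
    then show "\<exists>\<delta>>0. cball \<zeta> \<delta> \<subseteq> ball z r" using open_contains_cball open_ball by blast
  qed auto
  then obtain s where s: "s > 0" "\<And>\<zeta>. \<zeta> \<in> Z \<Longrightarrow> cball \<zeta> s \<subseteq> ball z r" by blast
  define \<rho> where "\<rho> = min s \<delta>0"
  have \<rho>: "\<rho> > 0" using s \<delta>0 by (simp add: \<rho>_def)
  have sub: "cball \<zeta> \<rho> \<subseteq> ball z r" if "\<zeta> \<in> Z" for \<zeta>
    using s(2)[OF that] by (auto simp: \<rho>_def)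
  have disj: "cball a \<rho> \<inter> cball b \<rho> = {}" if "a \<in> Z" "b \<in> Z" "a \<noteq> b" for a b
    using \<delta>0(2)[OF that] by (auto simp: \<rho>_def)
  have only: "t = \<zeta>" if "\<zeta> \<in> Z" "t \<in> cball \<zeta> \<rho>" "f (pt w1 t) = 0" for \<zeta> t
  proof (rule ccontr)
    assume "t \<noteq> \<zeta>"
    have "t \<in> ball z r" using sub[OF that(1)] that(2) by blast
    then have "t \<in> Z" using that(3) by (simp add: Z)
    then have "cball t \<rho> \<inter> cball \<zeta> \<rho> = {}" using disj that(1) \<open>t \<noteq> \<zeta>\<close> by blast
    then show False using that(2) \<rho> by (metis centre_in_cball disjoint_iff less_imp_le)
  qed
  \<comment> \<open>No root over \<open>w1\<close> lies here, so for nearby w all roots stay in the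
    small discs around \<open>Z\<close>.\<close>
  let ?K = "cball z r - (\<Union>\<zeta>\<in>Z. ball \<zeta> \<rho>)"
  let ?N = "{y\<in>V. f y \<noteq> 0}"
  have oN: "open ?N" by (rule open_nonzero_set[OF openW sephol_f])
  have "eventually (\<lambda>x. \<forall>t\<in>?K. upd x iu t \<in> ?N) (nhds (line w1))"
  proof (rule eventually_upd_compact[OF _ oN])
    show "compact ?K" by (intro compact_diff) auto
    fix t assume t: "t \<in> ?K"
    then have "pt w1 t \<in> V" using inW w1B by blast
    moreover have "f (pt w1 t) \<noteq> 0"
    proof
      assume 0: "f (pt w1 t) = 0"
      then have "t \<notin> sphere z r" using nzf w1B by blast
      then have "t \<in> Z" using t 0 by (auto simp: Z)
      then show False using t \<rho> by auto
    qed
    ultimately show "pt w1 t \<in> ?N" by simp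
  qed
  \<comment> \<open>The first condition keeps the small circles free of zeros. The second keeps
    \<open>A\<close> out of the small disc around a root off the fibre: over \<open>w1\<close> only
    its centre could lie in \<open>A\<close>.\<close>
  moreover have "eventually (\<lambda>x. \<forall>\<zeta>\<in>Z. (\<forall>t\<in>sphere \<zeta> \<rho>. upd x iu t \<in> ?N) \<and>
      (\<zeta> \<notin> fib w1 \<longrightarrow> (\<forall>t\<in>cball \<zeta> \<rho>. upd x iu t \<in> {x. x $ iw \<noteq> 0} - A))) (nhds (line w1))"
  proof (intro eventually_ball_finite[OF finZ] ballI eventually_conj)
    fix \<zeta> assume \<zeta>: "\<zeta> \<in> Z"
    show "eventually (\<lambda>x. \<forall>t\<in>sphere \<zeta> \<rho>. upd x iu t \<in> ?N) (nhds (line w1))"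
    proof (rule eventually_upd_compact[OF _ oN])
      fix t assume t: "t \<in> sphere \<zeta> \<rho>"
      have "t \<in> cball \<zeta> \<rho>" using t by auto
      then have "pt w1 t \<in> V" using inW w1B sub[OF \<zeta>] by (meson ball_subset_cball subsetD)
      moreover have "f (pt w1 t) \<noteq> 0" using only[OF \<zeta> \<open>t \<in> cball \<zeta> \<rho>\<close>] t \<rho> by auto
      ultimately show "pt w1 t \<in> ?N" by simp
    qed auto
    show "eventually (\<lambda>x. \<zeta> \<notin> fib w1 \<longrightarrow> (\<forall>t\<in>cball \<zeta> \<rho>. upd x iu t \<in> {x. x $ iw \<noteq> 0} - A)) (nhds (line w1))"
    proof (cases "\<zeta> \<in> fib w1")
      case False
      have "eventually (\<lambda>x. \<forall>t\<in>cball \<zeta> \<rho>. upd x iu t \<in> {x. x $ iw \<noteq> 0} - A) (nhds (line w1))"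
      proof (rule eventually_upd_compact[OF _ open_diff_analytic[OF A]])
        fix t assume t: "t \<in> cball \<zeta> \<rho>"
        have "pt w1 t \<notin> A"
        proof
          assume "pt w1 t \<in> A"
          moreover have "pt w1 t \<in> V" using inW w1B sub[OF \<zeta>] t by (meson ball_subset_cball subsetD)
          ultimately have "f (pt w1 t) = 0" using van by (auto simp: vanishing_def)
          then have "t = \<zeta>" using only \<zeta> t by blast
          then show False using False \<open>pt w1 t \<in> A\<close> by (simp add: fib_def)
        qed
        then show "pt w1 t \<in> {x. x $ iw \<noteq> 0} - A" using idx w1(1) by simp
      qed auto
      then show ?thesis by simp
    qed auto
  qed
  moreover have "eventually (\<lambda>x. x \<in> ball (line w0) \<epsilon>) (nhds (line w1))"
    using w1B by (intro eventually_nhds_in_open) auto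
  moreover have "eventually (\<lambda>x. x \<in> ball (line w1) \<eta>) (nhds (line w1))"
    using w1(2) by (intro eventually_nhds_in_open) auto
  ultimately have "eventually (\<lambda>x. (\<forall>t\<in>?K. upd x iu t \<in> ?N) \<and> (\<forall>\<zeta>\<in>Z. (\<forall>t\<in>sphere \<zeta> \<rho>. upd x iu t \<in> ?N) \<and>
      (\<zeta> \<notin> fib w1 \<longrightarrow> (\<forall>t\<in>cball \<zeta> \<rho>. upd x iu t \<in> {x. x $ iw \<noteq> 0} - A))) \<and> x \<in> ball (line w0) \<epsilon> \<and> x \<in> ball (line w1) \<eta>) (nhds (line w1))"
    by eventually_elim blast
  then obtain \<delta> where \<delta>: "\<delta> > 0" and E: "\<And>x. x \<in> ball (line w1) \<delta> \<Longrightarrow> (\<forall>t\<in>?K. upd x iu t \<in> ?N) \<and>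
      (\<forall>\<zeta>\<in>Z. (\<forall>t\<in>sphere \<zeta> \<rho>. upd x iu t \<in> ?N) \<and>
      (\<zeta> \<notin> fib w1 \<longrightarrow> (\<forall>t\<in>cball \<zeta> \<rho>. upd x iu t \<in> {x. x $ iw \<noteq> 0} - A))) \<and> x \<in> ball (line w0) \<epsilon> \<and> x \<in> ball (line w1) \<eta>"
    unfolding eventually_nhds_metric by (auto simp: dist_commute)
  have lineE: "line w \<in> ball (line w1) \<delta>" if "w \<in> ball w1 \<delta>" for w
    using that by (simp add: dist_upd)
  have \<eta>: "w \<in> ball w1 \<eta>" if "w \<in> ball w1 \<delta>" for w
    using E[OF lineE[OF that]] by (simp add: dist_upd)
  have rd': "root_disc f V (ball (line w1) \<delta>) iu \<zeta> \<rho>" if \<zeta>: "\<zeta> \<in> Z" for \<zeta>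
  proof
    show "upd x iu t \<in> V" if "x \<in> ball (line w1) \<delta>" "t \<in> cball \<zeta> \<rho>" for x t
      using inW[of x t] E[OF that(1)] sub[OF \<zeta>] that(2) by (meson ball_subset_cball subsetD)
    show "f (upd x iu t) \<noteq> 0" if "x \<in> ball (line w1) \<delta>" "t \<in> sphere \<zeta> \<rho>" for x t
      using E[OF that(1)] \<zeta> that(2) by blast
  qed (use openW sephol_f \<rho> in auto)
  define M where "M \<zeta> w = root_mset (\<lambda>t. f (pt w t)) \<zeta> \<rho>" for \<zeta> w
  define N where "N \<zeta> = size (M \<zeta> w1)" for \<zeta>
  have setM: "set_mset (M \<zeta> w) = {t\<in>ball \<zeta> \<rho>. f (pt w t) = 0}" if "\<zeta> \<in> Z" "w \<in> ball w1 \<delta>" for \<zeta> w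
    unfolding M_def by (rule root_disc.set_roots[OF rd'[OF that(1)] lineE[OF that(2)]])
  have sizeM: "size (M \<zeta> w) = N \<zeta>" if "\<zeta> \<in> Z" "w \<in> ball w1 \<delta>" for \<zeta> w
    unfolding M_def N_def
    by (rule root_disc.size_roots_eq[OF rd'[OF that(1)]]) (use lineE[OF that(2)] \<delta> in auto)
  have Npos: "N \<zeta> > 0" if "\<zeta> \<in> Z" for \<zeta>
  proof -
    have "\<zeta> \<in># M \<zeta> w1" using setM[OF that, of w1] that \<delta> \<rho> by (auto simp: Z)
    then show ?thesis unfolding N_def by (metis nonempty_has_size empty_iff set_mset_empty)
  qed
  have union: "set_mset (root_mset (\<lambda>t. f (pt w t)) z r) = (\<Union>\<zeta>\<in>Z. set_mset (M \<zeta> w))" if w: "w \<in> ball w1 \<delta>" for w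
  proof -
    have "line w \<in> ball (line w0) \<epsilon>" using E[OF lineE[OF w]] by blast
    then have 1: "set_mset (root_mset (\<lambda>t. f (pt w t)) z r) = {t\<in>ball z r. f (pt w t) = 0}" by (rule set_roots)
    have "t \<in> (\<Union>\<zeta>\<in>Z. ball \<zeta> \<rho>)" if "t \<in> ball z r" "f (pt w t) = 0" for t
    proof -
      have "t \<notin> ?K" using E[OF lineE[OF w]] that(2) by blast
      then show ?thesis using that(1) by auto
    qed
    moreover have "ball \<zeta> \<rho> \<subseteq> ball z r" if "\<zeta> \<in> Z" for \<zeta> using sub[OF that] by auto
    ultimately show ?thesis unfolding 1 using setM[OF _ w] by blast
  qed
  have disjM: "a = b" if "a \<in> Z" "b \<in> Z" "t \<in># M a w" "t \<in># M b w" "w \<in> ball w1 \<delta>" for a b t w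
  proof (rule ccontr)
    assume "a \<noteq> b"
    then have "cball a \<rho> \<inter> cball b \<rho> = {}" using disj that by blast
    moreover have "t \<in> cball a \<rho>" "t \<in> cball b \<rho>" using that setM by auto
    ultimately show False by blast
  qed
  \<comment> \<open>There are n small discs and n distinct roots in all, and no disc loses its
    roots, so each contains exactly one.\<close>
  have card1: "card (set_mset (M \<zeta> w)) = 1" if \<zeta>: "\<zeta> \<in> Z" and w: "w \<in> ball w1 \<delta>" for \<zeta> w
  proof -
    have "card Z = n" using card[of w1] w1(2) by (simp add: Z_def)
    also have "n = card (\<Union>\<zeta>\<in>Z. set_mset (M \<zeta> w))" using card[OF \<eta>[OF w]] union[OF w] by simp
    also have "\<dots> = (\<Sum>\<zeta>\<in>Z. card (set_mset (M \<zeta> w)))"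
      by (rule card_UN_disjoint) (use finZ disjM w in blast)+
    finally have "(\<Sum>\<zeta>\<in>Z. 1) = (\<Sum>\<zeta>\<in>Z. card (set_mset (M \<zeta> w)))" by simp
    then have "1 = card (set_mset (M \<zeta> w))"
    proof (rule sum_mono_inv[OF _ _ \<zeta> finZ])
      fix a assume a: "a \<in> Z"
      have "M a w \<noteq> {#}" using sizeM[OF a w] Npos[OF a] by auto
      then show "1 \<le> card (set_mset (M a w))" by (simp add: Suc_le_eq card_gt_0_iff)
    qed
    then show ?thesis by simp
  qed
  define \<theta> where "\<theta> \<zeta> w = the_elem (set_mset (M \<zeta> w))" for \<zeta> w
  have \<theta>: "set_mset (M \<zeta> w) = {\<theta> \<zeta> w}" if "\<zeta> \<in> Z" "w \<in> ball w1 \<delta>" for \<zeta> w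
    using card1[OF that] unfolding \<theta>_def by (metis card_1_singletonE the_elem_eq)
  have M\<theta>: "M \<zeta> w = replicate_mset (N \<zeta>) (\<theta> \<zeta> w)" if "\<zeta> \<in> Z" "w \<in> ball w1 \<delta>" for \<zeta> w
    using set_mset_subset_singletonD[of "M \<zeta> w" "\<theta> \<zeta> w"] \<theta>[OF that] sizeM[OF that] by simp
  \<comment> \<open>The single root is counted \<open>N \<zeta>\<close> times, so the root sum of
    \<open>h\<close> divided by \<open>N \<zeta>\<close> is the value of \<open>h\<close> on the
    branch.\<close>
  have hol: "(\<lambda>w. h (pt w (\<theta> \<zeta> w))) holomorphic_on ball w1 \<delta>" if h: "sephol h V" and \<zeta>: "\<zeta> \<in> Z" for h \<zeta>
  proof -
    have "(\<lambda>w. \<Sum>t\<in>#M \<zeta> w. h (pt w t)) holomorphic_on ball w1 \<delta>"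
      unfolding M_def by (rule sephol_line, rule root_disc.sephol_root_sum[OF rd'[OF \<zeta>] h])
    then have "(\<lambda>w. (\<Sum>t\<in>#M \<zeta> w. h (pt w t)) / of_nat (N \<zeta>)) holomorphic_on ball w1 \<delta>"
      using Npos[OF \<zeta>] by (intro holomorphic_intros) auto
    then show ?thesis
      by (rule holomorphic_transform) (use M\<theta>[OF \<zeta>] Npos[OF \<zeta>] in auto)
  qed
  have \<theta>_hol: "\<theta> \<zeta> holomorphic_on ball w1 \<delta>" if "\<zeta> \<in> Z" for \<zeta>
    using hol[OF sephol_nth[of iu] that] by simp
  have \<theta>_in: "\<theta> \<zeta> w \<in> ball \<zeta> \<rho>" "f (pt w (\<theta> \<zeta> w)) = 0" if "\<zeta> \<in> Z" "w \<in> ball w1 \<delta>" for \<zeta> w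
    using \<theta>[OF that] setM[OF that] by auto
  have \<theta>_eq: "t = \<theta> \<zeta> w" if "\<zeta> \<in> Z" "w \<in> ball w1 \<delta>" "t \<in> ball \<zeta> \<rho>" "f (pt w t) = 0" for \<zeta> w t
    using \<theta>[OF that(1,2)] setM[OF that(1,2)] that(3,4) by auto
  have \<theta>1: "\<theta> \<zeta> w1 = \<zeta>" if "\<zeta> \<in> Z" for \<zeta>
    using \<theta>_eq[OF that, of w1 \<zeta>] that \<delta> \<rho> by (auto simp: Z)
  have \<theta>_V: "pt w (\<theta> \<zeta> w) \<in> V" if "\<zeta> \<in> Z" "w \<in> ball w1 \<delta>" for \<zeta> w
    using root_disc.inW[OF rd'[OF that(1)] lineE[OF that(2)], of "\<theta> \<zeta> w"] \<theta>_in(1)[OF that] by auto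
  define G where "G = {\<zeta>\<in>Z. \<zeta> \<in> fib w1}"
  \<comment> \<open>If the branch left \<open>A\<close>, an equation of \<open>A\<close> would not
    vanish identically along it and \<open>w1\<close> would be an isolated zero. But
    \<open>nonisolated_fib\<close> gives points of \<open>A\<close> near (w1, \<zeta>) with another
    w, and these lie on the branch, as \<open>f\<close> has only one root in the small disc.\<close>
  have G1: "\<theta> \<zeta> w \<in> fib w" if \<zeta>: "\<zeta> \<in> G" and w: "w \<in> ball w1 \<delta>" for \<zeta> w
  proof (rule ccontr)
    assume "\<theta> \<zeta> w \<notin> fib w"
    have \<zeta>Z: "\<zeta> \<in> Z" using \<zeta> by (simp add: G_def)
    have "pt w (\<theta> \<zeta> w) \<in> V - A" using \<open>\<theta> \<zeta> w \<notin> fib w\<close> \<theta>_V[OF \<zeta>Z w] by (simp add: fib_def)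
    then obtain h where h: "vanishing A V h" "h (pt w (\<theta> \<zeta> w)) \<noteq> 0" using cut unfolding cut_out_def by blast
    let ?k = "\<lambda>w. h (pt w (\<theta> \<zeta> w))"
    have k: "?k holomorphic_on ball w1 \<delta>" using h(1) hol \<zeta>Z by (auto simp: vanishing_def)
    have k0: "?k w' = 0" if "w' \<in> ball w1 \<delta>" "\<theta> \<zeta> w' \<in> fib w'" for w'
      using h(1) \<theta>_V[OF \<zeta>Z that(1)] that(2) by (auto simp: vanishing_def fib_def)
    have "?k w1 = 0" by (rule k0) (use \<delta> \<theta>1[OF \<zeta>Z] \<zeta> in \<open>auto simp: G_def\<close>)
    then obtain r2 where r2: "r2 > 0" "ball w1 r2 \<subseteq> ball w1 \<delta>" "\<And>v. v \<in> ball w1 r2 - {w1} \<Longrightarrow> ?k v \<noteq> 0"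
      using isolated_zeros[OF k _ _ _ _ w h(2), of w1] \<delta> by (metis centre_in_ball connected_ball open_ball)
    have "\<zeta> \<in> fib w1" "min r2 \<rho> > 0" using \<zeta> r2(1) \<rho> by (simp_all add: G_def)
    from nonisolated_fib[OF this] obtain w' u' where wu: "u' \<in> fib w'" "w' \<noteq> w1" "dist w' w1 < min r2 \<rho>" "dist u' \<zeta> < min r2 \<rho>"
      by blast
    have w': "w' \<in> ball w1 r2 - {w1}" using wu by (auto simp: dist_commute)
    then have w'\<delta>: "w' \<in> ball w1 \<delta>" using r2(2) by blast
    have u': "u' \<in> ball \<zeta> \<rho>" using wu by (auto simp: dist_commute)
    have "pt w' u' \<in> V" using root_disc.inW[OF rd'[OF \<zeta>Z] lineE[OF w'\<delta>], of u'] u' by auto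
    then have "f (pt w' u') = 0" using van wu(1) by (auto simp: vanishing_def fib_def)
    then have "u' = \<theta> \<zeta> w'" using \<theta>_eq[OF \<zeta>Z w'\<delta> u'] by blast
    then have "?k w' = 0" using k0[OF w'\<delta>] wu(1) by simp
    then show False using r2(3)[OF w'] by simp
  qed
  have fibG: "fib w \<inter> ball z r = (\<lambda>\<zeta>. \<theta> \<zeta> w) ` G" if w: "w \<in> ball w1 \<delta>" for w
  proof
    show "(\<lambda>\<zeta>. \<theta> \<zeta> w) ` G \<subseteq> fib w \<inter> ball z r"
    proof
      fix u assume "u \<in> (\<lambda>\<zeta>. \<theta> \<zeta> w) ` G"
      then obtain \<zeta> where \<zeta>: "\<zeta> \<in> G" "u = \<theta> \<zeta> w" by blast
      then have "\<zeta> \<in> Z" by (simp add: G_def)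
      then have "\<theta> \<zeta> w \<in> cball \<zeta> \<rho>" using \<theta>_in(1)[OF _ w] by (meson ball_subset_cball subsetD)
      then have "\<theta> \<zeta> w \<in> ball z r" using sub[OF \<open>\<zeta> \<in> Z\<close>] by blast
      then show "u \<in> fib w \<inter> ball z r" using G1[OF \<zeta>(1) w] \<zeta>(2) by simp
    qed
    show "fib w \<inter> ball z r \<subseteq> (\<lambda>\<zeta>. \<theta> \<zeta> w) ` G"
    proof
      fix u assume u: "u \<in> fib w \<inter> ball z r"
      have "line w \<in> ball (line w0) \<epsilon>" using E[OF lineE[OF w]] by blast
      then have "pt w u \<in> V" using inW[of "line w" u] u by auto
      then have f0: "f (pt w u) = 0" using u van by (auto simp: vanishing_def fib_def)
      then have "u \<in># root_mset (\<lambda>t. f (pt w t)) z r"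
        using set_roots[OF \<open>line w \<in> ball (line w0) \<epsilon>\<close>] u by simp
      then obtain \<zeta> where \<zeta>: "\<zeta> \<in> Z" "u \<in># M \<zeta> w" using union[OF w] by blast
      then have "u = \<theta> \<zeta> w" using \<theta>[OF \<zeta>(1) w] by simp
      moreover have "\<zeta> \<in> fib w1"
      proof (rule ccontr)
        assume "\<zeta> \<notin> fib w1"
        then have "\<forall>t\<in>cball \<zeta> \<rho>. pt w t \<notin> A" using E[OF lineE[OF w]] \<zeta>(1) by blast
        moreover have "u \<in> cball \<zeta> \<rho>" using setM[OF \<zeta>(1) w] \<zeta>(2) by auto
        ultimately show False using u by (auto simp: fib_def)
      qed
      ultimately show "u \<in> (\<lambda>\<zeta>. \<theta> \<zeta> w) ` G" using \<zeta>(1) by (auto simp: G_def)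
    qed
  qed
  have inj: "inj_on (\<lambda>\<zeta>. \<theta> \<zeta> w) G" if w: "w \<in> ball w1 \<delta>" for w
  proof (rule inj_onI)
    fix a b assume ab: "a \<in> G" "b \<in> G" "\<theta> a w = \<theta> b w"
    then have "a \<in> Z" "b \<in> Z" by (auto simp: G_def)
    then show "a = b" using disjM[of a b "\<theta> a w" w] \<theta>[OF _ w] ab(3) w by simp
  qed
  have finG: "finite G" using finZ by (simp add: G_def)
  have "poly_holomorphic_on (\<lambda>w. \<Prod>\<zeta>\<in>G. [:- \<theta> \<zeta> w, 1:]) (ball w1 \<delta>)"
    by (intro poly_holomorphic_on_prod poly_holomorphic_on_linear \<theta>_hol) (simp add: G_def)
  then have "poly_holomorphic_on (\<lambda>w. \<Prod>u\<in>fib w \<inter> ball z r. [:- u, 1:]) (ball w1 \<delta>)"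
    by (rule poly_holomorphic_on_cong) (simp add: fibG prod.reindex[OF inj])
  moreover have "finite (fib w \<inter> ball z r) \<and> card (fib w \<inter> ball z r) = card G" if "w \<in> ball w1 \<delta>" for w
    using fibG[OF that] card_image[OF inj[OF that]] finG by simp
  ultimately show ?thesis using \<delta> by blast
qed

end

section \<open>From root polynomials of the fibres to Laurent coefficients\<close>

lemma monic_linear_prod:
  fixes F :: "complex set"
  assumes "finite F"
  shows "degree (\<Prod>u\<in>F. [:- u, 1:]) = card F"
    and "(\<And>u. u \<in> F \<Longrightarrow> norm u \<le> B) \<Longrightarrow> norm (coeff (\<Prod>u\<in>F. [:- u, 1:]) k) \<le> (1 + B) ^ card F"
proof -
  show "degree (\<Prod>u\<in>F. [:- u, 1:]) = card F" by (subst degree_prod_sum_eq) auto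
  show "norm (coeff (\<Prod>u\<in>F. [:- u, 1:]) k) \<le> (1 + B) ^ card F" if "\<And>u. u \<in> F \<Longrightarrow> norm u \<le> B"
    using assms that
  proof (induction F arbitrary: k rule: finite_induct)
    case empty
    then show ?case by (simp add: coeff_1)
  next
    case (insert a F)
    let ?p = "\<Prod>u\<in>F. [:- u, 1:]"
    have B: "0 \<le> B" "norm a \<le> B" using insert.prems[of a] norm_ge_zero[of a] by (auto simp del: norm_ge_zero)
    have IH: "norm (coeff ?p j) \<le> (1 + B) ^ card F" for j using insert by auto
    \<comment> \<open>A new coefficient is the preceding old one minus \<open>a\<close> times the
      old one, so the bound grows by a factor of at most 1 + B.\<close>
    have "norm (coeff ([:- a, 1:] * ?p) k) \<le> norm a * norm (coeff ?p k) + (1 + B) ^ card F"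
    proof (cases k)
      case 0
      then show ?thesis using B by (simp add: norm_mult)
    next
      case (Suc j)
      have "norm (coeff ([:- a, 1:] * ?p) k) \<le> norm (a * coeff ?p k) + norm (coeff ?p j)"
        using norm_triangle_ineq4[of "coeff ?p j" "a * coeff ?p k"] by (simp add: Suc)
      then show ?thesis using IH[of j] by (simp add: norm_mult)
    qed
    also have "\<dots> \<le> B * (1 + B) ^ card F + (1 + B) ^ card F"
      using B IH[of k] by (intro add_mono mult_mono) auto
    also have "\<dots> = (1 + B) ^ card (insert a F)" using insert.hyps by (simp add: algebra_simps)
    finally show ?case using insert.hyps by simp
  qed
qed

lemma poly_linear_prod_altdef:
  fixes F :: "complex set"
  assumes "finite F" "card F = N"
  shows "(\<Sum>k\<le>N. coeff (\<Prod>u\<in>F. [:- u, 1:]) k * v ^ k) = (\<Prod>u\<in>F. v - u)"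
proof -
  have "(\<Sum>k\<le>N. coeff (\<Prod>u\<in>F. [:- u, 1:]) k * v ^ k) = poly (\<Prod>u\<in>F. [:- u, 1:]) v"
    using monic_linear_prod(1)[OF assms(1)] assms(2) by (simp add: poly_altdef)
  then show ?thesis by (simp add: poly_prod)
qed

text \<open>Multiplied by w ^ e, the function is bounded near 0 and so extends to an entire
  function; this grows at most like the power 2 e of the norm, hence is a polynomial of degree at
  most 2 e by Liouville.\<close>

lemma holomorphic_punctured_growth_imp_Laurent:
  assumes hol: "g holomorphic_on - {0}"
    and bd: "\<And>w. w \<noteq> 0 \<Longrightarrow> norm (g w) \<le> C * (norm w + inverse (norm w)) ^ e"
  shows "\<exists>c. \<forall>w. w \<noteq> 0 \<longrightarrow> g w = (\<Sum>j\<le>2 * e. c j * w ^ j) / w ^ e"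
proof -
  have C: "norm (w ^ e * g w) \<le> C * (norm w ^ 2 + 1) ^ e" if "w \<noteq> 0" for w
  proof -
    have "norm (w ^ e * g w) \<le> norm w ^ e * (C * (norm w + inverse (norm w)) ^ e)"
      unfolding norm_mult norm_power by (intro mult_left_mono bd that) auto
    also have "\<dots> = C * (norm w * (norm w + inverse (norm w))) ^ e" by (simp add: power_mult_distrib)
    also have "norm w * (norm w + inverse (norm w)) = norm w ^ 2 + 1"
      using that by (simp add: algebra_simps power2_eq_square)
    finally show ?thesis .
  qed
  \<comment> \<open>The bound at w = 1 shows that \<open>C\<close> is nonnegative.\<close>
  have "norm (g 1) \<le> C * 2 ^ e" using bd[of 1] by simp
  then have "0 \<le> C * 2 ^ e" using norm_ge_zero order_trans by blast
  then have C0: "C \<ge> 0" using mult_neg_pos[of C "2 ^ e"] by force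
  have "\<exists>h. h holomorphic_on UNIV \<and> (\<forall>w\<in>UNIV - {0}. h w = w ^ e * g w)"
  proof (subst holomorphic_on_extend_bounded)
    show "(\<lambda>w. w ^ e * g w) holomorphic_on UNIV - {0}"
      using hol by (auto intro!: holomorphic_intros simp: Compl_eq_Diff_UNIV)
    have "eventually (\<lambda>w. w \<in> ball 0 1 - {0}) (at (0 :: complex))"
      by (rule eventually_at_in_open) auto
    then have "eventually (\<lambda>w. norm (w ^ e * g w) \<le> C * 2 ^ e) (at 0)"
    proof eventually_elim
      case (elim w)
      then have "norm (w ^ e * g w) \<le> C * (norm w ^ 2 + 1) ^ e" using C by auto
      also have "\<dots> \<le> C * 2 ^ e"
      proof (intro mult_left_mono power_mono C0)
        have "norm w ^ 2 \<le> 1" using elim by (simp add: power_le_one)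
        then show "norm w ^ 2 + 1 \<le> 2" by simp
      qed auto
      finally show ?case .
    qed
    then show "\<exists>B. eventually (\<lambda>w. norm (w ^ e * g w) \<le> B) (at 0)" by blast
  qed auto
  then obtain h where h: "h holomorphic_on UNIV" "\<And>w. w \<noteq> 0 \<Longrightarrow> h w = w ^ e * g w" by auto
  have "h w = (\<Sum>k\<le>2 * e. (deriv ^^ k) h 0 / fact k * w ^ k)" for w
  proof (rule Liouville_polynomial[OF h(1)])
    fix z :: complex assume z: "1 \<le> norm z"
    then have "z \<noteq> 0" by auto
    have "norm (h z) \<le> C * (norm z ^ 2 + 1) ^ e" using C h(2) \<open>z \<noteq> 0\<close> by simp
    also have "\<dots> \<le> C * (2 * norm z ^ 2) ^ e"
      using z by (intro mult_left_mono power_mono C0) auto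
    also have "\<dots> = (C * 2 ^ e) * norm z ^ (2 * e)" by (simp add: power_mult_distrib power_mult)
    finally show "norm (h z) \<le> (C * 2 ^ e) * norm z ^ (2 * e)" .
  qed
  then have "g w = (\<Sum>k\<le>2 * e. (deriv ^^ k) h 0 / fact k * w ^ k) / w ^ e" if "w \<noteq> 0" for w
    using h(2)[OF that] that by (metis nonzero_mult_div_cancel_left power_not_zero)
  then show ?thesis by (intro exI[of _ "\<lambda>k. (deriv ^^ k) h 0 / fact k"]) auto
qed

context analytic_multifunction
begin

lemma finite_fib: "finite (fib w)"
proof (cases "w = 0")
  case True
  then have "fib w = {}" using fib_nonzero by blast
  then show ?thesis by simp
next
  case False
  obtain K \<kappa> where K: "\<And>w u. u \<in> fib w \<Longrightarrow> norm u \<le> K * (norm w + inverse (norm w)) ^ \<kappa>"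
    using fib_bound by metis
  have "fib w \<subseteq> cball 0 (K * (norm w + inverse (norm w)) ^ \<kappa>)"
    using K by auto
  then have "bounded (fib w)" using bounded_cball bounded_subset by blast
  then show ?thesis unfolding fib_def by (intro finite_fibre[OF A]) (use False idx in auto)
qed

definition fib_poly :: "complex \<Rightarrow> complex poly" where
  "fib_poly w = (\<Prod>u\<in>fib w. [:- u, 1:])"

text \<open>On a small punctured disc the equations have a constant number of distinct roots in each
  disc of \<open>local_discs\<close>, so \<open>local_graphs\<close> applies around every
  \<open>w1\<close>, and the root polynomial of the fibre is the product over the discs.
  Connectedness of the punctured disc then gives a constant number of points.\<close>

lemma fib_poly_local:
  assumes w0: "w0 \<noteq> 0"
  obtains \<delta> m where "\<delta> > 0" "ball w0 \<delta> \<subseteq> - {0}" "poly_holomorphic_on fib_poly (ball w0 \<delta> - {w0})"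
    "\<And>w. w \<in> ball w0 \<delta> - {w0} \<Longrightarrow> card (fib w) = m"
proof -
  obtain R where R: "eventually (\<lambda>x. \<forall>t. upd x iu t \<in> A \<longrightarrow> norm t \<le> R) (nhds (line w0))"
    using locally_bounded[OF w0] by blast
  let ?U = "{x :: complex ^ 'k. x $ iw \<noteq> 0}"
  have p: "line w0 \<in> ?U" using w0 by simp
  have Ui: "upd x iu t \<in> ?U" if "x \<in> ?U" for x t using that idx by simp
  obtain \<epsilon> V f r where E: "\<epsilon> > 0" "ball (line w0) \<epsilon> \<subseteq> ?U" "finite {t. pt w0 t \<in> A}"
    "\<And>\<zeta>. pt w0 \<zeta> \<in> A \<Longrightarrow> root_disc (f \<zeta>) (V \<zeta>) (ball (line w0) \<epsilon>) iu \<zeta> (r \<zeta>)"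
    "\<And>\<zeta>. pt w0 \<zeta> \<in> A \<Longrightarrow> vanishing A (V \<zeta>) (f \<zeta>)"
    "\<And>\<zeta>. pt w0 \<zeta> \<in> A \<Longrightarrow> cut_out A (V \<zeta>)"
    "\<And>\<zeta> \<zeta>'. pt w0 \<zeta> \<in> A \<Longrightarrow> pt w0 \<zeta>' \<in> A \<Longrightarrow> \<zeta> \<noteq> \<zeta>' \<Longrightarrow> cball \<zeta> (r \<zeta>) \<inter> cball \<zeta>' (r \<zeta>') = {}"
    "\<And>x t. x \<in> ball (line w0) \<epsilon> \<Longrightarrow> upd x iu t \<in> A \<Longrightarrow> \<exists>\<zeta>. pt w0 \<zeta> \<in> A \<and> t \<in> ball \<zeta> (r \<zeta>)"
    by (rule local_discs[OF open_U A p Ui R]) (assumption, rule that, assumption+)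
  define L where "L = {t. pt w0 t \<in> A}"
  have finL: "finite L" using E(3) by (simp add: L_def)
  have line_in: "line w \<in> ball (line w0) \<epsilon>" if "w \<in> ball w0 \<epsilon>" for w
    using that by (simp add: dist_upd)
  have nz: "w \<noteq> 0" if "w \<in> ball w0 \<epsilon>" for w
    using E(2) line_in[OF that] by auto
  let ?M = "\<lambda>\<zeta> w. root_mset (\<lambda>t. f \<zeta> (pt w t)) \<zeta> (r \<zeta>)"
  \<comment> \<open>All distinct roots of the local equations are counted here, also those off
    \<open>A\<close>, as \<open>local_graphs\<close> demands.\<close>
  have "\<exists>\<delta>>0. \<forall>\<zeta>\<in>L. \<delta> \<le> \<epsilon> \<and> (\<exists>n. \<forall>w\<in>ball w0 \<delta> - {w0}. card (set_mset (?M \<zeta> w)) = n)"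
  proof (rule finite_uniform_radius[OF finL])
    fix \<zeta> assume "\<zeta> \<in> L"
    then interpret root_disc "f \<zeta>" "V \<zeta>" "ball (line w0) \<epsilon>" iu \<zeta> "r \<zeta>" using E(4) by (simp add: L_def)
    have "(\<lambda>w. \<Sum>t\<in>#?M \<zeta> w. t ^ k) holomorphic_on ball w0 \<epsilon>" for k
      using sephol_line[OF sephol_root_sum[OF sephol_power[OF sephol_nth[of iu], of k]]] by simp
    moreover have "size (?M \<zeta> w) = size (?M \<zeta> w0)" if "w \<in> ball w0 \<epsilon>" for w
      using E(1) line_in[OF that] by (intro size_roots_eq) auto
    ultimately show "\<exists>\<delta>>0. \<delta> \<le> \<epsilon> \<and> (\<exists>n. \<forall>w\<in>ball w0 \<delta> - {w0}. card (set_mset (?M \<zeta> w)) = n)"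
      using card_distinct_roots_generic[of "?M \<zeta>" w0 \<epsilon> "size (?M \<zeta> w0)"] E(1) by metis
  next
    fix \<zeta> \<delta> \<delta>'
    assume *: "\<delta> \<le> \<epsilon> \<and> (\<exists>n. \<forall>w\<in>ball w0 \<delta> - {w0}. card (set_mset (?M \<zeta> w)) = n)" "\<delta>' \<le> \<delta>"
    then obtain n where n: "\<And>w. w \<in> ball w0 \<delta> - {w0} \<Longrightarrow> card (set_mset (?M \<zeta> w)) = n" by blast
    have "\<forall>w\<in>ball w0 \<delta>' - {w0}. card (set_mset (?M \<zeta> w)) = n"
      using n *(2) by auto
    then show "\<delta>' \<le> \<epsilon> \<and> (\<exists>n. \<forall>w\<in>ball w0 \<delta>' - {w0}. card (set_mset (?M \<zeta> w)) = n)"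
      using * by auto
  qed
  then obtain \<delta>0 where \<delta>0: "\<delta>0 > 0" "\<And>\<zeta>. \<zeta> \<in> L \<Longrightarrow> \<exists>n. \<forall>w\<in>ball w0 \<delta>0 - {w0}. card (set_mset (?M \<zeta> w)) = n"
    by blast
  define \<delta> where "\<delta> = min \<delta>0 \<epsilon>"
  have \<delta>: "\<delta> > 0" "ball w0 \<delta> \<subseteq> ball w0 \<epsilon>" "ball w0 \<delta> \<subseteq> ball w0 \<delta>0"
    using \<delta>0(1) E(1) by (auto simp: \<delta>_def)
  have loc: "\<exists>d>0. ball w1 d \<subseteq> ball w0 \<delta> - {w0} \<and> poly_holomorphic_on fib_poly (ball w1 d) \<and>
      (\<exists>m. \<forall>w\<in>ball w1 d. card (fib w) = m)" if w1: "w1 \<in> ball w0 \<delta> - {w0}" for w1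
  proof -
    have "open (ball w0 \<delta> - {w0})" by auto
    then obtain \<eta> where \<eta>: "\<eta> > 0" "ball w1 \<eta> \<subseteq> ball w0 \<delta> - {w0}" using w1 open_contains_ball by blast
    let ?P = "\<lambda>\<zeta> w. \<Prod>u\<in>fib w \<inter> ball \<zeta> (r \<zeta>). [:- u, 1:]"
    have "\<exists>d>0. \<forall>\<zeta>\<in>L. \<exists>m. poly_holomorphic_on (?P \<zeta>) (ball w1 d) \<and>
        (\<forall>w\<in>ball w1 d. finite (fib w \<inter> ball \<zeta> (r \<zeta>)) \<and> card (fib w \<inter> ball \<zeta> (r \<zeta>)) = m)"
    proof (rule finite_uniform_radius[OF finL])
      fix \<zeta> assume \<zeta>: "\<zeta> \<in> L"
      then obtain n where n: "\<And>w. w \<in> ball w0 \<delta>0 - {w0} \<Longrightarrow> card (set_mset (?M \<zeta> w)) = n"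
        using \<delta>0(2) by blast
      show "\<exists>d>0. \<exists>m. poly_holomorphic_on (?P \<zeta>) (ball w1 d) \<and>
        (\<forall>w\<in>ball w1 d. finite (fib w \<inter> ball \<zeta> (r \<zeta>)) \<and> card (fib w \<inter> ball \<zeta> (r \<zeta>)) = m)"
      proof (rule local_graphs)
        show "root_disc (f \<zeta>) (V \<zeta>) (ball (line w0) \<epsilon>) iu \<zeta> (r \<zeta>)" "vanishing A (V \<zeta>) (f \<zeta>)" "cut_out A (V \<zeta>)"
          using E(4-6) \<zeta> by (auto simp: L_def)
        show "w1 \<noteq> 0" using nz w1 \<delta>(2) by blast
        show "\<eta> > 0" by (rule \<eta>(1))
        show "ball w1 \<eta> \<subseteq> ball w0 \<epsilon>" using \<eta>(2) \<delta>(2) by blast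
        show "card (set_mset (?M \<zeta> w)) = n" if "w \<in> ball w1 \<eta>" for w
          using n \<eta>(2) \<delta>(3) that by blast
      qed
    next
      fix \<zeta> d d'
      assume *: "\<exists>m. poly_holomorphic_on (?P \<zeta>) (ball w1 d) \<and>
        (\<forall>w\<in>ball w1 d. finite (fib w \<inter> ball \<zeta> (r \<zeta>)) \<and> card (fib w \<inter> ball \<zeta> (r \<zeta>)) = m)" "d' \<le> d"
      have "ball w1 d' \<subseteq> ball w1 d" using *(2) by auto
      then show "\<exists>m. poly_holomorphic_on (?P \<zeta>) (ball w1 d') \<and>
        (\<forall>w\<in>ball w1 d'. finite (fib w \<inter> ball \<zeta> (r \<zeta>)) \<and> card (fib w \<inter> ball \<zeta> (r \<zeta>)) = m)"
        using *(1) poly_holomorphic_on_subset by (meson subsetD)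
    qed
    then obtain d0 where d0: "d0 > 0" "\<forall>\<zeta>\<in>L. \<exists>m. poly_holomorphic_on (?P \<zeta>) (ball w1 d0) \<and>
        (\<forall>w\<in>ball w1 d0. finite (fib w \<inter> ball \<zeta> (r \<zeta>)) \<and> card (fib w \<inter> ball \<zeta> (r \<zeta>)) = m)" by blast
    from bchoice[OF d0(2)] obtain m where m: "\<forall>\<zeta>\<in>L. poly_holomorphic_on (?P \<zeta>) (ball w1 d0) \<and>
        (\<forall>w\<in>ball w1 d0. finite (fib w \<inter> ball \<zeta> (r \<zeta>)) \<and> card (fib w \<inter> ball \<zeta> (r \<zeta>)) = m \<zeta>)" ..
    define d where "d = min d0 \<eta>"
    have d: "d > 0" "ball w1 d \<subseteq> ball w1 d0" "ball w1 d \<subseteq> ball w0 \<delta> - {w0}"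
      using d0(1) \<eta> by (auto simp: d_def)
    have union: "fib w = (\<Union>\<zeta>\<in>L. fib w \<inter> ball \<zeta> (r \<zeta>))" if "w \<in> ball w1 d" for w
    proof -
      have "line w \<in> ball (line w0) \<epsilon>" using that d(3) \<delta>(2) line_in by blast
      then have "\<exists>\<zeta>\<in>L. u \<in> ball \<zeta> (r \<zeta>)" if "u \<in> fib w" for u
        using E(8) that unfolding fib_def L_def by blast
      then show ?thesis by blast
    qed
    have disj: "\<forall>a\<in>L. \<forall>b\<in>L. a \<noteq> b \<longrightarrow> (fib w \<inter> ball a (r a)) \<inter> (fib w \<inter> ball b (r b)) = {}" for w
    proof (intro ballI impI)
      fix a b assume "a \<in> L" "b \<in> L" "a \<noteq> b"
      then have "cball a (r a) \<inter> cball b (r b) = {}" using E(7) by (simp add: L_def)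
      then show "(fib w \<inter> ball a (r a)) \<inter> (fib w \<inter> ball b (r b)) = {}"
        using ball_subset_cball by blast
    qed
    have fin: "\<forall>\<zeta>\<in>L. finite (fib w \<inter> ball \<zeta> (r \<zeta>))" for w using finite_fib by blast
    have "poly_holomorphic_on (\<lambda>w. \<Prod>\<zeta>\<in>L. ?P \<zeta> w) (ball w1 d)"
      by (intro poly_holomorphic_on_prod) (use m poly_holomorphic_on_subset[OF _ d(2)] in blast)
    moreover have "fib_poly w = (\<Prod>\<zeta>\<in>L. ?P \<zeta> w)" if "w \<in> ball w1 d" for w
      unfolding fib_poly_def by (subst union[OF that], rule prod.UNION_disjoint[OF finL fin disj])
    ultimately have "poly_holomorphic_on fib_poly (ball w1 d)"
      using poly_holomorphic_on_cong by (metis (no_types, lifting))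
    moreover have "card (fib w) = (\<Sum>\<zeta>\<in>L. m \<zeta>)" if w: "w \<in> ball w1 d" for w
    proof -
      have "card (fib w) = (\<Sum>\<zeta>\<in>L. card (fib w \<inter> ball \<zeta> (r \<zeta>)))"
        by (subst union[OF w], rule card_UN_disjoint[OF finL fin disj])
      also have "\<dots> = (\<Sum>\<zeta>\<in>L. m \<zeta>)"
        using m w d(2) by (intro sum.cong) auto
      finally show ?thesis .
    qed
    ultimately show ?thesis using d(1,3) by blast
  qed
  have "(\<lambda>w. card (fib w)) constant_on (ball w0 \<delta> - {w0})"
  proof (rule locally_constant_imp_constant)
    show "connected (ball w0 \<delta> - {w0})" by (rule connected_punctured_ball) simp
    fix a assume a: "a \<in> ball w0 \<delta> - {w0}"
    obtain d m where d: "d > 0" "ball a d \<subseteq> ball w0 \<delta> - {w0}" "\<And>w. w \<in> ball a d \<Longrightarrow> card (fib w) = m"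
      using loc[OF a] by blast
    have "card (fib x) = card (fib a)" if "x \<in> ball a d" for x
      using d(3)[OF that] d(3)[of a] d(1) by simp
    moreover have "openin (top_of_set (ball w0 \<delta> - {w0})) (ball a d)"
      by (rule open_subset[OF d(2)]) simp
    moreover have "a \<in> ball a d" using d(1) by simp
    ultimately show "\<exists>T. openin (top_of_set (ball w0 \<delta> - {w0})) T \<and> a \<in> T \<and> (\<forall>x\<in>T. card (fib x) = card (fib a))"
      by blast
  qed
  then have "\<exists>m. \<forall>w\<in>ball w0 \<delta> - {w0}. card (fib w) = m"
    unfolding constant_on_def .
  then obtain m where "\<forall>w\<in>ball w0 \<delta> - {w0}. card (fib w) = m" ..
  then have m: "\<And>w. w \<in> ball w0 \<delta> - {w0} \<Longrightarrow> card (fib w) = m" by (rule bspec)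
  have hol: "poly_holomorphic_on fib_poly (ball w0 \<delta> - {w0})"
    by (rule poly_holomorphic_on_local) (use loc in blast)
  have "ball w0 \<delta> \<subseteq> - {0}" using nz \<delta>(2) by blast
  then show ?thesis by (rule that[OF \<delta>(1) _ hol m])
qed

text \<open>The number of points over w near but different from \<open>w0\<close> is locally
  constant in \<open>w0\<close>, even across exceptional values, since the fibre over
  \<open>w0\<close> itself is ignored; and the punctured plane is connected.\<close>

lemma card_fib_generic:
  obtains N where "\<And>w0. w0 \<noteq> 0 \<Longrightarrow> eventually (\<lambda>w. card (fib w) = N) (at w0)"
proof -
  have "\<exists>m. eventually (\<lambda>w. card (fib w) = m) (at w0)" if w0: "w0 \<noteq> 0" for w0
  proof -
    obtain \<delta> m where \<delta>: "\<delta> > 0" "\<And>w. w \<in> ball w0 \<delta> - {w0} \<Longrightarrow> card (fib w) = m"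
      using fib_poly_local[OF w0] by metis
    have "eventually (\<lambda>w. w \<in> ball w0 \<delta> - {w0}) (at w0)"
      by (rule eventually_at_in_open) (use \<delta> in auto)
    then show ?thesis using \<delta>(2) by (blast intro: eventually_mono)
  qed
  then obtain m where m: "\<And>w0. w0 \<noteq> 0 \<Longrightarrow> eventually (\<lambda>w. card (fib w) = m w0) (at w0)" by metis
  have "m constant_on - {0}"
  proof (rule locally_constant_imp_constant)
    show "connected (- {0 :: complex})" by (rule connected_punctured_universe) simp
    fix a :: complex assume "a \<in> - {0}"
    then obtain \<delta> k where \<delta>: "\<delta> > 0" "ball a \<delta> \<subseteq> - {0}" "\<And>w. w \<in> ball a \<delta> - {a} \<Longrightarrow> card (fib w) = k"
      using fib_poly_local[of a] by (metis ComplD singletonI)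
    have "m x = k" if x: "x \<in> ball a \<delta>" for x
    proof -
      have "eventually (\<lambda>w. card (fib w) = m x) (at x)" using m x \<delta>(2) by blast
      moreover have "eventually (\<lambda>w. w \<in> ball a \<delta> - {a}) (at x)"
      proof (cases "x = a")
        case True
        then show ?thesis using \<delta>(1) eventually_at_in_open[of "ball a \<delta>" a] by auto
      next
        case False
        then show ?thesis using x by (intro eventually_at_in_open') auto
      qed
      ultimately have "eventually (\<lambda>w. m x = k) (at x)"
        by eventually_elim (use \<delta>(3) in auto)
      then show ?thesis by simp
    qed
    moreover have "openin (top_of_set (- {0})) (ball a \<delta>)"
      by (rule open_subset[OF \<delta>(2)]) simp
    moreover have "a \<in> ball a \<delta>" using \<delta>(1) by simp
    ultimately show "\<exists>T. openin (top_of_set (- {0})) T \<and> a \<in> T \<and> (\<forall>x\<in>T. m x = m a)"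
      by metis
  qed
  then obtain N where "\<And>w. w \<noteq> 0 \<Longrightarrow> m w = N" unfolding constant_on_def by auto
  then show ?thesis using that m by metis
qed

text \<open>The coefficients extend over exceptional w because they are bounded, and the growth
  survives in the limit. What has to be shown is that at an exceptional w the roots of the extended
  polynomial are still exactly the points of the fibre.\<close>

theorem fib_algebraic:
  "\<exists>N n e c. \<forall>w u. w \<noteq> 0 \<longrightarrow> (u \<in> fib w \<longleftrightarrow> (\<Sum>k\<le>N. (\<Sum>j\<le>n. c k j * w ^ j) / w ^ e * u ^ k) = 0)"
proof -
  obtain N where N: "\<And>w0. w0 \<noteq> 0 \<Longrightarrow> eventually (\<lambda>w. card (fib w) = N) (at w0)"
    using card_fib_generic by blast
  obtain K \<kappa> where K: "K \<ge> 0" "\<And>w u. u \<in> fib w \<Longrightarrow> norm u \<le> K * (norm w + inverse (norm w)) ^ \<kappa>"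
    using fib_bound by blast
  let ?m = "\<lambda>w :: complex. norm w + inverse (norm w)"
  have m1: "?m w \<ge> 1" if "w \<noteq> 0" for w
  proof (cases "norm w \<ge> 1")
    case False
    then have "inverse (norm w) \<ge> 1" using that by (simp add: one_le_inverse)
    then show ?thesis by (smt (verit) norm_ge_zero)
  qed (smt (verit) norm_ge_zero inverse_nonnegative_iff_nonnegative)
  \<comment> \<open>The \<open>N\<close> roots are at most \<open>K * ?m w ^ \<kappa>\<close>; as
    \<open>?m w\<close> is at least 1, the summand 1 in the bound for the coefficients is absorbed
    into the constant.\<close>
  have coeff_bound: "norm (coeff (fib_poly w) k) \<le> (1 + K) ^ N * ?m w ^ (\<kappa> * N)"
    if "w \<noteq> 0" "card (fib w) = N" for w k
  proof -
    have "norm (coeff (fib_poly w) k) \<le> (1 + K * ?m w ^ \<kappa>) ^ N"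
      unfolding fib_poly_def using monic_linear_prod(2)[OF finite_fib, of w "K * ?m w ^ \<kappa>"] K that(2) by simp
    also have "\<dots> \<le> ((1 + K) * ?m w ^ \<kappa>) ^ N"
    proof (rule power_mono)
      have "1 \<le> ?m w ^ \<kappa>" using m1[OF that(1)] by (rule one_le_power)
      then show "1 + K * ?m w ^ \<kappa> \<le> (1 + K) * ?m w ^ \<kappa>" by (simp add: algebra_simps)
    qed (use K(1) in auto)
    finally show ?thesis by (simp add: power_mult_distrib power_mult)
  qed
  have m_cont: "(?m \<longlongrightarrow> ?m w0) (at w0)" if "w0 \<noteq> 0" for w0
    using that by (intro tendsto_intros) auto
  \<comment> \<open>Being a limit, the extension does not depend on the disc in which it is
    constructed.\<close>
  define g where "g k w0 = Lim (at w0) (\<lambda>w. coeff (fib_poly w) k)" for k w0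
  have ext: "\<exists>\<delta>>0. ball w0 \<delta> \<subseteq> - {0} \<and> g k holomorphic_on ball w0 \<delta> \<and>
      (\<forall>w\<in>ball w0 \<delta> - {w0}. coeff (fib_poly w) k = g k w)" if w0: "w0 \<noteq> 0" for k w0
  proof -
    obtain \<delta> where \<delta>: "\<delta> > 0" "ball w0 \<delta> \<subseteq> - {0}" "poly_holomorphic_on fib_poly (ball w0 \<delta> - {w0})"
      using fib_poly_local[OF w0] by metis
    let ?c = "\<lambda>w. coeff (fib_poly w) k"
    have hc: "?c holomorphic_on ball w0 \<delta> - {w0}" using \<delta>(3) by (simp add: poly_holomorphic_on_def)
    have "\<exists>h. h holomorphic_on ball w0 \<delta> \<and> (\<forall>w\<in>ball w0 \<delta> - {w0}. h w = ?c w)"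
    proof (subst holomorphic_on_extend_bounded[OF hc])
      show "w0 \<in> interior (ball w0 \<delta>)" using \<delta>(1) by simp
      have "eventually (\<lambda>w. ?m w < ?m w0 + 1) (at w0)"
        using m_cont[OF w0] by (rule order_tendstoD) simp
      moreover have "eventually (\<lambda>w. w \<in> ball w0 \<delta> - {w0}) (at w0)"
        by (rule eventually_at_in_open) (use \<delta> in auto)
      ultimately have "eventually (\<lambda>w. norm (?c w) \<le> (1 + K) ^ N * (?m w0 + 1) ^ (\<kappa> * N)) (at w0)"
        using N[OF w0]
      proof eventually_elim
        case (elim w)
        then have "w \<noteq> 0" using \<delta>(2) by auto
        then have "norm (?c w) \<le> (1 + K) ^ N * ?m w ^ (\<kappa> * N)" using coeff_bound elim by blast
        also have "\<dots> \<le> (1 + K) ^ N * (?m w0 + 1) ^ (\<kappa> * N)"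
          using elim K(1) by (intro mult_left_mono power_mono) auto
        finally show ?case .
      qed
      then show "\<exists>B. eventually (\<lambda>w. norm (?c w) \<le> B) (at w0)" by blast
    qed
    then obtain h where h: "h holomorphic_on ball w0 \<delta>" "\<And>w. w \<in> ball w0 \<delta> - {w0} \<Longrightarrow> h w = ?c w" by blast
    have "g k w = h w" if w: "w \<in> ball w0 \<delta>" for w
    proof -
      have "eventually (\<lambda>v. v \<in> ball w0 \<delta> - {w0}) (at w)"
      proof (cases "w = w0")
        case True
        then show ?thesis using \<delta>(1) eventually_at_in_open[of "ball w0 \<delta>" w0] by auto
      next
        case False
        then show ?thesis using w by (intro eventually_at_in_open') auto
      qed
      then have ev: "eventually (\<lambda>v. h v = ?c v) (at w)" by eventually_elim (rule h(2))
      have "(h \<longlongrightarrow> h w) (at w)"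
        using holomorphic_on_imp_continuous_on[OF h(1)] w
        by (simp add: continuous_on_eq_continuous_at isCont_def)
      then have "(?c \<longlongrightarrow> h w) (at w)" using ev by (rule Lim_transform_eventually)
      then show ?thesis unfolding g_def by (intro tendsto_Lim) auto
    qed
    then have "g k holomorphic_on ball w0 \<delta>" "\<forall>w\<in>ball w0 \<delta> - {w0}. ?c w = g k w"
      using h holomorphic_transform[OF h(1)] by auto
    then show ?thesis using \<delta>(1,2) by blast
  qed
  have g_hol: "g k holomorphic_on - {0}" for k
    unfolding holomorphic_on_def
  proof
    fix w0 :: complex assume "w0 \<in> - {0}"
    then obtain \<delta> where "\<delta> > 0" "g k holomorphic_on ball w0 \<delta>" using ext[of w0 k] by auto
    then have "g k field_differentiable at w0"
      by (meson centre_in_ball holomorphic_on_imp_differentiable_at open_ball)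
    then show "g k field_differentiable at w0 within - {0}" by (rule field_differentiable_at_within)
  qed
  have g_ev: "eventually (\<lambda>w. coeff (fib_poly w) k = g k w) (at w0)" if w0: "w0 \<noteq> 0" for k w0
  proof -
    obtain \<delta> where \<delta>: "\<delta> > 0" "\<forall>w\<in>ball w0 \<delta> - {w0}. coeff (fib_poly w) k = g k w"
      using ext[OF w0, of k] by blast
    have "eventually (\<lambda>w. w \<in> ball w0 \<delta> - {w0}) (at w0)"
      by (rule eventually_at_in_open) (use \<delta> in auto)
    then show ?thesis by eventually_elim (use \<delta>(2) in blast)
  qed
  have g_cont: "isCont (g k) w0" if "w0 \<noteq> 0" for k w0
  proof -
    have "open (- {0 :: complex})" by auto
    then show ?thesis
      using holomorphic_on_imp_continuous_on[OF g_hol[of k]] that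
      by (auto simp: continuous_on_eq_continuous_at)
  qed
  have g_bound: "norm (g k w0) \<le> (1 + K) ^ N * ?m w0 ^ (\<kappa> * N)" if w0: "w0 \<noteq> 0" for k w0
  proof (rule tendsto_le)
    show "((\<lambda>w. norm (g k w)) \<longlongrightarrow> norm (g k w0)) (at w0)"
      using g_cont[OF w0, of k] by (intro tendsto_norm) (simp add: isCont_def)
    show "((\<lambda>w. (1 + K) ^ N * ?m w ^ (\<kappa> * N)) \<longlongrightarrow> (1 + K) ^ N * ?m w0 ^ (\<kappa> * N)) (at w0)"
      by (intro tendsto_intros m_cont w0) (use w0 in auto)
    have "eventually (\<lambda>w. w \<in> - {0}) (at w0)" by (rule eventually_at_in_open') (use w0 in auto)
    then show "eventually (\<lambda>w. norm (g k w) \<le> (1 + K) ^ N * ?m w ^ (\<kappa> * N)) (at w0)"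
      using g_ev[OF w0, of k] N[OF w0]
    proof eventually_elim
      case (elim w)
      then show ?case using coeff_bound[of w k] by auto
    qed
  qed auto
  define \<Phi> where "\<Phi> w u = (\<Sum>k\<le>N. g k w * u ^ k)" for w u
  have \<Phi>_ev: "eventually (\<lambda>w. \<forall>u. \<Phi> w u = (\<Prod>u'\<in>fib w. u - u')) (at w0)" if w0: "w0 \<noteq> 0" for w0
  proof -
    have "eventually (\<lambda>w. \<forall>k\<in>{..N}. coeff (fib_poly w) k = g k w) (at w0)"
      by (intro eventually_ball_finite ballI g_ev w0) auto
    then show ?thesis using N[OF w0]
    proof eventually_elim
      case (elim w)
      show ?case
      proof
        fix u
        have "\<Phi> w u = (\<Sum>k\<le>N. coeff (fib_poly w) k * u ^ k)" using elim(1) by (simp add: \<Phi>_def)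
        then show "\<Phi> w u = (\<Prod>u'\<in>fib w. u - u')"
          unfolding fib_poly_def using poly_linear_prod_altdef[OF finite_fib elim(2)] by simp
      qed
    qed
  qed
  have main: "u0 \<in> fib w0 \<longleftrightarrow> \<Phi> w0 u0 = 0" if w0: "w0 \<noteq> 0" for w0 u0
  proof
    assume u0: "u0 \<in> fib w0"
    \<comment> \<open>Arbitrarily close to (w0, u0) there are points of the fibres over ordinary w,
      where \<Phi> vanishes; continuity does the rest.\<close>
    show "\<Phi> w0 u0 = 0"
    proof (rule ccontr)
      assume nz: "\<Phi> w0 u0 \<noteq> 0"
      have "isCont (\<lambda>p. \<Phi> (fst p) (snd p)) (w0, u0)"
        unfolding \<Phi>_def
        by (intro continuous_intros isCont_o2[OF _ g_cont]) (use w0 in auto)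
      then obtain e where e: "e > 0" "\<And>p. dist (w0, u0) p < e \<Longrightarrow> \<Phi> (fst p) (snd p) \<noteq> 0"
        using continuous_at_avoid[of "(w0, u0)" "\<lambda>p. \<Phi> (fst p) (snd p)" 0] nz by auto
      obtain d where d: "d > 0" "\<And>w. w \<noteq> w0 \<Longrightarrow> dist w w0 < d \<Longrightarrow> \<forall>u. \<Phi> w u = (\<Prod>u'\<in>fib w. u - u')"
        using \<Phi>_ev[OF w0] unfolding eventually_at by auto
      have "min (e / 2) d > 0" using e d by simp
      from nonisolated_fib[OF u0 this] obtain w' u' where w': "u' \<in> fib w'" "w' \<noteq> w0"
        "dist w' w0 < min (e / 2) d" "dist u' u0 < min (e / 2) d" by blast
      have "dist (w0, u0) (w', u') \<le> dist w0 w' + dist u0 u'"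
        unfolding dist_Pair_Pair by (rule sqrt_sum_squares_le_sum) auto
      also have "\<dots> < e" using w'(3,4) by (simp add: dist_commute)
      finally have "\<Phi> w' u' \<noteq> 0" using e(2)[of "(w', u')"] by simp
      moreover have "\<Phi> w' u' = 0" using d(2)[of w'] w' finite_fib by auto
      ultimately show False by simp
    qed
  next
    assume 0: "\<Phi> w0 u0 = 0"
    \<comment> \<open>Otherwise the neighbouring fibres keep a distance \<open>e\<close> from
      \<open>u0\<close>. There \<Phi> is a product of \<open>N\<close> differences, so its norm is
      at least \<open>e ^ N\<close>, also in the limit.\<close>
    show "u0 \<in> fib w0"
    proof (rule ccontr)
      assume "u0 \<notin> fib w0"
      let ?UA = "{x :: complex ^ 'k. x $ iw \<noteq> 0} - A"
      have op: "open ?UA" by (rule open_diff_analytic[OF A])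
      have "pt w0 u0 \<in> ?UA" using \<open>u0 \<notin> fib w0\<close> w0 idx by (simp add: fib_def)
      then obtain e where e: "e > 0" "cball u0 e \<subseteq> {t. pt w0 t \<in> ?UA}"
        using open_upd_slice[OF op, of "line w0" iu] open_contains_cball by (metis (no_types, lifting) mem_Collect_eq)
      have "eventually (\<lambda>x. \<forall>t\<in>cball u0 e. upd x iu t \<in> ?UA) (nhds (line w0))"
        by (rule eventually_upd_compact[OF compact_cball op]) (use e(2) in blast)
      then obtain d where d: "d > 0" "\<And>x. dist x (line w0) < d \<Longrightarrow> \<forall>t\<in>cball u0 e. upd x iu t \<in> ?UA"
        unfolding eventually_nhds_metric by blast
      have far: "norm (u0 - u') \<ge> e" if "dist w w0 < d" "u' \<in> fib w" for w u'
      proof (rule ccontr)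
        assume "\<not> ?thesis"
        then have "u' \<in> cball u0 e" by (simp add: dist_norm)
        then show False using d(2)[of "line w"] that by (auto simp: dist_upd fib_def)
      qed
      have "eventually (\<lambda>w. dist w w0 < d) (at w0)" unfolding eventually_at using d(1) by blast
      then have "eventually (\<lambda>w. e ^ N \<le> norm (\<Phi> w u0)) (at w0)"
        using \<Phi>_ev[OF w0] N[OF w0]
      proof eventually_elim
        case (elim w)
        have "e ^ N = (\<Prod>u'\<in>fib w. e)" using elim(3) by simp
        also have "\<dots> \<le> (\<Prod>u'\<in>fib w. norm (u0 - u'))"
          using far[OF elim(1)] e(1) by (intro prod_mono) auto
        also have "\<dots> = norm (\<Phi> w u0)" using elim(2) by (simp add: prod_norm)
        finally show ?case .
      qed
      moreover have "((\<lambda>w. norm (\<Phi> w u0)) \<longlongrightarrow> norm (\<Phi> w0 u0)) (at w0)"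
        unfolding \<Phi>_def using g_cont[OF w0] by (intro tendsto_intros) (simp add: isCont_def)
      ultimately have "e ^ N \<le> norm (\<Phi> w0 u0)" by (intro tendsto_lowerbound) auto
      then show False using 0 zero_less_power[OF e(1), of N] by simp
    qed
  qed
  have "\<exists>c. \<forall>w. w \<noteq> 0 \<longrightarrow> g k w = (\<Sum>j\<le>2 * (\<kappa> * N). c j * w ^ j) / w ^ (\<kappa> * N)" for k
    by (rule holomorphic_punctured_growth_imp_Laurent[OF g_hol g_bound])
  then obtain c where c: "\<And>k w. w \<noteq> 0 \<Longrightarrow> g k w = (\<Sum>j\<le>2 * (\<kappa> * N). c k j * w ^ j) / w ^ (\<kappa> * N)" by metis
  have "u \<in> fib w \<longleftrightarrow> (\<Sum>k\<le>N. (\<Sum>j\<le>2 * (\<kappa> * N). c k j * w ^ j) / w ^ (\<kappa> * N) * u ^ k) = 0" if "w \<noteq> 0" for w u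
    unfolding main[OF that] \<Phi>_def c[OF that] ..
  then show ?thesis by blast
qed

end

section \<open>Laurent polynomials on the torus\<close>

text \<open>Off the torus the exponent laws fail, as \<open>0 powi k = 0\<close> for \<open>k < 0\<close>, hence products of Laurent
  polynomials are only considered on it.\<close>

definition laurent_on_torus :: "(complex ^ 'n \<Rightarrow> complex) \<Rightarrow> bool" where
  "laurent_on_torus P \<longleftrightarrow> (\<exists>f. laurent_polynomial f \<and> (\<forall>z\<in>complex_torus. f z = P z))"

definition laurent_monomial :: "('n \<Rightarrow> int) \<Rightarrow> complex ^ 'n \<Rightarrow> complex" where
  "laurent_monomial \<alpha> z = (\<Prod>i\<in>UNIV. (z $ i) powi \<alpha> i)"

lemma laurent_polynomial_add:
  assumes "laurent_polynomial f" "laurent_polynomial g"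
  shows "laurent_polynomial (\<lambda>z. f z + g z)"
proof -
  obtain S c where f: "finite S" "f = (\<lambda>z. \<Sum>\<alpha>\<in>S. c \<alpha> * laurent_monomial \<alpha> z)"
    using assms(1) unfolding laurent_polynomial_def laurent_monomial_def by blast
  obtain T d where g: "finite T" "g = (\<lambda>z. \<Sum>\<alpha>\<in>T. d \<alpha> * laurent_monomial \<alpha> z)"
    using assms(2) unfolding laurent_polynomial_def laurent_monomial_def by blast
  define b where "b \<alpha> = (if \<alpha> \<in> S then c \<alpha> else 0) + (if \<alpha> \<in> T then d \<alpha> else 0)" for \<alpha>
  have "f z + g z = (\<Sum>\<alpha>\<in>S \<union> T. b \<alpha> * laurent_monomial \<alpha> z)" for z
  proof -
    have "f z = (\<Sum>\<alpha>\<in>S \<union> T. (if \<alpha> \<in> S then c \<alpha> else 0) * laurent_monomial \<alpha> z)"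
      unfolding f(2) using f(1) g(1) by (intro sum.mono_neutral_cong_left) auto
    moreover have "g z = (\<Sum>\<alpha>\<in>S \<union> T. (if \<alpha> \<in> T then d \<alpha> else 0) * laurent_monomial \<alpha> z)"
      unfolding g(2) using f(1) g(1) by (intro sum.mono_neutral_cong_left) auto
    ultimately show ?thesis by (simp add: b_def sum.distrib distrib_right)
  qed
  then show ?thesis
    unfolding laurent_polynomial_def using f(1) g(1)
    by (intro exI[of _ "S \<union> T"] exI[of _ b]) (auto simp: laurent_monomial_def)
qed

lemma laurent_polynomial_term: "laurent_polynomial (\<lambda>z. c * laurent_monomial \<alpha> z)"
  unfolding laurent_polynomial_def laurent_monomial_def
  by (intro exI[of _ "{\<alpha>}"] exI[of _ "\<lambda>_. c"]) auto

lemma laurent_monomial_add: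
  "z \<in> complex_torus \<Longrightarrow> laurent_monomial (\<lambda>i. \<alpha> i + \<beta> i) z = laurent_monomial \<alpha> z * laurent_monomial \<beta> z"
  unfolding laurent_monomial_def complex_torus_def
  by (simp add: power_int_add prod.distrib)

lemma laurent_monomial_0 [simp]: "laurent_monomial (\<lambda>_. 0) z = 1"
  by (simp add: laurent_monomial_def)

lemma laurent_monomial_axis: "laurent_monomial (\<lambda>j. if j = i then 1 else 0) z = z $ i"
proof -
  have "laurent_monomial (\<lambda>j. if j = i then 1 else 0) z = (\<Prod>j\<in>UNIV. if j = i then z $ j else 1)"
    unfolding laurent_monomial_def by (rule prod.cong) auto
  then show ?thesis by simp
qed

lemma laurent_monomial_nonzero: "z \<in> complex_torus \<Longrightarrow> laurent_monomial \<alpha> z \<noteq> 0"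
  by (simp add: laurent_monomial_def complex_torus_def)

lemma laurent_monomial_uminus: "laurent_monomial (\<lambda>i. - \<alpha> i) z = inverse (laurent_monomial \<alpha> z)"
  unfolding laurent_monomial_def by (simp add: power_int_minus prod_inversef[symmetric] o_def)

lemma laurent_on_torus_add: "laurent_on_torus P \<Longrightarrow> laurent_on_torus Q \<Longrightarrow> laurent_on_torus (\<lambda>z. P z + Q z)"
  unfolding laurent_on_torus_def using laurent_polynomial_add by fastforce

lemma laurent_on_torus_term: "laurent_on_torus (\<lambda>z. c * laurent_monomial \<alpha> z)"
  unfolding laurent_on_torus_def using laurent_polynomial_term by blast

lemma laurent_on_torus_sum:
  "(\<And>a. a \<in> I \<Longrightarrow> laurent_on_torus (P a)) \<Longrightarrow> laurent_on_torus (\<lambda>z. \<Sum>a\<in>I. P a z)"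
proof (induction I rule: infinite_finite_induct)
  case (insert a I)
  then show ?case by (simp add: laurent_on_torus_add)
qed (use laurent_on_torus_term[of 0] in auto)

lemma laurent_on_torus_cong:
  "laurent_on_torus P \<Longrightarrow> (\<And>z. z \<in> complex_torus \<Longrightarrow> P z = Q z) \<Longrightarrow> laurent_on_torus Q"
  unfolding laurent_on_torus_def by auto

lemma laurent_on_torusE:
  assumes "laurent_on_torus P"
  obtains S c where "\<And>z. z \<in> complex_torus \<Longrightarrow> P z = (\<Sum>\<alpha>\<in>S. c \<alpha> * laurent_monomial \<alpha> z)"
proof -
  obtain f where f: "laurent_polynomial f" "\<And>z. z \<in> complex_torus \<Longrightarrow> f z = P z"
    using assms unfolding laurent_on_torus_def by blast
  obtain S c where "f = (\<lambda>z. \<Sum>\<alpha>\<in>S. c \<alpha> * laurent_monomial \<alpha> z)"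
    using f(1) unfolding laurent_polynomial_def laurent_monomial_def by blast
  then have "P z = (\<Sum>\<alpha>\<in>S. c \<alpha> * laurent_monomial \<alpha> z)" if "z \<in> complex_torus" for z
    using f(2)[OF that] by simp
  then show ?thesis by (rule that)
qed

lemma laurent_on_torus_mult:
  assumes "laurent_on_torus P" "laurent_on_torus Q"
  shows "laurent_on_torus (\<lambda>z. P z * Q z)"
proof -
  obtain S c where P: "\<And>z. z \<in> complex_torus \<Longrightarrow> P z = (\<Sum>\<alpha>\<in>S. c \<alpha> * laurent_monomial \<alpha> z)"
    using laurent_on_torusE[OF assms(1)] by metis
  obtain T d where Q: "\<And>z. z \<in> complex_torus \<Longrightarrow> Q z = (\<Sum>\<alpha>\<in>T. d \<alpha> * laurent_monomial \<alpha> z)"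
    using laurent_on_torusE[OF assms(2)] by metis
  \<comment> \<open>Exponents may coincide in the double sum; closure under addition collects
    them.\<close>
  have "laurent_on_torus (\<lambda>z. \<Sum>\<alpha>\<in>S. \<Sum>\<beta>\<in>T. (c \<alpha> * d \<beta>) * laurent_monomial (\<lambda>i. \<alpha> i + \<beta> i) z)"
    by (intro laurent_on_torus_sum laurent_on_torus_term)
  then show ?thesis
    by (rule laurent_on_torus_cong)
      (simp add: P Q sum_product laurent_monomial_add mult_ac)
qed

lemma laurent_on_torus_const: "laurent_on_torus (\<lambda>z. c)"
  using laurent_on_torus_term[of c "\<lambda>_. 0"] by simp

lemma laurent_on_torus_monomial: "laurent_on_torus (laurent_monomial \<alpha>)"
  using laurent_on_torus_term[of 1 \<alpha>] by simp

lemma laurent_on_torus_nth: "laurent_on_torus (\<lambda>z. z $ i)"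
  using laurent_on_torus_monomial[of "\<lambda>j. if j = i then 1 else 0"] unfolding laurent_monomial_axis .

lemma laurent_on_torus_diff: "laurent_on_torus P \<Longrightarrow> laurent_on_torus Q \<Longrightarrow> laurent_on_torus (\<lambda>z. P z - Q z)"
  using laurent_on_torus_add[OF _ laurent_on_torus_mult[OF laurent_on_torus_const[of "-1"]]] by simp

lemma laurent_on_torus_prod:
  "(\<And>a. a \<in> I \<Longrightarrow> laurent_on_torus (P a)) \<Longrightarrow> laurent_on_torus (\<lambda>z. \<Prod>a\<in>I. P a z)"
  by (induction I rule: infinite_finite_induct)
    (auto intro: laurent_on_torus_mult laurent_on_torus_const)

lemma laurent_on_torus_power: "laurent_on_torus P \<Longrightarrow> laurent_on_torus (\<lambda>z. P z ^ k)"
  by (induction k) (auto intro: laurent_on_torus_mult laurent_on_torus_const)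

lemma sephol_laurent_monomial: "sephol (laurent_monomial \<alpha>) complex_torus"
proof -
  have "sephol (\<lambda>z. (z $ i) powi \<alpha> i) complex_torus" for i
  proof (cases "\<alpha> i \<ge> 0")
    case True
    then show ?thesis by (simp add: power_int_def sephol_power sephol_nth)
  next
    case False
    have "sephol (\<lambda>z. (1 / (z $ i)) ^ nat (- \<alpha> i)) complex_torus"
      by (intro sephol_power sephol_divide sephol_const sephol_nth) (simp add: complex_torus_def)
    then show ?thesis using False by (simp add: power_int_def inverse_eq_divide)
  qed
  then show ?thesis
    unfolding laurent_monomial_def by (intro sephol_prod)
qed

lemma open_complex_torus: "open (complex_torus :: (complex ^ 'n) set)"
proof -
  have "complex_torus = (\<Inter>i\<in>UNIV. {z :: complex ^ 'n. z $ i \<noteq> 0})" by (auto simp: complex_torus_def)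
  moreover have "open \<dots>" by (intro open_INT ballI open_Collect_neq continuous_intros) auto
  ultimately show ?thesis by simp
qed


section \<open>Analytic curves\<close>

text \<open>Along a coordinate line the Frechet derivative is complex linear in one variable, that
  is, multiplication by its value at the unit vector.\<close>

lemma sephol_holo_fun_on:
  assumes f: "holo_fun_on f V"
  shows "sephol f V"
  unfolding sephol_def
proof (intro conjI ballI allI)
  have "continuous (at z) f" if "z \<in> V" for z
    using f that unfolding holo_fun_on_def by (meson has_derivative_continuous)
  then show "continuous_on V f" by (simp add: continuous_at_imp_continuous_on)
  fix z i assume z: "z \<in> V"
  obtain f' where f': "(f has_derivative f') (at z)" "\<And>c v. f' (c *s v) = c * f' v"
    using f z unfolding holo_fun_on_def by blast
  have upd: "upd z i t = z + (t - z $ i) *s axis i 1" for t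
    by (simp add: vec_eq_iff axis_def)
  have "((\<lambda>t. z + (t - z $ i) *s axis i 1) has_derivative (\<lambda>s. s *s axis i 1)) (at (z $ i))"
  proof -
    have lin: "bounded_linear (\<lambda>s :: complex. s *s (axis i 1 :: complex ^ 'a))"
    proof
      show "\<exists>K. \<forall>s :: complex. norm (s *s (axis i 1 :: complex ^ 'a)) \<le> norm s * K"
      proof (intro exI allI)
        fix s :: complex
        have "s *s (axis i 1 :: complex ^ 'a) = axis i s" by (simp add: vec_eq_iff axis_def)
        then show "norm (s *s (axis i 1 :: complex ^ 'a)) \<le> norm s * 1" by (simp add: norm_axis)
      qed
    qed (simp_all add: vec_eq_iff algebra_simps)
    have "((\<lambda>t. t - z $ i) has_derivative (\<lambda>s. s)) (at (z $ i))" by (auto intro!: derivative_eq_intros)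
    from has_derivative_add[OF has_derivative_const[of z] bounded_linear.has_derivative[OF lin this]]
    show ?thesis by (simp only: add_0_left)
  qed
  moreover have "(f has_derivative f') (at (z + (z $ i - z $ i) *s axis i 1))" using f'(1) by simp
  ultimately have "((\<lambda>t. f (z + (t - z $ i) *s axis i 1)) has_derivative (\<lambda>s. f' (s *s axis i 1))) (at (z $ i))"
    using has_derivative_compose by fast
  then have "((\<lambda>t. f (upd z i t)) has_field_derivative f' (axis i 1)) (at (z $ i))"
    unfolding has_field_derivative_def upd f'(2) by (simp add: mult_commute_abs)
  then show "(\<lambda>t. f (upd z i t)) field_differentiable at (z $ i)"
    unfolding field_differentiable_def by blast
qed

lemma open_preimage_within:
  assumes "continuous_on W \<psi>" "open W" "open V"
  shows "open {w\<in>W. \<psi> w \<in> V}"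
proof -
  have "open (W \<inter> \<psi> -` V)" by (rule continuous_open_preimage[OF assms])
  moreover have "W \<inter> \<psi> -` V = {w\<in>W. \<psi> w \<in> V}" by auto
  ultimately show ?thesis by simp
qed

text \<open>Regular points of dimension 1 occur in every neighbourhood of \<open>p\<close>, and in a
  chart around such a point \<open>C\<close> is a piece of a coordinate line.\<close>

lemma pure_dimensional_1_imp_nonisolated:
  fixes C :: "(complex ^ 'n) set"
  assumes C: "pure_dimensional C 1" and p: "p \<in> C" "p \<in> V" and V: "open V"
  shows "infinite (C \<inter> V)"
proof -
  have "has_dim_at C p 1" using C p(1) by (simp add: pure_dimensional_def)
  then obtain q where q: "q \<in> V" "regular_point_of_dim C 1 q"
    using p(2) V unfolding has_dim_at_def Let_def by blast
  obtain V' W and \<phi> \<psi> :: "complex ^ 'n \<Rightarrow> complex ^ 'n" and I where R: "open V'" "q \<in> V'" "open W"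
    "homeomorphism V' W \<phi> \<psi>" "card (- I) = 1" "\<phi> ` (C \<inter> V') = {w\<in>W. \<forall>i\<in>I. w $ i = 0}" "q \<in> C"
    using q(2) unfolding regular_point_of_dim_def by blast
  \<comment> \<open>The one free coordinate of the chart: moving it stays on the image of
    \<open>C\<close>.\<close>
  obtain j where j: "j \<notin> I" using R(5) by (metis Compl_iff card_1_singletonE insertI1)
  have \<phi>q: "\<phi> q \<in> W" "\<And>i. i \<in> I \<Longrightarrow> \<phi> q $ i = 0" using R(2,6,7) by auto
  have "open {w\<in>W. \<psi> w \<in> V}"
    using R(3,4) V by (intro open_preimage_within) (auto simp: homeomorphism_def)
  then have "open {t. upd (\<phi> q) j t \<in> {w\<in>W. \<psi> w \<in> V}}" (is "open ?T")
    by (rule open_upd_slice)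
  moreover have "\<phi> q $ j \<in> ?T" using \<phi>q(1) R(2,4) q(1) by (simp add: homeomorphism_def)
  ultimately have inf: "infinite ?T" using finite_imp_not_open[of ?T] by blast
  let ?x = "\<lambda>t. \<psi> (upd (\<phi> q) j t)"
  have T: "\<exists>x\<in>C \<inter> V'. upd (\<phi> q) j t = \<phi> x" if "t \<in> ?T" for t
  proof -
    have "upd (\<phi> q) j t \<in> {w\<in>W. \<forall>i\<in>I. w $ i = 0}" using that \<phi>q(2) j by auto
    then show ?thesis unfolding R(6)[symmetric] by blast
  qed
  have "inj_on ?x ?T"
  proof (rule inj_onI)
    fix s t assume st: "s \<in> ?T" "t \<in> ?T" "?x s = ?x t"
    then have "upd (\<phi> q) j s = upd (\<phi> q) j t"
      using R(4) unfolding homeomorphism_def by (metis (mono_tags, lifting) mem_Collect_eq)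
    then show "s = t" by (metis upd_nth)
  qed
  moreover have "?x ` ?T \<subseteq> C \<inter> V"
  proof (rule image_subsetI)
    fix t assume t: "t \<in> ?T"
    then obtain x where "x \<in> C \<inter> V'" "upd (\<phi> q) j t = \<phi> x" using T by blast
    then show "?x t \<in> C \<inter> V" using R(4) t by (auto simp: homeomorphism_def)
  qed
  ultimately show ?thesis using inf finite_imageD[of ?x ?T] finite_subset by blast
qed

text \<open>The vector is sought on a moment curve, with entries \<open>s ^ idx i\<close>. Its
  product with \<xi> is then the value at s of a nonzero polynomial whose coefficients are the
  entries of \<xi>, so only finitely many s are bad.\<close>

lemma exists_exponent_vector:
  fixes L :: "(real ^ 'n) set"
  assumes "finite L" "0 \<notin> L"
  shows "\<exists>a :: 'n \<Rightarrow> int. \<forall>\<xi>\<in>L. (\<Sum>i\<in>UNIV. of_int (a i) * \<xi> $ i) \<noteq> 0"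
proof -
  obtain idx :: "'n \<Rightarrow> nat" where idx: "inj idx"
    using finite_imp_inj_to_nat_seg[of "UNIV :: 'n set"] by auto
  define P where "P \<xi> = (\<Sum>i\<in>UNIV. monom (\<xi> $ i) (idx i))" for \<xi> :: "real ^ 'n"
  have "P \<xi> \<noteq> 0" if \<xi>: "\<xi> \<in> L" for \<xi>
  proof -
    obtain j where j: "\<xi> $ j \<noteq> 0" using \<xi> assms(2) by (metis vec_eq_iff zero_index)
    have "coeff (P \<xi>) (idx j) = (\<Sum>i\<in>UNIV. if i = j then \<xi> $ i else 0)"
      unfolding P_def coeff_sum using idx by (intro sum.cong) (auto simp: inj_def)
    then have "coeff (P \<xi>) (idx j) \<noteq> 0" using j by simp
    then show ?thesis by auto
  qed
  then have "finite (\<Union>\<xi>\<in>L. {x. poly (P \<xi>) x = 0})" using assms(1) poly_roots_finite by blast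
  moreover have "infinite (range real)" by (simp add: range_inj_infinite)
  ultimately obtain s where s: "real s \<notin> (\<Union>\<xi>\<in>L. {x. poly (P \<xi>) x = 0})"
    by (metis finite_subset image_subsetI)
  have "(\<Sum>i\<in>UNIV. of_int (int (s ^ idx i)) * \<xi> $ i) \<noteq> 0" if "\<xi> \<in> L" for \<xi>
  proof -
    have "poly (P \<xi>) (real s) = (\<Sum>i\<in>UNIV. of_int (int (s ^ idx i)) * \<xi> $ i)"
      by (simp add: P_def poly_sum poly_monom mult.commute)
    then show ?thesis using s that by auto
  qed
  then show ?thesis by (intro exI[of _ "\<lambda>i. int (s ^ idx i)"] ballI)
qed

text \<open>Otherwise there are points along which the norm tends to infinity and the linear form is
  negligible against it. By compactness of the sphere their directions accumulate at a point of the
  limit set, where the form vanishes.\<close>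

lemma Log_map_bounded_by_exponent:
  fixes C :: "(complex ^ 'n) set"
  assumes a: "\<forall>\<xi>\<in>log_limit_set C. (\<Sum>i\<in>UNIV. of_int (a i) * \<xi> $ i) \<noteq> 0"
  shows "\<exists>R::nat. \<forall>z\<in>C. norm (Log_map z) \<le> R + R * \<bar>\<Sum>i\<in>UNIV. of_int (a i) * Log_map z $ i\<bar>"
proof (rule ccontr)
  define l where "l v = (\<Sum>i\<in>UNIV. of_int (a i) * v $ i)" for v :: "real ^ 'n"
  assume "\<not> ?thesis"
  \<comment> \<open>A single \<open>R\<close> serves as both constants, so its failure at m makes
    the norm exceed m as well as m times the form.\<close>
  then have "\<forall>m::nat. \<exists>z\<in>C. real m + real m * \<bar>l (Log_map z)\<bar> < norm (Log_map z)"
    by (auto simp: l_def not_le)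
  then obtain z where z: "\<And>m. z m \<in> C" "\<And>m. real m + real m * \<bar>l (Log_map (z m))\<bar> < norm (Log_map (z m))"
    by metis
  define \<nu> where "\<nu> m = norm (Log_map (z m))" for m
  define u where "u m = Log_map (z m) /\<^sub>R \<nu> m" for m
  have \<nu>: "\<nu> m > real m" "\<nu> m > real m * \<bar>l (Log_map (z m))\<bar>" for m
    using z(2)[of m] by (auto simp: \<nu>_def add_strict_increasing2 intro: le_less_trans[rotated])
  have \<nu>_lim: "filterlim \<nu> at_top sequentially"
    by (rule filterlim_at_top_mono[OF filterlim_real_sequentially]) (simp add: \<nu>(1) less_imp_le)
  have pos: "\<nu> m > 0" for m using \<nu>(1)[of m] by (metis of_nat_0_le_iff le_less_trans)
  have "u m \<in> sphere 0 1" for m using pos[of m] by (simp add: u_def \<nu>_def)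
  then obtain \<xi> \<sigma> where \<xi>: "\<xi> \<in> sphere 0 1" "strict_mono \<sigma>" "(u \<circ> \<sigma>) \<longlonglongrightarrow> \<xi>"
    using compact_sphere[of "0 :: real ^ 'n" 1] unfolding compact_def by meson
  have \<nu>\<sigma>: "filterlim (\<lambda>m. \<nu> (\<sigma> m)) at_top sequentially"
    by (rule filterlim_compose[OF \<nu>_lim filterlim_subseq[OF \<xi>(2)]])
  have "\<xi> \<in> log_limit_set C"
    unfolding log_limit_set_def using \<xi>(1) z(1) \<nu>\<sigma> \<xi>(3)
    by (auto simp: u_def \<nu>_def o_def intro!: exI[of _ "\<lambda>m. z (\<sigma> m)"])
  moreover have "l \<xi> = 0"
  proof -
    have lu: "\<bar>l (u m)\<bar> \<le> inverse (real m)" if "m > 0" for m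
    proof -
      have "l (u m) = l (Log_map (z m)) / \<nu> m"
        by (simp add: l_def u_def sum_divide_distrib divide_inverse mult_ac sum_distrib_left)
      then have "\<bar>l (u m)\<bar> = \<bar>l (Log_map (z m))\<bar> / \<nu> m" using pos[of m] by simp
      also have "\<dots> \<le> inverse (real m)"
        using \<nu>(2)[of m] pos[of m] that by (simp add: field_simps)
      finally show ?thesis .
    qed
    have "(\<lambda>m. l (u m)) \<longlonglongrightarrow> 0"
    proof (rule Lim_null_comparison[OF _ lim_inverse_n])
      show "eventually (\<lambda>m. norm (l (u m)) \<le> inverse (real m)) sequentially"
        using eventually_gt_at_top[of 0] by eventually_elim (use lu in simp)
    qed
    then have "(\<lambda>m. l (u (\<sigma> m))) \<longlonglongrightarrow> 0"
      using LIMSEQ_subseq_LIMSEQ[OF _ \<xi>(2)] by (auto simp: o_def)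
    moreover have "(\<lambda>m. l (u (\<sigma> m))) \<longlonglongrightarrow> l \<xi>"
      unfolding l_def using \<xi>(3) by (intro tendsto_intros) (auto simp: o_def)
    ultimately show ?thesis using LIMSEQ_unique by blast
  qed
  ultimately show False using a by (simp add: l_def)
qed

section \<open>Polynomial growth of the coordinates along the curve\<close>

lemma ln_norm_laurent_monomial:
  assumes "z \<in> complex_torus"
  shows "ln (norm (laurent_monomial a z)) = (\<Sum>i\<in>UNIV. of_int (a i) * Log_map z $ i)"
proof -
  have z: "z $ i \<noteq> 0" for i using assms by (simp add: complex_torus_def)
  have "norm (laurent_monomial a z) = (\<Prod>i\<in>UNIV. norm (z $ i) powi a i)"
    by (simp add: laurent_monomial_def prod_norm[symmetric] norm_power_int)
  also have "ln \<dots> = (\<Sum>i\<in>UNIV. ln (norm (z $ i) powi a i))"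
    using z by (intro ln_prod) (auto intro: zero_less_power_int)
  also have "\<dots> = (\<Sum>i\<in>UNIV. of_int (a i) * Log_map z $ i)"
  proof (rule sum.cong[OF refl])
    fix i
    have "norm (z $ i) powi a i = norm (z $ i) powr of_int (a i)"
      using z by (simp add: powr_real_of_int')
    then show "ln (norm (z $ i) powi a i) = of_int (a i) * Log_map z $ i"
      using z by (simp add: ln_powr Log_map_def)
  qed
  finally show ?thesis .
qed

lemma exp_abs_ln_le:
  assumes "x > 0"
  shows "exp \<bar>ln x\<bar> \<le> x + inverse (x :: real)"
  using assms by (cases "ln x \<ge> 0") (auto simp: exp_minus)

text \<open>Both bounds come from exponentiating one linear bound on the absolute value of the
  logarithm. \<open>R\<close> is a natural number so that it can become the exponent of a
  power.\<close>

lemma coordinate_growth: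
  fixes R :: nat
  assumes z: "z \<in> complex_torus"
    and R: "norm (Log_map z) \<le> R + R * \<bar>\<Sum>i\<in>UNIV. of_int (a i) * Log_map z $ i\<bar>"
  shows "norm (z $ i) \<le> exp R * (norm (laurent_monomial a z) + inverse (norm (laurent_monomial a z))) ^ R"
    and "inverse (norm (z $ i)) \<le> exp R * (norm (laurent_monomial a z) + inverse (norm (laurent_monomial a z))) ^ R"
proof -
  let ?w = "norm (laurent_monomial a z)"
  have zi: "z $ i \<noteq> 0" using z by (simp add: complex_torus_def)
  have w: "?w > 0" using laurent_monomial_nonzero[OF z] by simp
  have "\<bar>ln (norm (z $ i))\<bar> \<le> norm (Log_map z)"
    using component_le_norm_cart[of "Log_map z" i] by (simp add: Log_map_def)
  then have le: "\<bar>ln (norm (z $ i))\<bar> \<le> R + R * \<bar>ln ?w\<bar>"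
    using R unfolding ln_norm_laurent_monomial[OF z] by linarith
  have "exp (R + R * \<bar>ln ?w\<bar>) = exp R * exp \<bar>ln ?w\<bar> ^ R"
    by (simp add: exp_add exp_of_nat_mult)
  also have "\<dots> \<le> exp R * (?w + inverse ?w) ^ R"
    by (intro mult_left_mono power_mono exp_abs_ln_le w) auto
  finally have *: "exp (R + R * \<bar>ln ?w\<bar>) \<le> exp R * (?w + inverse ?w) ^ R" .
  have "norm (z $ i) = exp (ln (norm (z $ i)))" using zi by simp
  also have "\<dots> \<le> exp (R + R * \<bar>ln ?w\<bar>)" using le by simp
  finally show "norm (z $ i) \<le> exp R * (?w + inverse ?w) ^ R" using * by linarith
  have "inverse (norm (z $ i)) = exp (- ln (norm (z $ i)))" using zi by (simp add: exp_minus)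
  also have "\<dots> \<le> exp (R + R * \<bar>ln ?w\<bar>)" using le by simp
  finally show "inverse (norm (z $ i)) \<le> exp R * (?w + inverse ?w) ^ R" using * by linarith
qed

text \<open>Over a compact set of w \<noteq> 0 the first bound keeps \<open>C\<close> bounded and
  the second keeps it away from the coordinate hyperplanes: together they express that the monomial
  is proper on \<open>C\<close>.\<close>

locale proper_curve =
  fixes C :: "(complex ^ 'n) set" and a :: "'n \<Rightarrow> int" and K :: real and \<kappa> :: nat
  assumes analytic: "closed_analytic_subset complex_torus C"
    and growth: "\<And>z i. z \<in> C \<Longrightarrow>
      norm (z $ i) \<le> K * (norm (laurent_monomial a z) + inverse (norm (laurent_monomial a z))) ^ \<kappa>"
      "\<And>z i. z \<in> C \<Longrightarrow>
      inverse (norm (z $ i)) \<le> K * (norm (laurent_monomial a z) + inverse (norm (laurent_monomial a z))) ^ \<kappa>"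
    and infinite_near: "\<And>p V. p \<in> C \<Longrightarrow> p \<in> V \<Longrightarrow> open V \<Longrightarrow> infinite (C \<inter> V)"
begin

abbreviation proj :: "complex ^ 'n \<Rightarrow> complex" where "proj \<equiv> laurent_monomial a"

text \<open>The graph of \<open>(proj, l)\<close> over \<open>C\<close>, with the coordinates in \<open>J\<close> already eliminated. Eliminated
  coordinates are left free, which keeps the ambient type fixed.\<close>

definition graph :: "(complex ^ 'n \<Rightarrow> complex) \<Rightarrow> 'n set \<Rightarrow> (complex ^ ('n + bool)) set" where
  "graph l J = {x. \<exists>z\<in>C. (\<forall>i. i \<notin> J \<longrightarrow> x $ Inl i = z $ i) \<and> x $ Inr False = proj z \<and> x $ Inr True = l z}"

lemma C_subset: "C \<subseteq> complex_torus"
  using analytic by (simp add: closed_analytic_subset_def)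

lemma proj_nonzero: "z \<in> C \<Longrightarrow> proj z \<noteq> 0"
  using C_subset laurent_monomial_nonzero by blast

lemma sephol_pullback:
  assumes "sephol f V"
  shows "sephol (\<lambda>x :: complex ^ ('n + bool). f (\<chi> i. x $ Inl i)) {x. (\<chi> i. x $ Inl i) \<in> V}"
  unfolding sephol_def
proof (intro conjI ballI allI)
  show "continuous_on {x. (\<chi> i. x $ Inl i) \<in> V} (\<lambda>x :: complex ^ ('n + bool). f (\<chi> i. x $ Inl i))"
    by (rule continuous_on_compose2[OF sephol_imp_continuous_on[OF assms]])
      (auto intro!: continuous_intros)
  fix x :: "complex ^ ('n + bool)" and k
  assume x: "x \<in> {x. (\<chi> i. x $ Inl i) \<in> V}"
  show "(\<lambda>t. f (\<chi> i. upd x k t $ Inl i)) field_differentiable at (x $ k)"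
  proof (cases k)
    case (Inl j)
    have "(\<chi> i. upd x k t $ Inl i) = upd (\<chi> i. x $ Inl i) j t" for t
      using Inl by (simp add: vec_eq_iff)
    moreover have "(\<lambda>t. f (upd (\<chi> i. x $ Inl i) j t)) field_differentiable at ((\<chi> i. x $ Inl i) $ j)"
      using assms x unfolding sephol_def by blast
    ultimately show ?thesis using Inl by simp
  next
    case (Inr b)
    then show ?thesis by simp
  qed
qed

lemma open_pullback:
  assumes "open V"
  shows "open {x :: complex ^ ('n + bool). (\<chi> i. x $ Inl i) \<in> V}"
proof -
  have "continuous_on UNIV (\<lambda>x :: complex ^ ('n + bool). \<chi> i. x $ Inl i)"
    by (intro continuous_on_vec_lambda continuous_intros)
  from open_vimage[OF assms this] show ?thesis by (simp add: vimage_def)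
qed

text \<open>The ambient set leaves the coordinates of z unrestricted, even off the torus, because
  elimination runs along whole coordinate lines. So the graph must also be shown to be cut out near
  points where some coordinate of z is zero.\<close>

lemma analytic_in_graph_empty:
  assumes l: "sephol l UNIV"
  shows "analytic_in {x. x $ Inr False \<noteq> 0} (graph l {})"
  unfolding analytic_in_def
proof (intro conjI ballI)
  let ?U = "{x :: complex ^ ('n + bool). x $ Inr False \<noteq> 0}"
  let ?z = "\<lambda>x :: complex ^ ('n + bool). \<chi> i. x $ Inl i"
  have openU: "open ?U" by (intro open_Collect_neq continuous_intros)
  have graph: "x \<in> graph l {} \<longleftrightarrow> ?z x \<in> C \<and> x $ Inr False = proj (?z x) \<and> x $ Inr True = l (?z x)" for x
  proof -
    have "(\<forall>i. x $ Inl i = z $ i) \<longleftrightarrow> ?z x = z" for z by (auto simp: vec_eq_iff)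
    then show ?thesis by (auto simp: graph_def)
  qed
  show "graph l {} \<subseteq> ?U" using proj_nonzero by (auto simp: graph)
  fix p assume p: "p \<in> ?U"
  show "\<exists>V. open V \<and> p \<in> V \<and> V \<subseteq> ?U \<and> cut_out (graph l {}) V"
  proof (cases "?z p \<in> complex_torus")
    case True
    then obtain V0 F where V0: "open V0" "?z p \<in> V0" "V0 \<subseteq> complex_torus" "\<And>f. f \<in> F \<Longrightarrow> holo_fun_on f V0"
      "C \<inter> V0 = {z\<in>V0. \<forall>f\<in>F. f z = 0}"
      using analytic unfolding closed_analytic_subset_def by meson
    define V where "V = {x. ?z x \<in> V0} \<inter> ?U"
    have "open V" unfolding V_def using open_pullback[OF V0(1)] openU by blast
    have pull: "sephol (\<lambda>x. f (?z x)) V" if "sephol f V0" for f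
      by (rule sephol_subset[OF sephol_pullback[OF that]]) (auto simp: V_def)
    have "cut_out (graph l {}) V"
      unfolding cut_out_def
    proof
      fix y assume y: "y \<in> V - graph l {}"
      consider "?z y \<notin> C" | "y $ Inr False \<noteq> proj (?z y)" | "y $ Inr True \<noteq> l (?z y)"
        using y by (auto simp: graph)
      then show "\<exists>h. vanishing (graph l {}) V h \<and> h y \<noteq> 0"
      proof cases
        case 1
        then obtain f where f: "f \<in> F" "f (?z y) \<noteq> 0" using y V0(5) by (auto simp: V_def)
        have "f (?z x) = 0" if "x \<in> graph l {} \<inter> V" for x
        proof -
          have "?z x \<in> C \<inter> V0" using that by (auto simp: graph V_def)
          then show ?thesis using V0(5) f(1) by blast
        qed
        then have "vanishing (graph l {}) V (\<lambda>x. f (?z x))"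
          unfolding vanishing_def using pull[OF sephol_holo_fun_on[OF V0(4)[OF f(1)]]] by blast
        then show ?thesis using f(2) by blast
      next
        case 2
        have "vanishing (graph l {}) V (\<lambda>x. x $ Inr False - proj (?z x))"
          unfolding vanishing_def
          using pull[OF sephol_subset[OF sephol_laurent_monomial V0(3)]]
          by (auto simp: graph intro!: sephol_diff sephol_nth)
        then show ?thesis using 2 by (intro exI[of _ "\<lambda>x. x $ Inr False - proj (?z x)"]) simp
      next
        case 3
        have "vanishing (graph l {}) V (\<lambda>x. x $ Inr True - l (?z x))"
          unfolding vanishing_def
          using pull[OF sephol_subset[OF l]]
          by (auto simp: graph intro!: sephol_diff sephol_nth)
        then show ?thesis using 3 by (intro exI[of _ "\<lambda>x. x $ Inr True - l (?z x)"]) simp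
      qed
    qed
    then show ?thesis using \<open>open V\<close> V0(2) p by (intro exI[of _ V]) (auto simp: V_def)
  next
    case False
    then obtain i where i: "p $ Inl i = 0" by (auto simp: complex_torus_def)
    \<comment> \<open>No equation of \<open>C\<close> is available around such a point. But the
      bound on inverses gives \<open>?g x \<ge> 1\<close> on the graph, while
      \<open>?g p = 0\<close>, so a neighbourhood of \<open>p\<close> misses the graph.\<close>
    let ?g = "\<lambda>x :: complex ^ ('n + bool). norm (x $ Inl i) * (K * (norm (x $ Inr False) + inverse (norm (x $ Inr False))) ^ \<kappa>)"
    define V where "V = {x\<in>?U. ?g x \<in> {..<1}}"
    have "open V" unfolding V_def
      by (rule open_preimage_within[OF _ openU]) (auto intro!: continuous_intros)
    moreover have "p \<in> V" using p i by (simp add: V_def)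
    moreover have "graph l {} \<inter> V = {}"
    proof -
      have "?g x \<ge> 1" if "x \<in> graph l {}" for x
      proof -
        have "?z x \<in> C" "x $ Inr False = proj (?z x)" using that by (auto simp: graph)
        then have "inverse (norm (x $ Inl i)) \<le> K * (norm (x $ Inr False) + inverse (norm (x $ Inr False))) ^ \<kappa>"
          using growth(2)[of "?z x" i] by simp
        then have "norm (x $ Inl i) * inverse (norm (x $ Inl i)) \<le> ?g x" by (intro mult_left_mono) auto
        moreover have "x $ Inl i \<noteq> 0" using \<open>?z x \<in> C\<close> C_subset by (auto simp: complex_torus_def)
        ultimately show ?thesis by simp
      qed
      then show ?thesis by (fastforce simp: V_def)
    qed
    then have "cut_out (graph l {}) V"
      unfolding cut_out_def vanishing_def by (intro ballI exI[of _ "\<lambda>_. 1"]) auto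
    ultimately show ?thesis by (intro exI[of _ V]) (auto simp: V_def)
  qed
qed

lemma analytic_in_graph:
  assumes l: "sephol l UNIV"
  shows "analytic_in {x. x $ Inr False \<noteq> 0} (graph l J)"
proof (induction J rule: finite_induct[OF finite])
  case 1
  show ?case by (rule analytic_in_graph_empty[OF l])
next
  case (2 i J)
  let ?U = "{x :: complex ^ ('n + bool). x $ Inr False \<noteq> 0}"
  have "analytic_in ?U {x. \<exists>t. upd x (Inl i) t \<in> graph l J}"
  proof (rule analytic_in_eliminate[OF _ 2(3)])
    show "open ?U" by (intro open_Collect_neq continuous_intros)
    fix p assume "p \<in> ?U"
    then have "p $ Inr False \<noteq> 0" by simp
    from eventually_growth_le[OF this] obtain R where
      R: "eventually (\<lambda>x. K * (norm (x $ Inr False) + inverse (norm (x $ Inr False))) ^ \<kappa> \<le> R) (nhds p)" by blast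
    have "eventually (\<lambda>x. \<forall>t. upd x (Inl i) t \<in> graph l J \<longrightarrow> norm t \<le> R) (nhds p)"
      using R
    proof eventually_elim
      case (elim x)
      show ?case
      proof (intro allI impI)
        fix t assume "upd x (Inl i) t \<in> graph l J"
        then obtain z where "z \<in> C" "t = z $ i" "x $ Inr False = proj z" using 2(2) by (auto simp: graph_def)
        then show "norm t \<le> R" using growth(1)[of z i] elim by simp
      qed
    qed
    then show "\<exists>R. eventually (\<lambda>x. \<forall>t. upd x (Inl i) t \<in> graph l J \<longrightarrow> norm t \<le> R) (nhds p)" by blast
  qed auto
  also have "{x. \<exists>t. upd x (Inl i) t \<in> graph l J} = graph l (insert i J)"
  proof (intro set_eqI iffI)
    fix x assume "x \<in> {x. \<exists>t. upd x (Inl i) t \<in> graph l J}"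
    then show "x \<in> graph l (insert i J)" by (force simp: graph_def)
  next
    fix x assume "x \<in> graph l (insert i J)"
    then obtain z where z: "z \<in> C" "\<And>j. j \<notin> insert i J \<Longrightarrow> x $ Inl j = z $ j" "x $ Inr False = proj z" "x $ Inr True = l z"
      by (auto simp: graph_def)
    then have "upd x (Inl i) (z $ i) \<in> graph l J" by (auto simp: graph_def)
    then show "x \<in> {x. \<exists>t. upd x (Inl i) t \<in> graph l J}" by blast
  qed
  finally show ?case .
qed

lemma mem_graph_UNIV: "x \<in> graph l UNIV \<longleftrightarrow> (\<exists>z\<in>C. x $ Inr False = proj z \<and> x $ Inr True = l z)"
  by (simp add: graph_def)

text \<open>With a coordinate function as \<open>l\<close>, \<open>finite_fibre\<close> shows that
  this coordinate takes finitely many values on the fibre, so the fibre lies in a finite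
  box.\<close>

lemma finite_proj_fibre: "finite {z\<in>C. proj z = w}"
proof (cases "w = 0")
  case True
  then have "{z\<in>C. proj z = w} = {}" using proj_nonzero by blast
  then show ?thesis by (simp only: finite.emptyI)
next
  case False
  define F where "F i = (\<lambda>z. z $ i) ` {z\<in>C. proj z = w}" for i
  have "finite (F i)" for i
  proof -
    let ?p = "upd 0 (Inr False) w :: complex ^ ('n + bool)"
    have F: "F i = {t. upd ?p (Inr True) t \<in> graph (\<lambda>z. z $ i) UNIV}"
      by (auto simp: F_def mem_graph_UNIV)
    have "F i \<subseteq> cball 0 (K * (norm w + inverse (norm w)) ^ \<kappa>)"
      using growth(1) by (auto simp: F_def)
    then have "bounded (F i)" using bounded_cball bounded_subset by blast
    then show ?thesis unfolding F
      by (intro finite_fibre[OF analytic_in_graph[OF sephol_nth]]) (use False in auto)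
  qed
  then have "finite (vec_lambda ` PiE UNIV F)" by (intro finite_imageI finite_PiE) auto
  moreover have "{z\<in>C. proj z = w} \<subseteq> vec_lambda ` PiE UNIV F"
  proof
    fix z assume "z \<in> {z\<in>C. proj z = w}"
    then have "vec_nth z \<in> PiE UNIV F" by (auto simp: F_def)
    then show "z \<in> vec_lambda ` PiE UNIV F" by (metis image_eqI vec_nth_inverse)
  qed
  ultimately show ?thesis using finite_subset by blast
qed

section \<open>Functions of polynomial growth on the curve\<close>

definition tame :: "(complex ^ 'n \<Rightarrow> complex) \<Rightarrow> bool" where
  "tame l \<longleftrightarrow> (\<exists>K' \<kappa>'. \<forall>z\<in>C. norm (l z) \<le> K' * (norm (proj z) + inverse (norm (proj z))) ^ \<kappa>')"

lemma tameE:
  assumes "tame l"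
  obtains K' \<kappa>' where "\<And>z. z \<in> C \<Longrightarrow> norm (l z) \<le> K' * (norm (proj z) + inverse (norm (proj z))) ^ \<kappa>'"
proof -
  obtain K' \<kappa>' where *: "\<forall>z\<in>C. norm (l z) \<le> K' * (norm (proj z) + inverse (norm (proj z))) ^ \<kappa>'"
    using assms unfolding tame_def by blast
  show ?thesis by (rule that, rule bspec[OF *])
qed

lemma growth_base_ge_1: "z \<in> C \<Longrightarrow> norm (proj z) + inverse (norm (proj z)) \<ge> 1"
proof -
  assume "z \<in> C"
  then have "norm (proj z) > 0" using proj_nonzero by simp
  then have "1 \<le> exp \<bar>ln (norm (proj z))\<bar>" "exp \<bar>ln (norm (proj z))\<bar> \<le> norm (proj z) + inverse (norm (proj z))"
    using exp_abs_ln_le by auto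
  then show ?thesis by linarith
qed

lemma tame_const: "tame (\<lambda>z. c)"
  unfolding tame_def by (intro exI[of _ "norm c"] exI[of _ 0]) auto

lemma tame_nth: "tame (\<lambda>z. z $ i)"
  unfolding tame_def using growth(1) by blast

lemma tame_mult:
  assumes "tame k" "tame l"
  shows "tame (\<lambda>z. k z * l z)"
proof -
  let ?m = "\<lambda>z. norm (proj z) + inverse (norm (proj z))"
  obtain K1 n1 where 1: "\<And>z. z \<in> C \<Longrightarrow> norm (k z) \<le> K1 * ?m z ^ n1" using tameE[OF assms(1)] by metis
  obtain K2 n2 where 2: "\<And>z. z \<in> C \<Longrightarrow> norm (l z) \<le> K2 * ?m z ^ n2" using tameE[OF assms(2)] by metis
  have "norm (k z * l z) \<le> (K1 * K2) * ?m z ^ (n1 + n2)" if "z \<in> C" for z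
  proof -
    have "norm (k z * l z) \<le> (K1 * ?m z ^ n1) * (K2 * ?m z ^ n2)"
      unfolding norm_mult using 1[OF that] 2[OF that] norm_ge_zero[of "k z"]
      by (intro mult_mono) (linarith | simp)+
    then show ?thesis by (simp add: power_add mult_ac)
  qed
  then show ?thesis unfolding tame_def by blast
qed

lemma tame_diff:
  assumes "tame k" "tame l"
  shows "tame (\<lambda>z. k z - l z)"
proof -
  let ?m = "\<lambda>z. norm (proj z) + inverse (norm (proj z))"
  obtain K1 n1 where 1: "\<And>z. z \<in> C \<Longrightarrow> norm (k z) \<le> K1 * ?m z ^ n1" using tameE[OF assms(1)] by metis
  obtain K2 n2 where 2: "\<And>z. z \<in> C \<Longrightarrow> norm (l z) \<le> K2 * ?m z ^ n2" using tameE[OF assms(2)] by metis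
  \<comment> \<open>The sum of the exponents serves as a common upper bound; the base is at least
    1.\<close>
  have "norm (k z - l z) \<le> (\<bar>K1\<bar> + \<bar>K2\<bar>) * ?m z ^ (n1 + n2)" if z: "z \<in> C" for z
  proof -
    have m: "?m z ^ n \<le> ?m z ^ (n1 + n2)" if "n \<le> n1 + n2" for n
      using growth_base_ge_1[OF z] that by (rule power_increasing[rotated])
    have m0: "0 \<le> ?m z ^ n" for n by simp
    have "K1 * ?m z ^ n1 \<le> \<bar>K1\<bar> * ?m z ^ (n1 + n2)" "K2 * ?m z ^ n2 \<le> \<bar>K2\<bar> * ?m z ^ (n1 + n2)"
      using m m0 by (auto intro!: mult_mono)
    then have "norm (k z) + norm (l z) \<le> (\<bar>K1\<bar> + \<bar>K2\<bar>) * ?m z ^ (n1 + n2)"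
      using 1[OF z] 2[OF z] by (simp add: distrib_right)
    then show ?thesis using norm_triangle_ineq4[of "k z" "l z"] by linarith
  qed
  then show ?thesis unfolding tame_def by blast
qed

lemma tame_prod: "(\<And>b. b \<in> I \<Longrightarrow> tame (l b)) \<Longrightarrow> tame (\<lambda>z. \<Prod>b\<in>I. l b z)"
  by (induction I rule: infinite_finite_induct) (auto intro: tame_mult tame_const)

text \<open>For nonisolation: near a point of \<open>C\<close> lie infinitely many points of
  \<open>C\<close>, but only finitely many share its value of \<open>proj\<close>.\<close>

lemma analytic_multifunction_graph:
  assumes l: "sephol l UNIV" "tame l"
  shows "analytic_multifunction (graph l UNIV) (Inr False) (Inr True)"
proof
  show "analytic_in {x. x $ Inr False \<noteq> 0} (graph l UNIV)" by (rule analytic_in_graph[OF l(1)])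
  show "\<exists>K \<kappa>. \<forall>x\<in>graph l UNIV. norm (x $ Inr True) \<le> K * (norm (x $ Inr False) + inverse (norm (x $ Inr False))) ^ \<kappa>"
  proof -
    obtain K' \<kappa>' where "\<And>z. z \<in> C \<Longrightarrow> norm (l z) \<le> K' * (norm (proj z) + inverse (norm (proj z))) ^ \<kappa>'"
      using tameE[OF l(2)] by metis
    then show ?thesis by (intro exI[of _ K'] exI[of _ \<kappa>']) (auto simp: mem_graph_UNIV)
  qed
  fix x e assume x: "x \<in> graph l UNIV" and e: "e > (0 :: real)"
  obtain z where z: "z \<in> C" "x $ Inr False = proj z" "x $ Inr True = l z" using x by (auto simp: mem_graph_UNIV)
  define V where "V = {y\<in>complex_torus. (proj y, l y) \<in> ball (proj z) e \<times> ball (l z) e}"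
  have "open V" unfolding V_def
  proof (rule open_preimage_within[OF _ open_complex_torus])
    show "continuous_on complex_torus (\<lambda>y. (proj y, l y))"
      using sephol_imp_continuous_on[OF sephol_laurent_monomial[of a]] sephol_imp_continuous_on[OF l(1)]
      by (intro continuous_intros) (auto intro: continuous_on_subset)
  qed (auto intro: open_Times)
  moreover have "z \<in> V" using z(1) C_subset e by (auto simp: V_def)
  ultimately have "infinite (C \<inter> V)" using infinite_near z(1) by blast
  then have "\<not> C \<inter> V \<subseteq> {y\<in>C. proj y = proj z}" using finite_proj_fibre finite_subset by blast
  then obtain y where y: "y \<in> C" "y \<in> V" "proj y \<noteq> proj z" by blast
  define x' where "x' = (upd (upd 0 (Inr False) (proj y)) (Inr True) (l y) :: complex ^ ('n + bool))"
  have "x' \<in> graph l UNIV" using y(1) by (auto simp: mem_graph_UNIV x'_def)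
  moreover have "x' $ Inr False \<noteq> x $ Inr False" "dist (x' $ Inr False) (x $ Inr False) < e" "dist (x' $ Inr True) (x $ Inr True) < e"
    using y z by (auto simp: x'_def V_def dist_commute)
  ultimately show "\<exists>y\<in>graph l UNIV. y $ Inr False \<noteq> x $ Inr False \<and> dist (y $ Inr False) (x $ Inr False) < e \<and>
      dist (y $ Inr True) (x $ Inr True) < e" by blast
qed (auto simp: mem_graph_UNIV)

lemma laurent_separation:
  assumes q: "q \<in> complex_torus" "q \<notin> C"
  shows "\<exists>P. laurent_on_torus P \<and> (\<forall>z\<in>C. P z = 0) \<and> P q \<noteq> 0"
proof -
  define Fq where "Fq = {z\<in>C. proj z = proj q}"
  have fin: "finite Fq" unfolding Fq_def by (rule finite_proj_fibre)
  have "\<exists>i. q $ i \<noteq> z $ i" if "z \<in> Fq" for z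
  proof -
    have "q \<noteq> z" using that q(2) by (auto simp: Fq_def)
    then show ?thesis by (simp add: vec_eq_iff)
  qed
  then have "\<forall>z\<in>Fq. \<exists>i. q $ i \<noteq> z $ i" by (rule ballI)
  from bchoice[OF this] obtain i where i: "\<forall>z\<in>Fq. q $ i z \<noteq> z $ i z" ..
  \<comment> \<open>One factor for each point of \<open>C\<close> over the same w as
    \<open>q\<close>, in a coordinate where it differs from \<open>q\<close>: so \<open>l\<close> is
    zero on this fibre but not at \<open>q\<close>.\<close>
  define l where "l y = (\<Prod>z\<in>Fq. y $ i z - z $ i z)" for y
  have l: "sephol l UNIV" "tame l" "laurent_on_torus l"
    unfolding l_def
    by (intro sephol_prod sephol_diff sephol_nth sephol_const tame_prod tame_diff tame_nth tame_const
        laurent_on_torus_prod laurent_on_torus_diff laurent_on_torus_nth laurent_on_torus_const)+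
  interpret M: analytic_multifunction "graph l UNIV" "Inr False" "Inr True"
    by (rule analytic_multifunction_graph[OF l(1,2)])
  have fib: "u \<in> M.fib w \<longleftrightarrow> (\<exists>z\<in>C. proj z = w \<and> l z = u)" for u w
    unfolding M.fib_def by (auto simp: mem_graph_UNIV)
  obtain N n e c where "\<forall>w u. w \<noteq> 0 \<longrightarrow>
      (u \<in> M.fib w \<longleftrightarrow> (\<Sum>k\<le>N. (\<Sum>j\<le>n. c k j * w ^ j) / w ^ e * u ^ k) = 0)"
    using M.fib_algebraic by (elim exE)
  then have c: "u \<in> M.fib w \<longleftrightarrow> (\<Sum>k\<le>N. (\<Sum>j\<le>n. c k j * w ^ j) / w ^ e * u ^ k) = 0" if "w \<noteq> 0" for w u
    using that by blast
  \<comment> \<open>Division by w ^ e is written with the monomial of exponents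
    \<open>- a i\<close>, which keeps \<open>P\<close> a Laurent polynomial on the torus.\<close>
  define P where "P z = (\<Sum>k\<le>N. (\<Sum>j\<le>n. c k j * proj z ^ j) * laurent_monomial (\<lambda>i. - a i) z ^ e * l z ^ k)" for z
  have P: "P z = 0 \<longleftrightarrow> l z \<in> M.fib (proj z)" if "z \<in> complex_torus" for z
    unfolding c[OF laurent_monomial_nonzero[OF that]] P_def laurent_monomial_uminus
    by (simp add: divide_inverse power_inverse)
  have "laurent_on_torus P" unfolding P_def
    by (intro laurent_on_torus_sum laurent_on_torus_mult laurent_on_torus_power laurent_on_torus_const
        laurent_on_torus_monomial l(3))
  moreover have "P z = 0" if "z \<in> C" for z
    using P[of z] that C_subset fib by blast
  moreover have "P q \<noteq> 0"
  proof
    assume "P q = 0"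
    then obtain z where "z \<in> C" "proj z = proj q" "l z = l q" using P[OF q(1)] fib by blast
    then have "z \<in> Fq" by (simp add: Fq_def)
    then have "l z = 0" unfolding l_def using fin by (intro prod_zero) auto
    moreover have "l q \<noteq> 0" unfolding l_def using i fin by auto
    ultimately show False using \<open>l z = l q\<close> by simp
  qed
  ultimately show ?thesis by blast
qed

theorem algebraic: "algebraic_in_torus C"
  unfolding algebraic_in_torus_def
proof (intro exI conjI)
  let ?F = "{f. laurent_polynomial f \<and> (\<forall>z\<in>C. f z = 0)}"
  show "\<forall>f\<in>?F. laurent_polynomial f" by blast
  have "q \<in> C" if q: "q \<in> complex_torus" "\<forall>f\<in>?F. f q = 0" for q
  proof (rule ccontr)
    assume "q \<notin> C"
    then obtain P where P: "laurent_on_torus P" "\<forall>z\<in>C. P z = 0" "P q \<noteq> 0"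
      using laurent_separation q(1) by blast
    then obtain f where f: "laurent_polynomial f" "\<And>z. z \<in> complex_torus \<Longrightarrow> f z = P z"
      unfolding laurent_on_torus_def by blast
    then have "f \<in> ?F" using P(2) C_subset by auto
    then show False using q f(2) P(3) by force
  qed
  then show "C = {z\<in>complex_torus. \<forall>f\<in>?F. f z = 0}" using C_subset by blast
qed

end

theorem theorem0p2:
  fixes C :: "(complex ^ 'n) set"
  assumes "closed_analytic_curve complex_torus C"
    and "finite (irreducible_components complex_torus C)"
    and "finite (log_limit_set C)"
  shows "algebraic_in_torus C"
proof -
  have C: "closed_analytic_subset complex_torus C" "pure_dimensional C 1"
    using assms(1) by (auto simp: closed_analytic_curve_def)
  have "0 \<notin> log_limit_set C" by (simp add: log_limit_set_def)
  from exists_exponent_vector[OF assms(3) this] obtain a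
    where "\<forall>\<xi>\<in>log_limit_set C. (\<Sum>i\<in>UNIV. of_int (a i) * \<xi> $ i) \<noteq> 0" ..
  from Log_map_bounded_by_exponent[OF this] obtain R :: nat where
    "\<forall>z\<in>C. norm (Log_map z) \<le> R + R * \<bar>\<Sum>i\<in>UNIV. of_int (a i) * Log_map z $ i\<bar>" ..
  then have R: "norm (Log_map z) \<le> R + R * \<bar>\<Sum>i\<in>UNIV. of_int (a i) * Log_map z $ i\<bar>" if "z \<in> C" for z
    using that by (rule bspec)
  have sub: "z \<in> complex_torus" if "z \<in> C" for z
    using C(1) that by (auto simp: closed_analytic_subset_def)
  interpret proper_curve C a "exp R" R
  proof
    show "infinite (C \<inter> V)" if "p \<in> C" "p \<in> V" "open V" for p V
      by (rule pure_dimensional_1_imp_nonisolated[OF C(2) that])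
  qed (use C(1) coordinate_growth[OF sub R] in auto)
  show ?thesis by (rule algebraic)
qed

end
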